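(* Let $(R,\mathfrak m)$ be a Noetherian local ring with infinite residue field. Let $\mathcal P$ be a finite (possibly empty) subset of $\mathrm{Spec}(R)$. Let $E$ be a finitely generated $R$-module having a rank $e>0$. Let $s\ge 1$ be an integer. Let $W$ be a submodule of $E$ such that $\mathrm{ht}(W:_R E)\ge s$. Suppose that $E$ satisfies $\mathrm{G}_s$. Then there exist elements $a_1,\dots,a_s$ in $W$ such that for every $0\le i\le s$ and every subset $\{v_1,\dots,v_i\}$ (of cardinality $i$) of $\{1,\dots,s\}$: (1) $\mu\big((W/\sum_{j=1}^s Ra_j)_{\mathfrak p}\big)=\max\{0,\ \mu(W_{\mathfrak p})-s\}$ whenever $\mathfrak p\in\mathcal P$; (2) $\mathrm{ht}\big(\sum_{j=1}^i Ra_{v_j}:_R E\big)\ge i-e+1$.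
   Context: A finitely generated $R$-module $E$ has rank $e$ if $E\otimes_R \mathrm{Quot}(R)$ is free of rank $e$ over the total ring of quotients $\mathrm{Quot}(R)$. $\mu(-)$ denotes the minimal number of generators. For an integer $s\ge1$, a module $E$ of rank $e$ satisfies $\mathrm{G}_s$ if $\mu(E_{\mathfrak p})\le\dim R_{\mathfrak p}+e-1$ for all primes $\mathfrak p$ with $1\le\dim R_{\mathfrak p}\le s-1$. For submodules $U\subseteq E$, $(U:_R E)=\{r\in R: rE\subseteq U\}$. $\mathrm{ht}$ denotes height, with the unit ideal having height $\infty$. *)

theory Defs
  imports "HOL-Algebra.Algebra" "HOL-Library.Extended_Nat"
begin

definition local_ring :: "('a, 'r) ring_scheme \<Rightarrow> bool" where
  "local_ring R \<longleftrightarrow> cring R \<and> (\<exists>!\<mm>. maximalideal \<mm> R)"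

definition prime_chain :: "('a, 'r) ring_scheme \<Rightarrow> nat \<Rightarrow> (nat \<Rightarrow> 'a set) \<Rightarrow> bool" where
  "prime_chain R n c \<longleftrightarrow> (\<forall>i\<le>n. primeideal (c i) R) \<and> (\<forall>i<n. c i \<subset> c (Suc i))"

definition krull_dim :: "('a, 'r) ring_scheme \<Rightarrow> enat" where
  "krull_dim R = Sup {enat n | n. \<exists>c. prime_chain R n c}"

definition prime_height :: "('a, 'r) ring_scheme \<Rightarrow> 'a set \<Rightarrow> enat" where
  "prime_height R \<pp> = Sup {enat n | n. \<exists>c. prime_chain R n c \<and> c n = \<pp>}"

text \<open>For the unit ideal this is the infimum of the empty set, i.e. infinity.\<close>

definition height :: "('a, 'r) ring_scheme \<Rightarrow> 'a set \<Rightarrow> enat" where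
  "height R I = Inf {prime_height R \<pp> | \<pp>. primeideal \<pp> R \<and> I \<subseteq> \<pp>}"

definition fam_span ::
    "('a, 'r) ring_scheme \<Rightarrow> ('a, 'b, 'm) module_scheme \<Rightarrow> ('i \<Rightarrow> 'b) \<Rightarrow> 'i set \<Rightarrow> 'b set" where
  "fam_span R M a J =
     {\<Oplus>\<^bsub>M\<^esub>j\<in>J. r j \<odot>\<^bsub>M\<^esub> a j | r. r \<in> J \<rightarrow> carrier R}"

definition generated_by ::
    "('a, 'r) ring_scheme \<Rightarrow> ('a, 'b, 'm) module_scheme \<Rightarrow> nat \<Rightarrow> bool" where
  "generated_by R M n \<longleftrightarrow>
     (\<exists>x. x \<in> {..<n} \<rightarrow> carrier M \<and> fam_span R M x {..<n} = carrier M)"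

definition fin_gen :: "('a, 'r) ring_scheme \<Rightarrow> ('a, 'b, 'm) module_scheme \<Rightarrow> bool" where
  "fin_gen R M \<longleftrightarrow> (\<exists>n. generated_by R M n)"

text \<open>The value is infinity if \<open>M\<close> is not finitely generated.\<close>

definition min_gens :: "('a, 'r) ring_scheme \<Rightarrow> ('a, 'b, 'm) module_scheme \<Rightarrow> enat" where
  "min_gens R M = Inf {enat n | n. generated_by R M n}"

definition free_of_rank ::
    "('a, 'r) ring_scheme \<Rightarrow> ('a, 'b, 'm) module_scheme \<Rightarrow> nat \<Rightarrow> bool" where
  "free_of_rank R M e \<longleftrightarrow>
     (\<exists>x. x \<in> {..<e} \<rightarrow> carrier M \<and> fam_span R M x {..<e} = carrier M \<and>
        (\<forall>r \<in> {..<e} \<rightarrow> carrier R.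
           (\<Oplus>\<^bsub>M\<^esub>j\<in>{..<e}. r j \<odot>\<^bsub>M\<^esub> x j) = \<zero>\<^bsub>M\<^esub> \<longrightarrow> (\<forall>j<e. r j = \<zero>\<^bsub>R\<^esub>)))"

definition colon ::
    "('a, 'r) ring_scheme \<Rightarrow> ('a, 'b, 'm) module_scheme \<Rightarrow> 'b set \<Rightarrow> 'a set" where
  "colon R E U = {r \<in> carrier R. \<forall>x \<in> carrier E. r \<odot>\<^bsub>E\<^esub> x \<in> U}"

text \<open>
  In the records for modules below, the fields \<open>mult\<close> and \<open>one\<close>, which the library's module record
  inherits from rings, carry no meaning. Operations on equivalence classes are written as unions
  over all representatives; the value does not depend on these, so each union is a single class.
\<close>

definition quot_module :: "('a, 'b, 'm) module_scheme \<Rightarrow> 'b set \<Rightarrow> ('a, 'b set) module" where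
  "quot_module M N =
     \<lparr>carrier = a_rcosets\<^bsub>M\<^esub> N, monoid.mult = undefined, one = undefined,
      ring.zero = N, ring.add = set_add M,
      smult = (\<lambda>r A. \<Union>x\<in>A. N +>\<^bsub>M\<^esub> (r \<odot>\<^bsub>M\<^esub> x))\<rparr>"

definition loc_rel :: "'a set \<Rightarrow> ('a, 'b, 'm) module_scheme \<Rightarrow> (('b \<times> 'a) \<times> ('b \<times> 'a)) set" where
  "loc_rel S M =
     {((x, s), (y, t)). x \<in> carrier M \<and> s \<in> S \<and> y \<in> carrier M \<and> t \<in> S \<and>
        (\<exists>u\<in>S. u \<odot>\<^bsub>M\<^esub> (t \<odot>\<^bsub>M\<^esub> x) = u \<odot>\<^bsub>M\<^esub> (s \<odot>\<^bsub>M\<^esub> y))}"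

definition loc_frac :: "'a set \<Rightarrow> ('a, 'b, 'm) module_scheme \<Rightarrow> 'b \<Rightarrow> 'a \<Rightarrow> ('b \<times> 'a) set" where
  "loc_frac S M x s = loc_rel S M `` {(x, s)}"

definition loc_module ::
    "('a, 'r) ring_scheme \<Rightarrow> 'a set \<Rightarrow> ('a, 'b, 'm) module_scheme
       \<Rightarrow> (('a \<times> 'a) set, ('b \<times> 'a) set) module" where
  "loc_module R S M =
     \<lparr>carrier = (carrier M \<times> S) // loc_rel S M, monoid.mult = undefined, one = undefined,
      ring.zero = loc_frac S M \<zero>\<^bsub>M\<^esub> \<one>\<^bsub>R\<^esub>,
      ring.add = (\<lambda>A B. \<Union>(x, s)\<in>A. \<Union>(y, t)\<in>B.
               loc_frac S M (t \<odot>\<^bsub>M\<^esub> x \<oplus>\<^bsub>M\<^esub> s \<odot>\<^bsub>M\<^esub> y) (s \<otimes>\<^bsub>R\<^esub> t)),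
      smult = (\<lambda>Q A. \<Union>(a, s)\<in>Q. \<Union>(x, t)\<in>A. loc_frac S M (a \<odot>\<^bsub>M\<^esub> x) (s \<otimes>\<^bsub>R\<^esub> t))\<rparr>"

definition self_module :: "('a, 'r) ring_scheme \<Rightarrow> ('a, 'a) module" where
  "self_module R =
     \<lparr>carrier = carrier R, monoid.mult = monoid.mult R, one = one R,
      ring.zero = ring.zero R, ring.add = ring.add R, smult = monoid.mult R\<rparr>"

definition loc_ring :: "('a, 'r) ring_scheme \<Rightarrow> 'a set \<Rightarrow> ('a \<times> 'a) set ring" where
  "loc_ring R S =
     (let L = loc_module R S (self_module R)
      in \<lparr>carrier = carrier L, monoid.mult = smult L, one = loc_frac S (self_module R) \<one>\<^bsub>R\<^esub> \<one>\<^bsub>R\<^esub>,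
          ring.zero = ring.zero L, ring.add = ring.add L\<rparr>)"

abbreviation ring_at :: "('a, 'r) ring_scheme \<Rightarrow> 'a set \<Rightarrow> ('a \<times> 'a) set ring" where
  "ring_at R \<pp> \<equiv> loc_ring R (carrier R - \<pp>)"

abbreviation module_at ::
    "('a, 'r) ring_scheme \<Rightarrow> 'a set \<Rightarrow> ('a, 'b, 'm) module_scheme
       \<Rightarrow> (('a \<times> 'a) set, ('b \<times> 'a) set) module" where
  "module_at R \<pp> M \<equiv> loc_module R (carrier R - \<pp>) M"

definition mu_at :: "('a, 'r) ring_scheme \<Rightarrow> 'a set \<Rightarrow> ('a, 'b, 'm) module_scheme \<Rightarrow> enat" where
  "mu_at R \<pp> M = min_gens (ring_at R \<pp>) (module_at R \<pp> M)"

definition regular_elements :: "('a, 'r) ring_scheme \<Rightarrow> 'a set" where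
  "regular_elements R =
     {s \<in> carrier R. \<forall>x \<in> carrier R. s \<otimes>\<^bsub>R\<^esub> x = \<zero>\<^bsub>R\<^esub> \<longrightarrow> x = \<zero>\<^bsub>R\<^esub>}"

abbreviation total_quotient_ring :: "('a, 'r) ring_scheme \<Rightarrow> ('a \<times> 'a) set ring" where
  "total_quotient_ring R \<equiv> loc_ring R (regular_elements R)"

definition to_total_quotient_ring :: "('a, 'r) ring_scheme \<Rightarrow> 'a \<Rightarrow> ('a \<times> 'a) set" where
  "to_total_quotient_ring R r = loc_frac (regular_elements R) (self_module R) r \<one>\<^bsub>R\<^esub>"

text \<open>
  The tensor product of an \<open>R\<close>-module \<open>M\<close> with an \<open>R\<close>-algebra \<open>Q\<close>, given by the structure map
  \<open>\<phi>\<close> from \<open>R\<close> to \<open>Q\<close>: the free abelian group on the pairs \<open>(x, q)\<close> modulo the usual relations,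
  with \<open>Q\<close> acting on the second factor.
\<close>

definition tensor_relations ::
    "('a, 'r) ring_scheme \<Rightarrow> ('q, 't) ring_scheme \<Rightarrow> ('a \<Rightarrow> 'q) \<Rightarrow> ('a, 'b, 'm) module_scheme
       \<Rightarrow> ('b \<times> 'q \<Rightarrow>\<^sub>0 int) set" where
  "tensor_relations R Q \<phi> M =
     {frag_of (x \<oplus>\<^bsub>M\<^esub> y, q) - frag_of (x, q) - frag_of (y, q) | x y q.
        x \<in> carrier M \<and> y \<in> carrier M \<and> q \<in> carrier Q} \<union>
     {frag_of (x, q \<oplus>\<^bsub>Q\<^esub> q') - frag_of (x, q) - frag_of (x, q') | x q q'.
        x \<in> carrier M \<and> q \<in> carrier Q \<and> q' \<in> carrier Q} \<union>
     {frag_of (r \<odot>\<^bsub>M\<^esub> x, q) - frag_of (x, \<phi> r \<otimes>\<^bsub>Q\<^esub> q) | r x q.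
        r \<in> carrier R \<and> x \<in> carrier M \<and> q \<in> carrier Q}"

definition base_change ::
    "('a, 'r) ring_scheme \<Rightarrow> ('q, 't) ring_scheme \<Rightarrow> ('a \<Rightarrow> 'q) \<Rightarrow> ('a, 'b, 'm) module_scheme
       \<Rightarrow> ('q, ('b \<times> 'q \<Rightarrow>\<^sub>0 int) set) module" where
  "base_change R Q \<phi> M =
     (let F = free_Abelian_group (carrier M \<times> carrier Q);
          H = generate F (tensor_relations R Q \<phi> M)
      in \<lparr>carrier = rcosets\<^bsub>F\<^esub> H, monoid.mult = undefined, one = undefined,
          ring.zero = H, ring.add = set_mult F,
          smult = (\<lambda>q A. \<Union>z\<in>A.
                     H #>\<^bsub>F\<^esub> frag_extend (\<lambda>(x, q'). frag_of (x, q \<otimes>\<^bsub>Q\<^esub> q')) z)\<rparr>)"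

definition has_rank ::
    "('a, 'r) ring_scheme \<Rightarrow> ('a, 'b, 'm) module_scheme \<Rightarrow> nat \<Rightarrow> bool" where
  "has_rank R E e \<longleftrightarrow>
     free_of_rank (total_quotient_ring R)
       (base_change R (total_quotient_ring R) (to_total_quotient_ring R) E) e"

text \<open>
  Meant for a module \<open>E\<close> of rank \<open>e\<close> and for \<open>s \<ge> 1\<close>. Neither subtraction on extended naturals
  truncates then, since the dimension is at least 1 in the second one.
\<close>

definition satisfies_G ::
    "('a, 'r) ring_scheme \<Rightarrow> ('a, 'b, 'm) module_scheme \<Rightarrow> nat \<Rightarrow> nat \<Rightarrow> bool" where
  "satisfies_G R E e s \<longleftrightarrow>
     (\<forall>\<pp>. primeideal \<pp> R \<and> 1 \<le> krull_dim (ring_at R \<pp>) \<and>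
          krull_dim (ring_at R \<pp>) \<le> enat s - 1 \<longrightarrow>
        mu_at R \<pp> E \<le> krull_dim (ring_at R \<pp>) + enat e - 1)"

end

theory Submission
  imports Defs
begin

text \<open>
  If \<open>W / U\<close> is finitely generated and nonzero at a prime \<open>\<pp>\<close>, then the elements of \<open>W\<close> that do not
  lower the local number of generators of \<open>W / U\<close> at \<open>\<pp>\<close> lie in a proper submodule of \<open>W\<close>. Over a
  local ring with infinite residue field a module is not a finite union of proper submodules, so an
  element of \<open>W\<close> can lower these numbers for finitely many pairs \<open>(U, \<pp>)\<close> at once.

  The \<open>a\<^sub>j\<close> are chosen successively, so that for every set \<open>V\<close> of indices and every prime \<open>\<qq>\<close> of
  height \<open>d < s\<close> the module \<open>E\<close> modulo the \<open>a\<^sub>j\<close> with \<open>j \<in> V\<close> needs at most \<open>max 0 (d + e - |V|)\<close>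
  generators at \<open>\<qq>\<close>. For \<open>V = {}\<close> this is the rank condition at \<open>d = 0\<close> and \<open>G\<^sub>s\<close> at \<open>d > 0\<close>. Passing
  from \<open>V\<close> to \<open>V \<union> {j}\<close> is a condition on \<open>a\<^sub>j\<close> only at the primes where the bound for \<open>V\<close> is
  attained and positive; these are finitely many, as they are minimal over one of finitely many
  ideals. Primes of height less than \<open>s\<close> do not contain \<open>W : E\<close>, so that \<open>E\<close> and \<open>W\<close> agree there. If
  \<open>d + e \<le> |V|\<close>, then \<open>E\<close> is generated by the \<open>a\<^sub>j\<close> at \<open>\<qq>\<close>, which is the height estimate.
\<close>

section \<open>Generators of modules up to denominators\<close>

text \<open>Local numbers of generators are handled inside the one module \<open>M\<close>:
  \<open>locally_generated\<close> clears denominators instead of forming localized or quotient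
  modules. So \<open>U\<close>, \<open>W\<close> and the prime can vary without a change of type,
  and the modules of the theorem are translated once, by \<open>generated_by_loc_iff\<close>,
  \<open>locally_generated_quot_module\<close> and \<open>base_change_generators\<close>. All bounds
  have the form of at most \<open>n\<close> generators, and the truncated difference
  \<open>n - 1\<close> supplies the maximum with 0.

  The conditions on a new element are finitely many because of the shape of the bound: it drops with
  the height unless it is already 0, whereas at an exceptional prime the bound lowered by one fails.
  Hence the locus where the lowered bound fails is contained in no smaller prime.

  The infinite residue field enters through infinitely many ring elements whose differences are
  units. With coefficients from such a set a line in \<open>W\<close> behaves as over an infinite
  field: it meets a submodule at most once if the submodule does not contain its direction.\<close>

definition adjoin :: "('a, 'b, 'm) module_scheme \<Rightarrow> 'a set \<Rightarrow> 'b set \<Rightarrow> 'b \<Rightarrow> 'b set" where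
  "adjoin M C U y = {u \<oplus>\<^bsub>M\<^esub> c \<odot>\<^bsub>M\<^esub> y | u c. u \<in> U \<and> c \<in> C}"

text \<open>The coefficient set \<open>C\<close> is a parameter because two choices occur:
  \<open>carrier R\<close> for the submodule generated by \<open>U\<close> and the list, and a prime
  for the combinations with all coefficients in it.\<close>

primrec lin_combs :: "('a, 'b, 'm) module_scheme \<Rightarrow> 'a set \<Rightarrow> 'b set \<Rightarrow> 'b list \<Rightarrow> 'b set" where
  "lin_combs M C U [] = U"
| "lin_combs M C U (y # ys) = adjoin M C (lin_combs M C U ys) y"

text \<open>At most \<open>n\<close> generators for the image of \<open>W\<close> in
  \<open>M / U\<close> after localization at \<open>S\<close>. The list has length exactly
  \<open>n\<close>, but its entries may be zero or repeat. The denominator may depend on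
  \<open>z\<close>; \<open>colon_meets_submonoid\<close> makes it uniform.\<close>

definition locally_generated ::
    "('a, 'r) ring_scheme \<Rightarrow> ('a, 'b, 'm) module_scheme \<Rightarrow> 'a set \<Rightarrow> 'b set \<Rightarrow> 'b set \<Rightarrow> nat \<Rightarrow> bool" where
  "locally_generated R M S W U n \<longleftrightarrow>
     (\<exists>ys. length ys = n \<and> set ys \<subseteq> W \<and>
        (\<forall>z\<in>W. \<exists>t\<in>S. t \<odot>\<^bsub>M\<^esub> z \<in> lin_combs M (carrier R) U ys))"

lemma adjoin_mono: "U \<subseteq> U' \<Longrightarrow> C \<subseteq> C' \<Longrightarrow> adjoin M C U y \<subseteq> adjoin M C' U' y"
  by (auto simp: adjoin_def)

lemma lin_combs_mono: "U \<subseteq> U' \<Longrightarrow> C \<subseteq> C' \<Longrightarrow> lin_combs M C U ys \<subseteq> lin_combs M C' U' ys"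
  by (induction ys) (simp_all add: adjoin_mono)

lemma adjoinI: "u \<in> U \<Longrightarrow> c \<in> C \<Longrightarrow> u \<oplus>\<^bsub>M\<^esub> c \<odot>\<^bsub>M\<^esub> y \<in> adjoin M C U y"
  by (auto simp: adjoin_def)

lemma adjoinE:
  assumes "x \<in> adjoin M C U y"
  obtains u c where "x = u \<oplus>\<^bsub>M\<^esub> c \<odot>\<^bsub>M\<^esub> y" "u \<in> U" "c \<in> C"
  using assms by (auto simp: adjoin_def)

context module
begin

lemmas submodule_subset = submoduleE(1)
lemmas submodule_neg = submoduleE(3)
lemmas submodule_smult = submoduleE(4)
lemmas submodule_add = submoduleE(5)

lemma submodule_zero: "submodule U R M \<Longrightarrow> \<zero>\<^bsub>M\<^esub> \<in> U"
  using subgroup.one_closed submodule.axioms(1) by fastforce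

lemma adjoin_closed:
  assumes "U \<subseteq> carrier M" "C \<subseteq> carrier R" "y \<in> carrier M"
  shows "adjoin M C U y \<subseteq> carrier M"
  using assms by (auto simp: adjoin_def)

lemma adjoin_submodule:
  assumes U: "submodule U R M" and y: "y \<in> carrier M"
  shows "submodule (adjoin M (carrier R) U y) R M"
proof (rule submoduleI)
  show "adjoin M (carrier R) U y \<subseteq> carrier M"
    using adjoin_closed submodule_subset[OF U] y by simp
  show "\<zero>\<^bsub>M\<^esub> \<in> adjoin M (carrier R) U y"
    using adjoinI[OF submodule_zero[OF U] R.zero_closed, of M y] y by simp
next
  fix x assume "x \<in> adjoin M (carrier R) U y"
  then obtain u c where x: "x = u \<oplus>\<^bsub>M\<^esub> c \<odot>\<^bsub>M\<^esub> y" "u \<in> U" "c \<in> carrier R" by (rule adjoinE)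
  have "\<ominus>\<^bsub>M\<^esub> x = \<ominus>\<^bsub>M\<^esub> u \<oplus>\<^bsub>M\<^esub> (\<ominus> c) \<odot>\<^bsub>M\<^esub> y"
    using x y submodule_subset[OF U, THEN subsetD] by (simp add: M.minus_add smult_l_minus)
  then show "\<ominus>\<^bsub>M\<^esub> x \<in> adjoin M (carrier R) U y"
    using x submodule_neg[OF U] by (auto intro!: adjoinI)
next
  fix x x' assume "x \<in> adjoin M (carrier R) U y" "x' \<in> adjoin M (carrier R) U y"
  then obtain u c u' c' where x: "x = u \<oplus>\<^bsub>M\<^esub> c \<odot>\<^bsub>M\<^esub> y" "u \<in> U" "c \<in> carrier R"
    and x': "x' = u' \<oplus>\<^bsub>M\<^esub> c' \<odot>\<^bsub>M\<^esub> y" "u' \<in> U" "c' \<in> carrier R" by (metis adjoinE)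
  have "x \<oplus>\<^bsub>M\<^esub> x' = (u \<oplus>\<^bsub>M\<^esub> u') \<oplus>\<^bsub>M\<^esub> (c \<oplus> c') \<odot>\<^bsub>M\<^esub> y"
    using x x' y submodule_subset[OF U, THEN subsetD] by (simp add: smult_l_distr M.a_ac)
  then show "x \<oplus>\<^bsub>M\<^esub> x' \<in> adjoin M (carrier R) U y"
    using x x' submodule_add[OF U] by (auto intro!: adjoinI)
next
  fix r x assume r: "r \<in> carrier R" and "x \<in> adjoin M (carrier R) U y"
  then obtain u c where x: "x = u \<oplus>\<^bsub>M\<^esub> c \<odot>\<^bsub>M\<^esub> y" "u \<in> U" "c \<in> carrier R" by (metis adjoinE)
  have "r \<odot>\<^bsub>M\<^esub> x = r \<odot>\<^bsub>M\<^esub> u \<oplus>\<^bsub>M\<^esub> (r \<otimes> c) \<odot>\<^bsub>M\<^esub> y"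
    using x r y submodule_subset[OF U, THEN subsetD] by (simp add: smult_r_distr smult_assoc1)
  then show "r \<odot>\<^bsub>M\<^esub> x \<in> adjoin M (carrier R) U y"
    using x r submodule_smult[OF U] by (auto intro!: adjoinI)
qed

lemma adjoin_superset:
  assumes "U \<subseteq> carrier M" "y \<in> carrier M" shows "U \<subseteq> adjoin M (carrier R) U y"
proof
  fix u assume "u \<in> U"
  then show "u \<in> adjoin M (carrier R) U y"
    using adjoinI[OF \<open>u \<in> U\<close> R.zero_closed, of M y] assms by auto
qed

lemma adjoin_self:
  assumes "submodule U R M" "y \<in> carrier M" shows "y \<in> adjoin M (carrier R) U y"
  using adjoinI[OF submodule_zero[OF assms(1)] R.one_closed, of M y] assms by simp

lemma adjoin_least:
  assumes "submodule V R M" "U \<subseteq> V" "y \<in> V" shows "adjoin M (carrier R) U y \<subseteq> V"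
  using assms submodule_add submodule_smult by (auto elim!: adjoinE)

lemma adjoin_commute:
  assumes "U \<subseteq> carrier M" "C \<subseteq> carrier R" "x \<in> carrier M" "y \<in> carrier M"
  shows "adjoin M C (adjoin M C U x) y = adjoin M C (adjoin M C U y) x"
proof -
  have "adjoin M C (adjoin M C U x) y \<subseteq> adjoin M C (adjoin M C U y) x"
    if xy: "x \<in> carrier M" "y \<in> carrier M" for x y
  proof
    fix z assume "z \<in> adjoin M C (adjoin M C U x) y"
    then obtain u c d where z: "z = (u \<oplus>\<^bsub>M\<^esub> c \<odot>\<^bsub>M\<^esub> x) \<oplus>\<^bsub>M\<^esub> d \<odot>\<^bsub>M\<^esub> y" "u \<in> U" "c \<in> C" "d \<in> C"
      by (metis adjoinE)
    moreover have "u \<in> carrier M" "c \<in> carrier R" "d \<in> carrier R" using z assms by auto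
    ultimately have eq: "z = (u \<oplus>\<^bsub>M\<^esub> d \<odot>\<^bsub>M\<^esub> y) \<oplus>\<^bsub>M\<^esub> c \<odot>\<^bsub>M\<^esub> x"
      using xy by (simp add: M.a_ac)
    show "z \<in> adjoin M C (adjoin M C U y) x"
      unfolding eq by (intro adjoinI z(2-4))
  qed
  from this[OF assms(3,4)] this[OF assms(4,3)] show ?thesis by (rule equalityI)
qed

lemma lin_combs_closed:
  assumes "U \<subseteq> carrier M" "C \<subseteq> carrier R" "set ys \<subseteq> carrier M"
  shows "lin_combs M C U ys \<subseteq> carrier M"
  using assms by (induction ys) (simp_all add: adjoin_closed)

lemma lin_combs_submodule:
  assumes "submodule U R M" "set ys \<subseteq> carrier M"
  shows "submodule (lin_combs M (carrier R) U ys) R M"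
  using assms by (induction ys) (simp_all add: adjoin_submodule)

lemma lin_combs_superset:
  assumes "V \<subseteq> carrier M" "set ys \<subseteq> carrier M" shows "V \<subseteq> lin_combs M (carrier R) V ys"
  using assms(2)
proof (induction ys)
  case (Cons y ys)
  then show ?case
    using adjoin_superset[of "lin_combs M (carrier R) V ys" y] lin_combs_closed[OF assms(1), of "carrier R" ys]
    by auto
qed simp

lemma lin_combs_adjoin:
  assumes "U \<subseteq> carrier M" "C \<subseteq> carrier R" "x \<in> carrier M" "set ys \<subseteq> carrier M"
  shows "lin_combs M C (adjoin M C U x) ys = adjoin M C (lin_combs M C U ys) x"
  using assms by (induction ys) (simp_all add: adjoin_commute lin_combs_closed)

lemma lin_combs_rotate:
  assumes "U \<subseteq> carrier M" "C \<subseteq> carrier R" "x \<in> carrier M" "set ys \<subseteq> carrier M"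
    "set zs \<subseteq> carrier M"
  shows "lin_combs M C U (ys @ x # zs) = adjoin M C (lin_combs M C U (ys @ zs)) x"
  using assms by (induction ys) (simp_all add: adjoin_commute lin_combs_closed)

lemma lin_combs_least:
  assumes "submodule V R M" "U \<subseteq> V" "set ys \<subseteq> V"
  shows "lin_combs M (carrier R) U ys \<subseteq> V"
  using assms by (induction ys) (simp_all add: adjoin_least)

text \<open>\<open>U\<close> absorbs multiplication by \<open>t\<close>, and the factor moves onto
  the generators. This is how generators of \<open>M\<close> are pushed into a submodule that
  contains all multiples by \<open>t\<close>.\<close>

lemma lin_combs_smult:
  assumes U: "submodule U R M" and t: "t \<in> carrier R" and "set ys \<subseteq> carrier M"
    and "w \<in> lin_combs M (carrier R) U ys"
  shows "t \<odot>\<^bsub>M\<^esub> w \<in> lin_combs M (carrier R) U (map ((\<odot>\<^bsub>M\<^esub>) t) ys)"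
  using assms(3,4)
proof (induction ys arbitrary: w)
  case Nil
  then show ?case using U t by (simp add: submodule_smult)
next
  case (Cons y ys)
  then obtain v c where w: "w = v \<oplus>\<^bsub>M\<^esub> c \<odot>\<^bsub>M\<^esub> y" "v \<in> lin_combs M (carrier R) U ys" "c \<in> carrier R"
    by (auto elim: adjoinE)
  have "v \<in> carrier M"
    using w lin_combs_closed[of U "carrier R" ys] submodule_subset[OF U] Cons.prems by auto
  then have "t \<odot>\<^bsub>M\<^esub> w = t \<odot>\<^bsub>M\<^esub> v \<oplus>\<^bsub>M\<^esub> c \<odot>\<^bsub>M\<^esub> (t \<odot>\<^bsub>M\<^esub> y)"
    using w t Cons.prems by (simp add: smult_r_distr smult_assoc1[symmetric] R.m_comm)
  then show ?case using Cons w by (auto intro!: adjoinI)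
qed

text \<open>Look for a coefficient outside \<open>I\<close>. If there is one, its generator is
  singled out; for a prime \<open>I\<close> that coefficient is a denominator, so the generator can
  be exchanged for \<open>a\<close>.\<close>

lemma split_lin_combs:
  assumes "U \<subseteq> carrier M" "set ys \<subseteq> carrier M" "a \<in> lin_combs M (carrier R) U ys"
  shows "a \<in> lin_combs M I U ys \<or>
    (\<exists>ys1 y ys2 v r. ys = ys1 @ y # ys2 \<and> v \<in> lin_combs M (carrier R) U (ys1 @ ys2) \<and>
       r \<in> carrier R - I \<and> a = v \<oplus>\<^bsub>M\<^esub> r \<odot>\<^bsub>M\<^esub> y)"
  using assms
proof (induction ys arbitrary: a)
  case (Cons y ys)
  then obtain v r where a: "a = v \<oplus>\<^bsub>M\<^esub> r \<odot>\<^bsub>M\<^esub> y" "v \<in> lin_combs M (carrier R) U ys" "r \<in> carrier R"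
    by (auto elim: adjoinE)
  show ?case
  proof (cases "r \<in> I")
    case False
    then show ?thesis using a by (metis DiffI append_Nil)
  next
    case r: True
    consider "v \<in> lin_combs M I U ys"
      | ys1 y' ys2 v' r' where "ys = ys1 @ y' # ys2" "v' \<in> lin_combs M (carrier R) U (ys1 @ ys2)"
         "r' \<in> carrier R - I" "v = v' \<oplus>\<^bsub>M\<^esub> r' \<odot>\<^bsub>M\<^esub> y'"
      using Cons.IH[OF Cons.prems(1) _ a(2)] Cons.prems(2) by (simp del: Diff_iff) blast
    then show ?thesis
    proof cases
      case 1
      then show ?thesis using a r by (auto intro: adjoinI)
    next
      case 2
      have "v' \<in> carrier M"
        using lin_combs_closed[of U "carrier R" "ys1 @ ys2"] 2 Cons.prems by auto
      then have "a = (v' \<oplus>\<^bsub>M\<^esub> r \<odot>\<^bsub>M\<^esub> y) \<oplus>\<^bsub>M\<^esub> r' \<odot>\<^bsub>M\<^esub> y'"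
        using a 2 Cons.prems by (simp add: M.a_ac)
      moreover have "v' \<oplus>\<^bsub>M\<^esub> r \<odot>\<^bsub>M\<^esub> y \<in> lin_combs M (carrier R) U ((y # ys1) @ ys2)"
        using 2 a by (auto intro: adjoinI)
      moreover have "y # ys = (y # ys1) @ y' # ys2" using 2 by simp
      ultimately show ?thesis using 2 by metis
    qed
  qed
qed simp

lemma locally_generated_0:
  "locally_generated R M S W U 0 \<longleftrightarrow> (\<forall>z\<in>W. \<exists>t\<in>S. t \<odot>\<^bsub>M\<^esub> z \<in> U)"
  by (simp add: locally_generated_def)

lemma locally_generated_mono_submodule:
  assumes "locally_generated R M S W U n" "U \<subseteq> U'"
  shows "locally_generated R M S W U' n"
  using assms lin_combs_mono[OF assms(2) subset_refl] unfolding locally_generated_def by blast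

text \<open>The list is padded with zeros, which lie in \<open>W\<close>.\<close>

lemma locally_generated_mono:
  assumes "locally_generated R M S W U n" "n \<le> m" and W: "submodule W R M" and U: "U \<subseteq> carrier M"
  shows "locally_generated R M S W U m"
  using assms(2)
proof (induction m rule: dec_induct)
  case (step m)
  then obtain ys where ys: "length ys = m" "set ys \<subseteq> W"
    "\<forall>z\<in>W. \<exists>t\<in>S. t \<odot>\<^bsub>M\<^esub> z \<in> lin_combs M (carrier R) U ys"
    unfolding locally_generated_def by blast
  have "lin_combs M (carrier R) U ys \<subseteq> lin_combs M (carrier R) U (\<zero>\<^bsub>M\<^esub> # ys)"
    using adjoin_superset lin_combs_closed[OF U subset_refl, of ys] ys(2) submodule_subset[OF W] by auto
  then have "\<forall>z\<in>W. \<exists>t\<in>S. t \<odot>\<^bsub>M\<^esub> z \<in> lin_combs M (carrier R) U (\<zero>\<^bsub>M\<^esub> # ys)"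
    using ys(3) by blast
  then show ?case
    unfolding locally_generated_def using ys(1,2) submodule_zero[OF W]
    by (intro exI[of _ "\<zero>\<^bsub>M\<^esub> # ys"]) (simp del: lin_combs.simps)
qed (rule assms)

text \<open>The element \<open>a\<close> becomes a generator itself. This is the lower bound: one
  element cannot reduce the number of generators by more than one.\<close>

lemma locally_generated_adjoinD:
  assumes "locally_generated R M S W (adjoin M (carrier R) U a) n" "a \<in> W"
    and W: "submodule W R M" and U: "U \<subseteq> carrier M"
  shows "locally_generated R M S W U (Suc n)"
proof -
  obtain ys where ys: "length ys = n" "set ys \<subseteq> W"
    "\<forall>z\<in>W. \<exists>t\<in>S. t \<odot>\<^bsub>M\<^esub> z \<in> lin_combs M (carrier R) (adjoin M (carrier R) U a) ys"
    using assms(1) unfolding locally_generated_def by blast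
  have "lin_combs M (carrier R) (adjoin M (carrier R) U a) ys = lin_combs M (carrier R) U (a # ys)"
    using lin_combs_adjoin[OF U subset_refl, of a ys] assms(2) ys(2) submodule_subset[OF W] by auto
  then show ?thesis
    unfolding locally_generated_def using ys assms(2) by (intro exI[of _ "a # ys"]) auto
qed

text \<open>A denominator \<open>t\<close> that carries \<open>M\<close> into \<open>W\<close> makes
  the two equal after localization. From \<open>W\<close> to \<open>M\<close> the denominators are
  multiplied by \<open>t\<close>; from \<open>M\<close> to \<open>W\<close> the generators are, so
  that they lie in \<open>W\<close>.\<close>

lemma locally_generated_restrict:
  assumes S: "submonoid S R" and W: "submodule W R M" and U: "submodule U R M"
    and t: "t \<in> S" "t \<in> colon R M W"
  shows "locally_generated R M S W U n \<longleftrightarrow> locally_generated R M S (carrier M) U n"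
proof
  note Sc = submonoid.subset[OF S, THEN subsetD]
  note Sm = submonoid.m_closed[OF S]
  have tW: "t \<odot>\<^bsub>M\<^esub> z \<in> W" if "z \<in> carrier M" for z using t that by (auto simp: colon_def)
  {
    assume "locally_generated R M S W U n"
    then obtain ys where ys: "length ys = n" "set ys \<subseteq> W"
      "\<forall>z\<in>W. \<exists>t\<in>S. t \<odot>\<^bsub>M\<^esub> z \<in> lin_combs M (carrier R) U ys"
      unfolding locally_generated_def by blast
    have "\<exists>t\<in>S. t \<odot>\<^bsub>M\<^esub> z \<in> lin_combs M (carrier R) U ys" if z: "z \<in> carrier M" for z
    proof -
      obtain t' where t': "t' \<in> S" "t' \<odot>\<^bsub>M\<^esub> (t \<odot>\<^bsub>M\<^esub> z) \<in> lin_combs M (carrier R) U ys"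
        using ys(3) tW[OF z] by blast
      then show ?thesis using Sm[OF t'(1) t(1)] z t(1)
        by (intro bexI[of _ "t' \<otimes> t"]) (simp_all add: smult_assoc1 Sc)
    qed
    then show "locally_generated R M S (carrier M) U n"
      unfolding locally_generated_def using ys submodule_subset[OF W] by blast
  }
  {
    assume "locally_generated R M S (carrier M) U n"
    then obtain ys where ys: "length ys = n" "set ys \<subseteq> carrier M"
      "\<forall>z\<in>carrier M. \<exists>t\<in>S. t \<odot>\<^bsub>M\<^esub> z \<in> lin_combs M (carrier R) U ys"
      unfolding locally_generated_def by blast
    have "\<exists>t'\<in>S. t' \<odot>\<^bsub>M\<^esub> z \<in> lin_combs M (carrier R) U (map ((\<odot>\<^bsub>M\<^esub>) t) ys)" if z: "z \<in> W" for z
    proof -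
      have zc: "z \<in> carrier M" using z submodule_subset[OF W] by blast
      then obtain t' where t': "t' \<in> S" "t' \<odot>\<^bsub>M\<^esub> z \<in> lin_combs M (carrier R) U ys"
        using ys(3) by blast
      have "t \<odot>\<^bsub>M\<^esub> (t' \<odot>\<^bsub>M\<^esub> z) \<in> lin_combs M (carrier R) U (map ((\<odot>\<^bsub>M\<^esub>) t) ys)"
        using lin_combs_smult[OF U _ ys(2) t'(2)] t Sc by blast
      then show ?thesis using Sm[OF t(1) t'(1)] zc t(1) t'(1)
        by (intro bexI[of _ "t \<otimes> t'"]) (simp_all add: smult_assoc1 Sc)
    qed
    moreover have "set (map ((\<odot>\<^bsub>M\<^esub>) t) ys) \<subseteq> W" using ys(2) tW by auto
    ultimately show "locally_generated R M S W U n"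
      unfolding locally_generated_def using ys(1) by (intro exI[of _ "map ((\<odot>\<^bsub>M\<^esub>) t) ys"]) auto
  }
qed

end

section \<open>Avoiding proper submodules, and elements of minimal generating systems\<close>

lemma primeideal_complement_submonoid:
  assumes "primeideal \<pp> R" shows "submonoid (carrier R - \<pp>) R"
proof -
  interpret primeideal \<pp> R by fact
  have "\<one>\<^bsub>R\<^esub> \<notin> \<pp>" using I_notcarr one_imp_carrier by blast
  then show ?thesis using I_prime by (auto intro!: submonoid.intro)
qed

context module
begin

text \<open>Submodules satisfy this, and so does the empty set, which serves as the excluded set
  when no condition is to be imposed.\<close>

definition smult_add_closed :: "'c set \<Rightarrow> bool" where
  "smult_add_closed N \<longleftrightarrow> (\<forall>r\<in>carrier R. \<forall>x\<in>N. \<forall>y\<in>N. r \<odot>\<^bsub>M\<^esub> x \<oplus>\<^bsub>M\<^esub> y \<in> N)"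

text \<open>Take \<open>x\<close> outside the sets treated so far and \<open>y\<close> outside the
  new set \<open>N\<close>. If \<open>x\<close> lies in \<open>N\<close>, then the line of points
  \<open>y + c x\<close> misses \<open>N\<close>, and each older set contains at most one of them:
  two would give \<open>(c - d) x\<close> and hence \<open>x\<close>, as \<open>c - d\<close> is a
  unit. Infinitely many \<open>c\<close> leave a point outside all sets.\<close>

lemma avoid_finite_union:
  assumes W: "submodule W R M"
    and C: "infinite C" "C \<subseteq> carrier R" "\<And>c d. c \<in> C \<Longrightarrow> d \<in> C \<Longrightarrow> c \<noteq> d \<Longrightarrow> c \<ominus> d \<in> Units R"
    and "finite \<N>" "\<forall>N\<in>\<N>. N \<subset> W \<and> smult_add_closed N"
  shows "\<exists>a\<in>W. a \<notin> \<Union>\<N>"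
  using assms(5,6)
proof (induction \<N>)
  case empty
  then show ?case using submodule_zero[OF W] by auto
next
  case (insert N \<N>)
  note Wc = submodule_subset[OF W, THEN subsetD]
  obtain x where x: "x \<in> W" "x \<notin> \<Union>\<N>" using insert by auto
  show ?case
  proof (cases "x \<in> N")
    case False
    then show ?thesis using x by auto
  next
    case xN: True
    obtain y where y: "y \<in> W" "y \<notin> N" using insert.prems by auto
    have N: "smult_add_closed N" using insert.prems by auto
    \<comment> \<open>From \<open>y + c x\<close> in \<open>N\<close> and \<open>x\<close> in
      \<open>N\<close> the element \<open>y\<close> would be recovered in \<open>N\<close>.\<close>
    have f: "y \<oplus>\<^bsub>M\<^esub> c \<odot>\<^bsub>M\<^esub> x \<in> W - N" if c: "c \<in> C" for c
    proof -
      have "(\<ominus> c) \<odot>\<^bsub>M\<^esub> x \<oplus>\<^bsub>M\<^esub> (y \<oplus>\<^bsub>M\<^esub> c \<odot>\<^bsub>M\<^esub> x) = ((\<ominus> c) \<odot>\<^bsub>M\<^esub> x \<oplus>\<^bsub>M\<^esub> c \<odot>\<^bsub>M\<^esub> x) \<oplus>\<^bsub>M\<^esub> y"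
        using x y c C Wc by (auto simp: M.a_ac)
      also have "\<dots> = y"
        using x y c C(2) Wc by (auto simp: smult_l_distr[symmetric] R.l_neg)
      finally have "y \<oplus>\<^bsub>M\<^esub> c \<odot>\<^bsub>M\<^esub> x \<notin> N"
        using N xN y(2) c C(2) unfolding smult_add_closed_def by (metis R.a_inv_closed subsetD)
      then show ?thesis using x y c C(2) submodule_add[OF W] submodule_smult[OF W] by auto
    qed
    show ?thesis
    proof (rule ccontr)
      assume "\<not> ?thesis"
      then have "\<forall>c\<in>C. \<exists>N'\<in>\<N>. y \<oplus>\<^bsub>M\<^esub> c \<odot>\<^bsub>M\<^esub> x \<in> N'" using f by blast
      then obtain g where g: "\<And>c. c \<in> C \<Longrightarrow> g c \<in> \<N> \<and> y \<oplus>\<^bsub>M\<^esub> c \<odot>\<^bsub>M\<^esub> x \<in> g c" by metis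
      \<comment> \<open>Pigeonhole: infinitely many coefficients, finitely many sets, so two points
        of the line lie in the same set.\<close>
      have "\<not> inj_on g C"
        using finite_imageD[of g C] C(1) insert.hyps(1) finite_subset[of "g ` C" \<N>] g by auto
      then obtain c d where cd: "c \<in> C" "d \<in> C" "c \<noteq> d" "g c = g d" by (auto simp: inj_on_def)
      define N' where "N' = g c"
      have N': "smult_add_closed N'" "N' \<in> \<N>" "y \<oplus>\<^bsub>M\<^esub> c \<odot>\<^bsub>M\<^esub> x \<in> N'" "y \<oplus>\<^bsub>M\<^esub> d \<odot>\<^bsub>M\<^esub> x \<in> N'"
        using insert.prems g cd by (auto simp: N'_def)
      have carr: "c \<in> carrier R" "d \<in> carrier R" "x \<in> carrier M" "y \<in> carrier M"
        using cd C(2) x y Wc by auto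
      have "(\<ominus> \<one>) \<odot>\<^bsub>M\<^esub> (y \<oplus>\<^bsub>M\<^esub> d \<odot>\<^bsub>M\<^esub> x) \<oplus>\<^bsub>M\<^esub> (y \<oplus>\<^bsub>M\<^esub> c \<odot>\<^bsub>M\<^esub> x) \<in> N'"
        using N' unfolding smult_add_closed_def by auto
      also have "(\<ominus> \<one>) \<odot>\<^bsub>M\<^esub> (y \<oplus>\<^bsub>M\<^esub> d \<odot>\<^bsub>M\<^esub> x) \<oplus>\<^bsub>M\<^esub> (y \<oplus>\<^bsub>M\<^esub> c \<odot>\<^bsub>M\<^esub> x)
          = (\<ominus>\<^bsub>M\<^esub> y \<oplus>\<^bsub>M\<^esub> y) \<oplus>\<^bsub>M\<^esub> (c \<odot>\<^bsub>M\<^esub> x \<oplus>\<^bsub>M\<^esub> \<ominus>\<^bsub>M\<^esub> (d \<odot>\<^bsub>M\<^esub> x))"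
        using carr by (simp add: smult_l_minus M.minus_add M.a_ac)
      also have "\<dots> = (c \<ominus> d) \<odot>\<^bsub>M\<^esub> x"
        using carr by (simp add: M.l_neg R.minus_eq smult_l_distr smult_l_minus)
      finally have cdx: "(c \<ominus> d) \<odot>\<^bsub>M\<^esub> x \<in> N'" .
      \<comment> \<open>The closure condition always adds a second element; zero has to be obtained
        before it yields closure under plain scalar multiples.\<close>
      have "(\<ominus> \<one>) \<odot>\<^bsub>M\<^esub> ((c \<ominus> d) \<odot>\<^bsub>M\<^esub> x) \<oplus>\<^bsub>M\<^esub> (c \<ominus> d) \<odot>\<^bsub>M\<^esub> x \<in> N'"
        using N'(1) cdx unfolding smult_add_closed_def by auto
      then have z: "\<zero>\<^bsub>M\<^esub> \<in> N'" using carr by (simp add: smult_l_minus M.l_neg)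
      have u: "c \<ominus> d \<in> Units R" using C(3) cd by blast
      have "inv (c \<ominus> d) \<odot>\<^bsub>M\<^esub> ((c \<ominus> d) \<odot>\<^bsub>M\<^esub> x) \<oplus>\<^bsub>M\<^esub> \<zero>\<^bsub>M\<^esub> \<in> N'"
        using N'(1) cdx z R.Units_inv_closed[OF u] unfolding smult_add_closed_def by blast
      then have "x \<in> N'" using carr u by (simp add: smult_assoc1[symmetric])
      then show False using x N'(2) by blast
    qed
  qed
qed

text \<open>The elements outside \<open>N\<close> are those which belong to a minimal generating system of \<open>W / U\<close>
  at \<open>\<pp>\<close>; that \<open>N\<close> is proper replaces Nakayama's lemma.\<close>

lemma basic_element_condition:
  assumes p: "primeideal \<pp> R" and W: "submodule W R M" and U: "submodule U R M"
  defines "S \<equiv> carrier R - \<pp>"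
  shows "\<exists>N. N \<subset> W \<and> smult_add_closed N \<and>
    (\<forall>a\<in>W - N. \<forall>n. locally_generated R M S W U n \<longrightarrow>
        locally_generated R M S W (adjoin M (carrier R) U a) (n - 1))"
proof (cases "\<exists>n. locally_generated R M S W U n \<and> \<not> locally_generated R M S W U 0")
  \<comment> \<open>Here \<open>W / U\<close> is zero at the prime, or no finite number of
    generators suffices. Nothing has to be lowered, so the empty set is excluded.\<close>
  case False
  have "{} \<subset> W" using submodule_zero[OF W] by auto
  moreover have "locally_generated R M S W (adjoin M (carrier R) U a) (n - 1)"
    if "a \<in> W" and n: "locally_generated R M S W U n" for a n
  proof -
    have "a \<in> carrier M" using that submodule_subset[OF W] by auto
    have "locally_generated R M S W U 0" using False n by blast
    then have "locally_generated R M S W (adjoin M (carrier R) U a) 0"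
      using locally_generated_mono_submodule adjoin_superset submodule_subset[OF U] \<open>a \<in> carrier M\<close>
      by blast
    then show ?thesis
      using locally_generated_mono[OF _ _ W, of S "adjoin M (carrier R) U a" 0 "n - 1"]
        submodule_subset[OF adjoin_submodule[OF U \<open>a \<in> carrier M\<close>]] by simp
  qed
  ultimately show ?thesis unfolding smult_add_closed_def by blast
next
  case True
  interpret p: primeideal \<pp> R by fact
  have Sm: "\<And>a b. a \<in> S \<Longrightarrow> b \<in> S \<Longrightarrow> a \<otimes> b \<in> S" and S1: "\<one> \<in> S" and Sc: "\<And>a. a \<in> S \<Longrightarrow> a \<in> carrier R"
    using primeideal_complement_submonoid[OF p]
    by (auto simp: S_def dest: submonoid.m_closed submonoid.one_closed)
  note Wc = submodule_subset[OF W, THEN subsetD]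
  note Uc = submodule_subset[OF U]
  define m where "m = (LEAST n. locally_generated R M S W U n)"
  have m: "locally_generated R M S W U m" using True unfolding m_def by (metis LeastI)
  have m_le: "m \<le> n" if "locally_generated R M S W U n" for n
    using that unfolding m_def by (rule Least_le)
  have "m \<noteq> 0" using m True by metis
  obtain ys where ys: "length ys = m" "set ys \<subseteq> W"
    "\<forall>z\<in>W. \<exists>t\<in>S. t \<odot>\<^bsub>M\<^esub> z \<in> lin_combs M (carrier R) U ys"
    using m unfolding locally_generated_def by blast
  have ysc: "set ys \<subseteq> carrier M" using ys Wc by auto
  \<comment> \<open>Up to denominators \<open>L\<close> is \<open>U + \<pp> W\<close>. Its
    saturation \<open>N\<close> in \<open>W\<close> is the kernel of reduction modulo the maximal
    ideal of the local ring at \<open>\<pp>\<close>.\<close>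
  define L where "L = lin_combs M \<pp> U ys"
  have pR: "\<pp> \<subseteq> carrier R" using p.a_subset .
  have L_closed: "L \<subseteq> carrier M"
    unfolding L_def using lin_combs_closed[OF Uc pR ysc] .
  have L_add: "x \<oplus>\<^bsub>M\<^esub> y \<in> L" if "x \<in> L" "y \<in> L" for x y
    using ysc that unfolding L_def
  proof (induction ys arbitrary: x y)
    case Nil
    then show ?case using submodule_add[OF U] by simp
  next
    case (Cons z zs)
    then obtain v c v' c' where xy: "x = v \<oplus>\<^bsub>M\<^esub> c \<odot>\<^bsub>M\<^esub> z" "y = v' \<oplus>\<^bsub>M\<^esub> c' \<odot>\<^bsub>M\<^esub> z" "c \<in> \<pp>" "c' \<in> \<pp>"
      "v \<in> lin_combs M \<pp> U zs" "v' \<in> lin_combs M \<pp> U zs" by (auto elim!: adjoinE)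
    have "v \<in> carrier M" "v' \<in> carrier M" using xy lin_combs_closed[OF Uc pR, of zs] Cons.prems by auto
    then have "x \<oplus>\<^bsub>M\<^esub> y = (v \<oplus>\<^bsub>M\<^esub> v') \<oplus>\<^bsub>M\<^esub> (c \<oplus> c') \<odot>\<^bsub>M\<^esub> z"
      using xy pR Cons.prems by (simp add: subsetD smult_l_distr M.a_ac)
    then show ?case using Cons xy by (auto intro!: adjoinI)
  qed
  have L_smult: "r \<odot>\<^bsub>M\<^esub> x \<in> L" if "x \<in> L" "r \<in> carrier R" for x r
    using ysc that unfolding L_def
  proof (induction ys arbitrary: x)
    case Nil
    then show ?case using submodule_smult[OF U] by simp
  next
    case (Cons z zs)
    then obtain v c where x: "x = v \<oplus>\<^bsub>M\<^esub> c \<odot>\<^bsub>M\<^esub> z" "c \<in> \<pp>" "v \<in> lin_combs M \<pp> U zs"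
      by (auto elim!: adjoinE)
    have "v \<in> carrier M" using x lin_combs_closed[OF Uc pR, of zs] Cons.prems by auto
    then have "r \<odot>\<^bsub>M\<^esub> x = r \<odot>\<^bsub>M\<^esub> v \<oplus>\<^bsub>M\<^esub> (r \<otimes> c) \<odot>\<^bsub>M\<^esub> z"
      using x pR Cons.prems by (simp add: subsetD smult_r_distr smult_assoc1)
    then show ?case using Cons x p.I_l_closed by (auto intro!: adjoinI)
  qed
  define N where "N = {a \<in> W. \<exists>t\<in>S. t \<odot>\<^bsub>M\<^esub> a \<in> L}"
  have "smult_add_closed N"
    unfolding smult_add_closed_def
  proof (intro ballI)
    fix r x y assume r: "r \<in> carrier R" and "x \<in> N" "y \<in> N"
    then obtain t t' where *: "x \<in> W" "y \<in> W" "t \<in> S" "t' \<in> S" "t \<odot>\<^bsub>M\<^esub> x \<in> L" "t' \<odot>\<^bsub>M\<^esub> y \<in> L"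
      by (auto simp: N_def)
    have c: "x \<in> carrier M" "y \<in> carrier M" "t \<in> carrier R" "t' \<in> carrier R"
      using * Wc Sc by auto
    have "(t \<otimes> t') \<odot>\<^bsub>M\<^esub> (r \<odot>\<^bsub>M\<^esub> x \<oplus>\<^bsub>M\<^esub> y) = (t' \<otimes> r) \<odot>\<^bsub>M\<^esub> (t \<odot>\<^bsub>M\<^esub> x) \<oplus>\<^bsub>M\<^esub> t \<odot>\<^bsub>M\<^esub> (t' \<odot>\<^bsub>M\<^esub> y)"
      using c r by (simp add: smult_r_distr smult_assoc1[symmetric] R.m_ac)
    also have "\<dots> \<in> L" using * r c by (intro L_add L_smult[OF *(5)] L_smult[OF *(6)]) simp_all
    finally show "r \<odot>\<^bsub>M\<^esub> x \<oplus>\<^bsub>M\<^esub> y \<in> N"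
      using * r Sm submodule_add[OF W] submodule_smult[OF W] by (auto simp: N_def)
  qed
  moreover have "N \<noteq> W"
  proof
    assume "N = W"
    obtain y zs where y: "ys = y # zs" using \<open>m \<noteq> 0\<close> ys(1) by (cases ys) auto
    then have "y \<in> N" using ys(2) \<open>N = W\<close> by auto
    then obtain t where t: "t \<in> S" "t \<odot>\<^bsub>M\<^esub> y \<in> adjoin M \<pp> (lin_combs M \<pp> U zs) y"
      by (auto simp: N_def L_def y)
    then obtain v c where vc: "t \<odot>\<^bsub>M\<^esub> y = v \<oplus>\<^bsub>M\<^esub> c \<odot>\<^bsub>M\<^esub> y" "c \<in> \<pp>" "v \<in> lin_combs M \<pp> U zs"
      by (auto elim!: adjoinE)
    have zs: "set zs \<subseteq> carrier M" "y \<in> carrier M" using ysc y by auto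
    define K where "K = lin_combs M (carrier R) U zs"
    have K: "submodule K R M" unfolding K_def using lin_combs_submodule[OF U zs(1)] .
    have vK: "v \<in> K" unfolding K_def by (rule lin_combs_mono[OF subset_refl pR, THEN subsetD, OF vc(3)])
    have c: "c \<in> carrier R" "t \<in> carrier R" "v \<in> carrier M"
      using vc t Sc pR vK submodule_subset[OF K] by auto
    have tc: "t \<ominus> c \<in> S"
    proof -
      have "t \<ominus> c \<notin> \<pp>"
      proof
        assume "t \<ominus> c \<in> \<pp>"
        then have "(t \<ominus> c) \<oplus> c \<in> \<pp>" using vc p.a_closed by blast
        also have "(t \<ominus> c) \<oplus> c = t" using c by (simp add: R.minus_eq R.a_assoc R.l_neg)
        finally show False using t by (simp add: S_def)
      qed
      then show ?thesis using c by (simp add: S_def)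
    qed
    have "(t \<ominus> c) \<odot>\<^bsub>M\<^esub> y = (v \<oplus>\<^bsub>M\<^esub> c \<odot>\<^bsub>M\<^esub> y) \<oplus>\<^bsub>M\<^esub> \<ominus>\<^bsub>M\<^esub> (c \<odot>\<^bsub>M\<^esub> y)"
      using c zs vc(1) by (simp add: R.minus_eq smult_l_distr smult_l_minus)
    also have "\<dots> = v" using c zs by (simp add: M.a_assoc M.r_neg)
    finally have tcy: "(t \<ominus> c) \<odot>\<^bsub>M\<^esub> y \<in> K" using vK by simp
    have "\<exists>t\<in>S. t \<odot>\<^bsub>M\<^esub> z \<in> K" if z: "z \<in> W" for z
    proof -
      obtain t' where t': "t' \<in> S" "t' \<odot>\<^bsub>M\<^esub> z \<in> lin_combs M (carrier R) U ys" using ys(3) z by blast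
      then obtain w d where wd: "t' \<odot>\<^bsub>M\<^esub> z = w \<oplus>\<^bsub>M\<^esub> d \<odot>\<^bsub>M\<^esub> y" "w \<in> K" "d \<in> carrier R"
        by (auto simp: K_def y elim!: adjoinE)
      have "((t \<ominus> c) \<otimes> t') \<odot>\<^bsub>M\<^esub> z = (t \<ominus> c) \<odot>\<^bsub>M\<^esub> (w \<oplus>\<^bsub>M\<^esub> d \<odot>\<^bsub>M\<^esub> y)"
        using wd(1) c z Wc t' Sc by (simp add: smult_assoc1)
      also have "\<dots> = (t \<ominus> c) \<odot>\<^bsub>M\<^esub> w \<oplus>\<^bsub>M\<^esub> d \<odot>\<^bsub>M\<^esub> ((t \<ominus> c) \<odot>\<^bsub>M\<^esub> y)"
        using wd c zs submodule_subset[OF K]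
        by (simp add: subsetD smult_r_distr smult_assoc1[symmetric] R.m_comm)
      also have "\<dots> \<in> K"
        using wd c by (intro submodule_add[OF K] submodule_smult[OF K _ tcy] submodule_smult[OF K _ wd(2)]) simp_all
      finally show ?thesis using Sm[OF tc t'(1)] by blast
    qed
    then have "locally_generated R M S W U (m - 1)"
      unfolding locally_generated_def K_def using ys y by (intro exI[of _ zs]) auto
    then show False using m_le[of "m - 1"] \<open>m \<noteq> 0\<close> by simp
  qed
  moreover have "N \<subseteq> W" by (auto simp: N_def)
  moreover have "locally_generated R M S W (adjoin M (carrier R) U a) (n - 1)"
    if a: "a \<in> W - N" and n: "locally_generated R M S W U n" for a n
  proof -
    have ac: "a \<in> carrier M" using a Wc by auto
    define U' where "U' = adjoin M (carrier R) U a"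
    have U': "submodule U' R M" unfolding U'_def using adjoin_submodule[OF U ac] .
    obtain t where t: "t \<in> S" "t \<odot>\<^bsub>M\<^esub> a \<in> lin_combs M (carrier R) U ys" using ys(3) a by blast
    \<comment> \<open>As \<open>a\<close> is outside \<open>N\<close>, some coefficient
      \<open>r\<close> of \<open>t a\<close> is outside \<open>\<pp>\<close>. Up to the denominator
      \<open>r\<close> the corresponding \<open>y\<close> is a combination of \<open>a\<close> and
      the other generators, so those others suffice once \<open>a\<close> is adjoined.\<close>
    have "t \<odot>\<^bsub>M\<^esub> a \<notin> L" using a t by (auto simp: N_def)
    then obtain ys1 y ys2 v r where *: "ys = ys1 @ y # ys2"
      "v \<in> lin_combs M (carrier R) U (ys1 @ ys2)"
      "r \<in> S" "t \<odot>\<^bsub>M\<^esub> a = v \<oplus>\<^bsub>M\<^esub> r \<odot>\<^bsub>M\<^esub> y"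
      using split_lin_combs[OF Uc ysc t(2), of \<pp>] unfolding L_def S_def by metis
    define K where "K = lin_combs M (carrier R) U' (ys1 @ ys2)"
    have K: "submodule K R M" unfolding K_def using lin_combs_submodule[OF U'] * ysc by simp
    have UK: "lin_combs M (carrier R) U (ys1 @ ys2) \<subseteq> K"
      unfolding K_def U'_def by (intro lin_combs_mono adjoin_superset ac Uc subset_refl)
    have "U' \<subseteq> K"
      unfolding K_def by (rule lin_combs_superset[OF submodule_subset[OF U']]) (use * ysc in simp)
    then have aK: "a \<in> K" using adjoin_self[OF U ac] by (auto simp: U'_def)
    have c: "v \<in> carrier M" "y \<in> carrier M" "r \<in> carrier R" "t \<in> carrier R"
      using * UK submodule_subset[OF K] ysc t Sc by auto
    have "r \<odot>\<^bsub>M\<^esub> y = t \<odot>\<^bsub>M\<^esub> a \<oplus>\<^bsub>M\<^esub> \<ominus>\<^bsub>M\<^esub> v"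
      using *(4) c by (simp add: M.a_ac M.r_neg M.r_neg2)
    also have "\<dots> \<in> K"
      using * UK aK c by (intro submodule_add[OF K] submodule_neg[OF K] submodule_smult[OF K]) auto
    finally have ryK: "r \<odot>\<^bsub>M\<^esub> y \<in> K" .
    have "\<exists>t\<in>S. t \<odot>\<^bsub>M\<^esub> z \<in> K" if z: "z \<in> W" for z
    proof -
      obtain t' where t': "t' \<in> S" "t' \<odot>\<^bsub>M\<^esub> z \<in> lin_combs M (carrier R) U ys" using ys(3) z by blast
      have "lin_combs M (carrier R) U ys = adjoin M (carrier R) (lin_combs M (carrier R) U (ys1 @ ys2)) y"
        using lin_combs_rotate[OF Uc subset_refl c(2)] * ysc by simp
      then obtain w d where wd: "t' \<odot>\<^bsub>M\<^esub> z = w \<oplus>\<^bsub>M\<^esub> d \<odot>\<^bsub>M\<^esub> y" "w \<in> K" "d \<in> carrier R"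
        using t'(2) UK by (auto elim!: adjoinE)
      have "(r \<otimes> t') \<odot>\<^bsub>M\<^esub> z = r \<odot>\<^bsub>M\<^esub> (w \<oplus>\<^bsub>M\<^esub> d \<odot>\<^bsub>M\<^esub> y)"
        using wd(1) c z Wc t' Sc by (simp add: smult_assoc1)
      also have "\<dots> = r \<odot>\<^bsub>M\<^esub> w \<oplus>\<^bsub>M\<^esub> d \<odot>\<^bsub>M\<^esub> (r \<odot>\<^bsub>M\<^esub> y)"
        using wd c submodule_subset[OF K]
        by (simp add: subsetD smult_r_distr smult_assoc1[symmetric] R.m_comm)
      also have "\<dots> \<in> K"
        using wd c by (intro submodule_add[OF K] submodule_smult[OF K _ ryK] submodule_smult[OF K _ wd(2)]) simp_all
      finally show ?thesis using Sm[OF *(3) t'(1)] by blast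
    qed
    then have "locally_generated R M S W U' (m - 1)"
      unfolding locally_generated_def K_def using ys * by (intro exI[of _ "ys1 @ ys2"]) auto
    \<comment> \<open>The exchange was made for the minimal number \<open>m\<close>; any other
      admissible \<open>n\<close> satisfies \<open>m - 1 \<le> n - 1\<close>.\<close>
    then show ?thesis
      using locally_generated_mono[OF _ _ W, of S U' "m - 1" "n - 1"] m_le[OF n]
        submodule_subset[OF U'] unfolding U'_def by simp
  qed
  ultimately show ?thesis by blast
qed

end

section \<open>Primes of Noetherian rings\<close>

locale noetherian_cring = noetherian_ring R + cring R for R (structure)
begin

text \<open>Zorn's lemma on the set of counterexamples: in a Noetherian ring a nonempty chain of
  ideals contains its union, so there would be a maximal counterexample.\<close>

lemma ideal_noetherian_induct [consumes 1, case_names step]: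
  assumes "ideal I R"
    and step: "\<And>I. ideal I R \<Longrightarrow> (\<And>J. ideal J R \<Longrightarrow> I \<subset> J \<Longrightarrow> P J) \<Longrightarrow> P I"
  shows "P I"
proof (rule ccontr)
  assume "\<not> P I"
  define bad where "bad = {I. ideal I R \<and> \<not> P I}"
  have "bad \<noteq> {}" using assms(1) \<open>\<not> P I\<close> by (auto simp: bad_def)
  moreover have "\<Union>C \<in> bad" if "C \<noteq> {}" "subset.chain bad C" for C
  proof -
    have "subset.chain {I. ideal I R} C" "C \<subseteq> bad"
      using that(2) by (auto simp: pred_on.chain_def bad_def)
    then show ?thesis using ideal_chain_is_trivial[OF that(1)] by blast
  qed
  ultimately obtain M where M: "M \<in> bad" "\<forall>J\<in>bad. M \<subseteq> J \<longrightarrow> J = M"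
    using subset_Zorn_nonempty[of bad] by metis
  have "P M"
  proof (rule step)
    show "ideal M R" using M by (simp add: bad_def)
    show "P J" if "ideal J R" "M \<subset> J" for J
      using that M(2) by (auto simp: bad_def)
  qed
  then show False using M by (simp add: bad_def)
qed

text \<open>For \<open>a\<close>, \<open>b\<close> outside \<open>I\<close> with product in
  \<open>I\<close>, the ideals \<open>I + (a)\<close> and \<open>I + (b)\<close> do it. This is the
  step of the Noetherian inductions below.\<close>

lemma not_prime_ideal_split:
  assumes I: "ideal I R" and "\<not> primeideal I R" "I \<noteq> carrier R"
  obtains J K where "ideal J R" "ideal K R" "I \<subset> J" "I \<subset> K"
    "\<And>x y. x \<in> J \<Longrightarrow> y \<in> K \<Longrightarrow> x \<otimes> y \<in> I"
proof -
  interpret I: ideal I R by fact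
  obtain a b where ab: "a \<in> carrier R" "b \<in> carrier R" "a \<otimes> b \<in> I" "a \<notin> I" "b \<notin> I"
    using I.primeidealCD[OF is_cring assms(2)] assms(3) by auto
  have ext: "ideal (I <+>\<^bsub>R\<^esub> PIdl c) R" "I \<subset> I <+>\<^bsub>R\<^esub> PIdl c" if c: "c \<in> carrier R" "c \<notin> I" for c
  proof -
    show "ideal (I <+>\<^bsub>R\<^esub> PIdl c) R" using add_ideals[OF I cgenideal_ideal[OF c(1)]] .
    have z: "\<zero> \<in> PIdl c"
      using additive_subgroup.zero_closed ideal.axioms(1) cgenideal_ideal[OF c(1)] by blast
    have "I \<subseteq> I <+>\<^bsub>R\<^esub> PIdl c"
    proof
      fix i assume "i \<in> I"
      then have "i \<oplus> \<zero> \<in> I <+>\<^bsub>R\<^esub> PIdl c" using z unfolding set_add_def' by blast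
      then show "i \<in> I <+>\<^bsub>R\<^esub> PIdl c" using I.Icarr[OF \<open>i \<in> I\<close>] by simp
    qed
    moreover have "c \<in> I <+>\<^bsub>R\<^esub> PIdl c"
    proof -
      have "\<zero> \<oplus> c \<in> I <+>\<^bsub>R\<^esub> PIdl c"
        using I.zero_closed cgenideal_self[OF c(1)] unfolding set_add_def' by blast
      then show ?thesis using c by simp
    qed
    ultimately show "I \<subset> I <+>\<^bsub>R\<^esub> PIdl c" using c(2) by blast
  qed
  have "x \<otimes> y \<in> I" if xy: "x \<in> I <+>\<^bsub>R\<^esub> PIdl a" "y \<in> I <+>\<^bsub>R\<^esub> PIdl b" for x y
  proof -
    obtain i r where x: "x = i \<oplus> r \<otimes> a" "i \<in> I" "r \<in> carrier R"
      using xy(1) unfolding set_add_def' cgenideal_def by blast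
    obtain j t where y: "y = j \<oplus> t \<otimes> b" "j \<in> I" "t \<in> carrier R"
      using xy(2) unfolding set_add_def' cgenideal_def by blast
    have c: "i \<in> carrier R" "j \<in> carrier R" using x y I.Icarr by auto
    have "x \<otimes> y = (i \<otimes> y \<oplus> (r \<otimes> a) \<otimes> j) \<oplus> (r \<otimes> t) \<otimes> (a \<otimes> b)"
      using x y c ab by (simp add: l_distr r_distr m_ac a_ac)
    moreover have "i \<otimes> y \<in> I" using I.I_r_closed x(2) y c ab by simp
    moreover have "(r \<otimes> a) \<otimes> j \<in> I" using I.I_l_closed y(2) x ab by simp
    moreover have "(r \<otimes> t) \<otimes> (a \<otimes> b) \<in> I" using I.I_l_closed ab(3) x y by simp
    ultimately show ?thesis using I.a_closed by simp
  qed
  then show thesis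
    by (rule that[OF ext(1)[OF ab(1,4)] ext(1)[OF ab(2,5)] ext(2)[OF ab(1,4)] ext(2)[OF ab(2,5)]])
qed

text \<open>If \<open>I\<close> is proper and not prime, a product of two larger ideals lies in
  \<open>I\<close>, so every prime over \<open>I\<close> contains one of them. The finite sets for
  the two are united.\<close>

lemma finite_primes_below:
  assumes "ideal I R"
  shows "\<exists>F. finite F \<and> (\<forall>\<pp>\<in>F. primeideal \<pp> R \<and> I \<subseteq> \<pp>) \<and>
    (\<forall>\<qq>. primeideal \<qq> R \<and> I \<subseteq> \<qq> \<longrightarrow> (\<exists>\<pp>\<in>F. \<pp> \<subseteq> \<qq>))"
  using assms
proof (induction I rule: ideal_noetherian_induct)
  case (step I)
  consider "I = carrier R" | "primeideal I R" | "I \<noteq> carrier R" "\<not> primeideal I R" by blast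
  then show ?case
  proof cases
    case 1
    have "\<not> I \<subseteq> \<qq>" if "primeideal \<qq> R" for \<qq>
      using primeideal.I_notcarr[OF that] ideal.Icarr[OF primeideal.axioms(1)[OF that]] 1 by blast
    then show ?thesis by (intro exI[of _ "{}"]) auto
  next
    case 2
    then show ?thesis by (intro exI[of _ "{I}"]) auto
  next
    case 3
    obtain J K where JK: "ideal J R" "ideal K R" "I \<subset> J" "I \<subset> K"
      and prod: "\<And>x y. x \<in> J \<Longrightarrow> y \<in> K \<Longrightarrow> x \<otimes> y \<in> I"
      using not_prime_ideal_split[OF step(1) 3(2,1)] by metis
    obtain F where F: "finite F" "\<forall>\<pp>\<in>F. primeideal \<pp> R \<and> J \<subseteq> \<pp>"
      "\<forall>\<qq>. primeideal \<qq> R \<and> J \<subseteq> \<qq> \<longrightarrow> (\<exists>\<pp>\<in>F. \<pp> \<subseteq> \<qq>)"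
      using step(2)[OF JK(1,3)] by blast
    obtain G where G: "finite G" "\<forall>\<pp>\<in>G. primeideal \<pp> R \<and> K \<subseteq> \<pp>"
      "\<forall>\<qq>. primeideal \<qq> R \<and> K \<subseteq> \<qq> \<longrightarrow> (\<exists>\<pp>\<in>G. \<pp> \<subseteq> \<qq>)"
      using step(2)[OF JK(2,4)] by blast
    have JKq: "J \<subseteq> \<qq> \<or> K \<subseteq> \<qq>" if q: "primeideal \<qq> R" "I \<subseteq> \<qq>" for \<qq>
    proof (rule ccontr)
      assume "\<not> ?thesis"
      then obtain x y where "x \<in> J" "x \<notin> \<qq>" "y \<in> K" "y \<notin> \<qq>" by blast
      then show False
        using prod[of x y] q(2) primeideal.I_prime[OF q(1), of x y] ideal.Icarr[OF JK(1), of x]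
          ideal.Icarr[OF JK(2), of y] by blast
    qed
    show ?thesis
    proof (intro exI[of _ "F \<union> G"] conjI)
      show "\<forall>\<pp>\<in>F \<union> G. primeideal \<pp> R \<and> I \<subseteq> \<pp>" using F(2) G(2) JK(3,4) by blast
      show "\<forall>\<qq>. primeideal \<qq> R \<and> I \<subseteq> \<qq> \<longrightarrow> (\<exists>\<pp>\<in>F \<union> G. \<pp> \<subseteq> \<qq>)"
      proof (intro allI impI)
        fix \<qq> assume q: "primeideal \<qq> R \<and> I \<subseteq> \<qq>"
        then have "J \<subseteq> \<qq> \<or> K \<subseteq> \<qq>" using JKq by metis
        then have "(\<exists>\<pp>\<in>F. \<pp> \<subseteq> \<qq>) \<or> (\<exists>\<pp>\<in>G. \<pp> \<subseteq> \<qq>)" using F(3) G(3) q by metis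
        then show "\<exists>\<pp>\<in>F \<union> G. \<pp> \<subseteq> \<qq>" by blast
      qed
    qed (use F(1) G(1) in simp)
  qed
qed

text \<open>A minimal prime over \<open>T\<close> contains a member of the finite set from
  \<open>finite_primes_below\<close>, hence equals it. \<open>T\<close> is a mere set because
  \<open>generation_locus\<close> will be inserted.\<close>

lemma finite_minimal_primes:
  assumes "T \<subseteq> carrier R"
  shows "finite {\<qq>. primeideal \<qq> R \<and> T \<subseteq> \<qq> \<and> (\<forall>\<pp>. primeideal \<pp> R \<and> T \<subseteq> \<pp> \<longrightarrow> \<not> \<pp> \<subset> \<qq>)}"
proof -
  have T: "Idl T \<subseteq> \<qq> \<longleftrightarrow> T \<subseteq> \<qq>" if "primeideal \<qq> R" for \<qq>
    using Idl_subset_ideal[OF primeideal.axioms(1)[OF that] assms] .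
  obtain F where F: "finite F" "\<forall>\<pp>\<in>F. primeideal \<pp> R \<and> Idl T \<subseteq> \<pp>"
      "\<forall>\<qq>. primeideal \<qq> R \<and> Idl T \<subseteq> \<qq> \<longrightarrow> (\<exists>\<pp>\<in>F. \<pp> \<subseteq> \<qq>)"
    using finite_primes_below[OF genideal_ideal[OF assms]] by blast
  have "{\<qq>. primeideal \<qq> R \<and> T \<subseteq> \<qq> \<and> (\<forall>\<pp>. primeideal \<pp> R \<and> T \<subseteq> \<pp> \<longrightarrow> \<not> \<pp> \<subset> \<qq>)} \<subseteq> F"
  proof safe
    fix \<qq> assume q: "primeideal \<qq> R" "T \<subseteq> \<qq>" "\<forall>\<pp>. primeideal \<pp> R \<and> T \<subseteq> \<pp> \<longrightarrow> \<not> \<pp> \<subset> \<qq>"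
    obtain \<pp> where p: "\<pp> \<in> F" "\<pp> \<subseteq> \<qq>" using F(3) T[OF q(1)] q by metis
    then have "primeideal \<pp> R" "T \<subseteq> \<pp>" using F(2) T by metis+
    then have "\<pp> = \<qq>" using q(3) p(2) by (metis psubsetI)
    then show "\<qq> \<in> F" using p by simp
  qed
  then show ?thesis using F(1) finite_subset by blast
qed

text \<open>If \<open>I\<close> is not prime, one of the two larger ideals still misses
  \<open>T\<close>; otherwise a product of two elements of \<open>T\<close> would lie in
  \<open>I\<close>.\<close>

lemma prime_avoiding_multiplicative_set:
  assumes "ideal I R" "I \<inter> T = {}" "T \<noteq> {}" "T \<subseteq> carrier R"
    and T: "\<And>x y. x \<in> T \<Longrightarrow> y \<in> T \<Longrightarrow> x \<otimes> y \<in> T"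
  shows "\<exists>\<qq>. primeideal \<qq> R \<and> I \<subseteq> \<qq> \<and> \<qq> \<inter> T = {}"
  using assms(1,2)
proof (induction I rule: ideal_noetherian_induct)
  case (step I)
  show ?case
  proof (cases "primeideal I R")
    case False
    have "I \<noteq> carrier R" using step(3) assms(3,4) by blast
    obtain J K where JK: "ideal J R" "ideal K R" "I \<subset> J" "I \<subset> K"
      and prod: "\<And>x y. x \<in> J \<Longrightarrow> y \<in> K \<Longrightarrow> x \<otimes> y \<in> I"
      using not_prime_ideal_split[OF step(1) False \<open>I \<noteq> carrier R\<close>] by metis
    have "J \<inter> T = {} \<or> K \<inter> T = {}" using prod T step(3) by blast
    then show ?thesis using step(2)[OF JK(1,3)] step(2)[OF JK(2,4)] JK(3,4) by blast
  qed (use step(3) in blast)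
qed

text \<open>For a regular \<open>x\<close> in \<open>\<pp>\<close> the products of powers of
  \<open>x\<close> with elements outside \<open>\<pp>\<close> form a multiplicative set without
  zero. A prime that avoids this set lies in \<open>\<pp>\<close> and omits \<open>x\<close>,
  against minimality. It lets the rank condition pass to primes of height 0.\<close>

lemma minimal_prime_not_regular:
  assumes p: "primeideal \<pp> R" and min: "\<And>\<qq>. primeideal \<qq> R \<Longrightarrow> \<not> \<qq> \<subset> \<pp>"
  shows "regular_elements R \<subseteq> carrier R - \<pp>"
proof -
  interpret p: primeideal \<pp> R by fact
  have False if x: "x \<in> regular_elements R" "x \<in> \<pp>" for x
  proof -
    have xc: "x \<in> carrier R" and reg: "\<And>y. y \<in> carrier R \<Longrightarrow> x \<otimes> y = \<zero> \<Longrightarrow> y = \<zero>"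
      using x(1) by (auto simp: regular_elements_def)
    define T where "T = {s \<otimes> x [^] n | s n. s \<in> carrier R - \<pp> \<and> n \<in> (UNIV :: nat set)}"
    have one: "\<one> \<in> carrier R - \<pp>" using p.I_notcarr p.one_imp_carrier by auto
    have "T \<subseteq> carrier R" using xc by (auto simp: T_def)
    moreover have "T \<noteq> {}" using one by (auto simp: T_def)
    moreover have "u \<otimes> v \<in> T" if uv: "u \<in> T" "v \<in> T" for u v
    proof -
      obtain s n s' n' where *: "u = s \<otimes> x [^] (n::nat)" "v = s' \<otimes> x [^] (n'::nat)"
        "s \<in> carrier R - \<pp>" "s' \<in> carrier R - \<pp>" using uv by (auto simp: T_def)
      have "u \<otimes> v = (s \<otimes> s') \<otimes> (x [^] (n + n'))"
        using * xc by (simp add: nat_pow_mult[symmetric] m_ac)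
      moreover have "s \<otimes> s' \<in> carrier R - \<pp>" using * p.I_prime by auto
      ultimately show ?thesis unfolding T_def by blast
    qed
    moreover have "{\<zero>} \<inter> T = {}"
    proof -
      have "s = \<zero>" if "s \<in> carrier R" "s \<otimes> x [^] n = \<zero>" for s and n :: nat
        using that(2)
      proof (induction n)
        case (Suc n)
        have "x \<otimes> (s \<otimes> x [^] n) = \<zero>" using Suc.prems xc that(1) by (simp add: m_ac)
        from reg[OF _ this] have "s \<otimes> x [^] n = \<zero>" using xc that(1) by simp
        then show ?case by (rule Suc.IH)
      qed (use that(1) in simp)
      then show ?thesis using p.zero_closed by (force simp: T_def)
    qed
    ultimately obtain \<qq> where q: "primeideal \<qq> R" "\<qq> \<inter> T = {}"
      using prime_avoiding_multiplicative_set[OF zeroideal, of T] by metis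
    have "\<one> \<otimes> x [^] (1::nat) \<in> T" using one unfolding T_def by blast
    then have "x \<notin> \<qq>" using q(2) xc by auto
    moreover have "\<qq> \<subseteq> \<pp>"
    proof
      fix y assume y: "y \<in> \<qq>"
      then have yc: "y \<in> carrier R" using ideal.Icarr primeideal.axioms(1) q(1) by metis
      have "y \<in> T" if "y \<notin> \<pp>"
      proof -
        have "y \<otimes> x [^] (0::nat) \<in> T" using that yc unfolding T_def by blast
        then show ?thesis using yc by simp
      qed
      then show "y \<in> \<pp>" using q(2) y by blast
    qed
    ultimately show False using min[OF q(1)] x(2) by blast
  qed
  then show ?thesis by (auto simp: regular_elements_def)
qed

lemma proper_ideal_in_maximal:
  assumes "ideal I R" "I \<noteq> carrier R"
  shows "\<exists>\<mm>. maximalideal \<mm> R \<and> I \<subseteq> \<mm>"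
  using assms
proof (induction I rule: ideal_noetherian_induct)
  case (step I)
  show ?case
  proof (cases "maximalideal I R")
    case False
    then obtain J where J: "ideal J R" "I \<subseteq> J" "J \<noteq> I" "J \<noteq> carrier R"
      using maximalidealI[OF step(1)] step(3) by metis
    then show ?thesis using step(2)[OF J(1)] by blast
  qed blast
qed

lemma local_ring_Units:
  assumes "local_ring R" "maximalideal \<mm> R" "x \<in> carrier R - \<mm>"
  shows "x \<in> Units R"
proof (rule ccontr)
  assume x: "x \<notin> Units R"
  have "ideal (PIdl x) R" using cgenideal_ideal assms(3) by blast
  moreover have "\<one> \<notin> PIdl x"
    using x assms(3) by (auto simp: cgenideal_def Units_def m_comm)
  then have "PIdl x \<noteq> carrier R" by auto
  ultimately obtain \<nn> where n: "maximalideal \<nn> R" "PIdl x \<subseteq> \<nn>"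
    using proper_ideal_in_maximal by blast
  have "\<nn> = \<mm>" using assms(1,2) n(1) unfolding local_ring_def by blast
  then show False using n(2) cgenideal_self[of x] assms(3) by blast
qed

text \<open>Choose one representative of each residue class. Differences of distinct ones lie
  outside the maximal ideal, so they are units.\<close>

lemma infinite_residue_field_units:
  assumes "local_ring R" "maximalideal \<mm> R" "infinite (carrier (R Quot \<mm>))"
  shows "\<exists>C. infinite C \<and> C \<subseteq> carrier R \<and> (\<forall>c\<in>C. \<forall>d\<in>C. c \<noteq> d \<longrightarrow> c \<ominus> d \<in> Units R)"
proof -
  interpret m: maximalideal \<mm> R by fact
  have "\<exists>x\<in>carrier R. A = \<mm> +> x" if "A \<in> carrier (R Quot \<mm>)" for A
    using that by (auto simp: FactRing_def A_RCOSETS_def' a_r_coset_def RCOSETS_def)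
  then obtain rep where rep: "\<And>A. A \<in> carrier (R Quot \<mm>) \<Longrightarrow> rep A \<in> carrier R \<and> A = \<mm> +> rep A"
    by metis
  define C where "C = rep ` carrier (R Quot \<mm>)"
  have "inj_on rep (carrier (R Quot \<mm>))" using rep by (metis inj_onI)
  then have "infinite C" using assms(3) finite_imageD unfolding C_def by blast
  moreover have "c \<ominus> d \<in> Units R" if cd: "c \<in> C" "d \<in> C" "c \<noteq> d" for c d
  proof -
    have c: "c \<in> carrier R" "d \<in> carrier R" "\<mm> +> c \<noteq> \<mm> +> d"
      using cd rep by (auto simp: C_def)
    have "c \<ominus> d \<notin> \<mm>" using c quotient_eq_iff_same_a_r_cos[OF m.is_ideal] by blast
    then show ?thesis using local_ring_Units[OF assms(1,2)] c by simp
  qed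
  moreover have "C \<subseteq> carrier R" using rep by (auto simp: C_def)
  ultimately show ?thesis by blast
qed

end

text \<open>A chain ending in \<open>\<qq>\<close> is prolonged by \<open>\<pp>\<close>. Finiteness
  of the height of \<open>\<qq>\<close> is part of the conclusion, since the bounds are only stated
  for finite heights.\<close>

lemma prime_height_strict:
  assumes "primeideal \<qq> R" "primeideal \<pp> R" "\<qq> \<subset> \<pp>" "prime_height R \<pp> = enat d"
  shows "\<exists>d'<d. prime_height R \<qq> = enat d'"
proof -
  have *: "Suc n \<le> d" if c: "prime_chain R n c" "c n = \<qq>" for n c
  proof -
    define c' where "c' = (\<lambda>i. if i \<le> n then c i else \<pp>)"
    have "prime_chain R (Suc n) c'" "c' (Suc n) = \<pp>"
      using c assms(2,3) by (auto simp: prime_chain_def c'_def le_Suc_eq less_Suc_eq)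
    then have "enat (Suc n) \<le> prime_height R \<pp>"
      unfolding prime_height_def by (intro Sup_upper) blast
    then show ?thesis using assms(4) by simp
  qed
  have "prime_chain R 0 (\<lambda>_. \<qq>)" using assms(1) by (simp add: prime_chain_def)
  \<comment> \<open>The one-element chain shows \<open>d \<ge> 1\<close>, so \<open>d - 1\<close>
    below is not truncated.\<close>
  then have "Suc 0 \<le> d" using * by blast
  have "prime_height R \<qq> \<le> enat (d - 1)"
    unfolding prime_height_def
  proof (rule Sup_least)
    fix x assume "x \<in> {enat n |n. \<exists>c. prime_chain R n c \<and> c n = \<qq>}"
    then obtain n c where x: "x = enat n" "prime_chain R n c" "c n = \<qq>" by blast
    show "x \<le> enat (d - 1)" using *[OF x(2,3)] x(1) by simp
  qed
  then obtain d' where "prime_height R \<qq> = enat d'" "d' \<le> d - 1" by (cases "prime_height R \<qq>") auto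
  then show ?thesis using \<open>Suc 0 \<le> d\<close> by (intro exI[of _ d']) auto
qed

lemma heightI:
  assumes "\<And>\<qq>. primeideal \<qq> R \<Longrightarrow> I \<subseteq> \<qq> \<Longrightarrow> n \<le> prime_height R \<qq>"
  shows "n \<le> height R I"
  unfolding height_def using assms by (auto intro: Inf_greatest)

lemma heightD:
  assumes "n \<le> height R I" "primeideal \<qq> R" "prime_height R \<qq> < n"
  shows "\<not> I \<subseteq> \<qq>"
proof
  assume "I \<subseteq> \<qq>"
  then have "height R I \<le> prime_height R \<qq>" unfolding height_def using assms(2) by (auto intro: Inf_lower)
  then show False using assms(1,3) by (meson leD order_trans)
qed

section \<open>Localization\<close>

lemma self_module_simps [simp]:
  "carrier (self_module R) = carrier R" "\<zero>\<^bsub>self_module R\<^esub> = \<zero>\<^bsub>R\<^esub>"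
  "x \<oplus>\<^bsub>self_module R\<^esub> y = x \<oplus>\<^bsub>R\<^esub> y" "x \<odot>\<^bsub>self_module R\<^esub> y = x \<otimes>\<^bsub>R\<^esub> y"
  by (simp_all add: self_module_def)

text \<open>Evaluates the operations on classes, which are unions over all representatives:
  independence of the representative collapses the union to one class.\<close>

lemma UN_eq_const_pair:
  assumes "(x0, y0) \<in> A" "\<And>x y. (x, y) \<in> A \<Longrightarrow> f x y = c"
  shows "(\<Union>(x, y)\<in>A. f x y) = c"
  using assms by fastforce

lemma (in cring) module_self_module: "module R (self_module R)"
proof (rule moduleI)
  show "abelian_group (self_module R)"
  proof (rule abelian_groupI)
    show "\<exists>y\<in>carrier (self_module R). y \<oplus>\<^bsub>self_module R\<^esub> x = \<zero>\<^bsub>self_module R\<^esub>"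
      if "x \<in> carrier (self_module R)" for x
      using that by (auto intro!: bexI[of _ "\<ominus> x"] simp: l_neg)
  qed (auto simp: a_ac)
qed (auto simp: l_distr r_distr m_assoc is_cring)

locale localization = module R M for R (structure) and M (structure) +
  fixes S assumes submonoid: "submonoid S R"
begin

abbreviation frac :: "'c \<Rightarrow> 'a \<Rightarrow> ('c \<times> 'a) set" where "frac \<equiv> loc_frac S M"
abbreviation (input) sfrac :: "'a \<Rightarrow> 'a \<Rightarrow> ('a \<times> 'a) set" where "sfrac \<equiv> loc_frac S (self_module R)"
abbreviation (input) L where "L \<equiv> loc_module R S M"
abbreviation (input) Rl where "Rl \<equiv> loc_ring R S"

lemma S_closed [simp]: "s \<in> S \<Longrightarrow> s \<in> carrier R"
  and S_mult [simp]: "s \<in> S \<Longrightarrow> t \<in> S \<Longrightarrow> s \<otimes> t \<in> S"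
  and S_one [simp]: "\<one> \<in> S"
  using submonoid by (auto dest: submonoid.subset submonoid.m_closed submonoid.one_closed)

lemma equiv_loc_rel: "equiv (carrier M \<times> S) (loc_rel S M)"
proof (rule equivI)
  show "loc_rel S M \<subseteq> (carrier M \<times> S) \<times> (carrier M \<times> S)" by (auto simp: loc_rel_def)
  show "refl_on (carrier M \<times> S) (loc_rel S M)"
    using S_one by (auto simp: loc_rel_def refl_on_def)
  show "sym (loc_rel S M)" by (auto simp: loc_rel_def sym_def) metis
  show "trans (loc_rel S M)"
  proof (rule transI, clarify)
    fix x s y t z r
    assume "((x, s), (y, t)) \<in> loc_rel S M" "((y, t), (z, r)) \<in> loc_rel S M"
    then obtain u v where *: "x \<in> carrier M" "s \<in> S" "y \<in> carrier M" "t \<in> S" "z \<in> carrier M" "r \<in> S"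
      "u \<in> S" "v \<in> S"
      and eqs: "u \<odot>\<^bsub>M\<^esub> (t \<odot>\<^bsub>M\<^esub> x) = u \<odot>\<^bsub>M\<^esub> (s \<odot>\<^bsub>M\<^esub> y)" "v \<odot>\<^bsub>M\<^esub> (r \<odot>\<^bsub>M\<^esub> y) = v \<odot>\<^bsub>M\<^esub> (t \<odot>\<^bsub>M\<^esub> z)"
      by (auto simp: loc_rel_def)
    \<comment> \<open>The middle fraction \<open>y / t\<close> is eliminated by multiplying the
      first equation by \<open>v r\<close> and the second by \<open>u s\<close>. Its denominator
      \<open>t\<close> remains as a factor, so it belongs to the witness.\<close>
    have "(u \<otimes> v \<otimes> t) \<odot>\<^bsub>M\<^esub> (r \<odot>\<^bsub>M\<^esub> x) = (v \<otimes> r) \<odot>\<^bsub>M\<^esub> (u \<odot>\<^bsub>M\<^esub> (t \<odot>\<^bsub>M\<^esub> x))"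
      using * by (simp add: smult_assoc1[symmetric] R.m_ac)
    also have "\<dots> = (u \<otimes> s) \<odot>\<^bsub>M\<^esub> (v \<odot>\<^bsub>M\<^esub> (r \<odot>\<^bsub>M\<^esub> y))"
      unfolding eqs(1) using * by (simp add: smult_assoc1[symmetric] R.m_ac)
    also have "\<dots> = (u \<otimes> v \<otimes> t) \<odot>\<^bsub>M\<^esub> (s \<odot>\<^bsub>M\<^esub> z)"
      unfolding eqs(2) using * by (simp add: smult_assoc1[symmetric] R.m_ac)
    finally show "((x, s), (z, r)) \<in> loc_rel S M"
      using * by (auto simp: loc_rel_def intro!: bexI[of _ "u \<otimes> v \<otimes> t"])
  qed
qed

lemma loc_frac_eq_iff:
  assumes "x \<in> carrier M" "s \<in> S" "y \<in> carrier M" "t \<in> S"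
  shows "frac x s = frac y t \<longleftrightarrow> (\<exists>u\<in>S. u \<odot>\<^bsub>M\<^esub> (t \<odot>\<^bsub>M\<^esub> x) = u \<odot>\<^bsub>M\<^esub> (s \<odot>\<^bsub>M\<^esub> y))"
  using eq_equiv_class_iff[OF equiv_loc_rel, of "(x, s)" "(y, t)"] assms
  by (simp add: loc_frac_def loc_rel_def)

lemma loc_frac_eqI':
  assumes "u \<odot>\<^bsub>M\<^esub> (t \<odot>\<^bsub>M\<^esub> x) = u \<odot>\<^bsub>M\<^esub> (s \<odot>\<^bsub>M\<^esub> y)" "u \<in> S"
    and "x \<in> carrier M" "s \<in> S" "y \<in> carrier M" "t \<in> S"
  shows "frac x s = frac y t"
  using loc_frac_eq_iff[OF assms(3-6)] assms(1,2) by blast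

lemma loc_frac_eqI:
  assumes "x \<in> carrier M" "s \<in> S" "y \<in> carrier M" "t \<in> S" "t \<odot>\<^bsub>M\<^esub> x = s \<odot>\<^bsub>M\<^esub> y"
  shows "frac x s = frac y t"
  using assms by (intro loc_frac_eqI'[of \<one>]) simp_all

lemma mem_loc_frac:
  assumes "x \<in> carrier M" "s \<in> S"
  shows "(y, t) \<in> frac x s \<longleftrightarrow> y \<in> carrier M \<and> t \<in> S \<and> frac y t = frac x s"
  using assms equiv_class_eq_iff[OF equiv_loc_rel, of "(x, s)" "(y, t)"]
  by (auto simp: loc_frac_def)

lemma loc_frac_mem: "x \<in> carrier M \<Longrightarrow> s \<in> S \<Longrightarrow> (x, s) \<in> frac x s"
  by (simp add: mem_loc_frac)

lemma loc_frac_closed [simp]: "x \<in> carrier M \<Longrightarrow> s \<in> S \<Longrightarrow> frac x s \<in> carrier L"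
  by (auto simp: loc_module_def loc_frac_def intro: quotientI)

lemma loc_carrierE:
  assumes "A \<in> carrier L" obtains x s where "x \<in> carrier M" "s \<in> S" "A = frac x s"
  using assms by (auto simp: loc_module_def loc_frac_def elim!: quotientE)

lemma loc_zero: "\<zero>\<^bsub>L\<^esub> = frac \<zero>\<^bsub>M\<^esub> \<one>"
  by (simp add: loc_module_def)

lemma loc_frac_cancel:
  assumes "x \<in> carrier M" "s \<in> S" "t \<in> S" shows "frac (t \<odot>\<^bsub>M\<^esub> x) (t \<otimes> s) = frac x s"
  using assms by (intro loc_frac_eqI) (auto simp: smult_assoc1[symmetric] R.m_ac)

lemma loc_add:
  assumes "x \<in> carrier M" "s \<in> S" "y \<in> carrier M" "t \<in> S"
  shows "frac x s \<oplus>\<^bsub>L\<^esub> frac y t = frac (t \<odot>\<^bsub>M\<^esub> x \<oplus>\<^bsub>M\<^esub> s \<odot>\<^bsub>M\<^esub> y) (s \<otimes> t)"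
proof -
  have *: "frac (t' \<odot>\<^bsub>M\<^esub> x' \<oplus>\<^bsub>M\<^esub> s' \<odot>\<^bsub>M\<^esub> y') (s' \<otimes> t') = frac (t \<odot>\<^bsub>M\<^esub> x \<oplus>\<^bsub>M\<^esub> s \<odot>\<^bsub>M\<^esub> y) (s \<otimes> t)"
    if "(x', s') \<in> frac x s" "(y', t') \<in> frac y t" for x' s' y' t'
  proof -
    have c: "x' \<in> carrier M" "s' \<in> S" "y' \<in> carrier M" "t' \<in> S"
      "frac x' s' = frac x s" "frac y' t' = frac y t"
      using that mem_loc_frac assms by auto
    obtain u where u: "u \<in> S" "u \<odot>\<^bsub>M\<^esub> (s \<odot>\<^bsub>M\<^esub> x') = u \<odot>\<^bsub>M\<^esub> (s' \<odot>\<^bsub>M\<^esub> x)"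
      using c assms loc_frac_eq_iff by metis
    obtain v where v: "v \<in> S" "v \<odot>\<^bsub>M\<^esub> (t \<odot>\<^bsub>M\<^esub> y') = v \<odot>\<^bsub>M\<^esub> (t' \<odot>\<^bsub>M\<^esub> y)"
      using c assms loc_frac_eq_iff by metis
    have "(u \<otimes> v) \<odot>\<^bsub>M\<^esub> ((s \<otimes> t) \<odot>\<^bsub>M\<^esub> (t' \<odot>\<^bsub>M\<^esub> x' \<oplus>\<^bsub>M\<^esub> s' \<odot>\<^bsub>M\<^esub> y')) =
        (v \<otimes> t \<otimes> t') \<odot>\<^bsub>M\<^esub> (u \<odot>\<^bsub>M\<^esub> (s \<odot>\<^bsub>M\<^esub> x')) \<oplus>\<^bsub>M\<^esub> (u \<otimes> s \<otimes> s') \<odot>\<^bsub>M\<^esub> (v \<odot>\<^bsub>M\<^esub> (t \<odot>\<^bsub>M\<^esub> y'))"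
      using c u(1) v(1) assms by (simp add: smult_r_distr smult_assoc1[symmetric] R.m_ac)
    also have "\<dots> = (u \<otimes> v) \<odot>\<^bsub>M\<^esub> ((s' \<otimes> t') \<odot>\<^bsub>M\<^esub> (t \<odot>\<^bsub>M\<^esub> x \<oplus>\<^bsub>M\<^esub> s \<odot>\<^bsub>M\<^esub> y))"
      unfolding u(2) v(2) using c u(1) v(1) assms by (simp add: smult_r_distr smult_assoc1[symmetric] R.m_ac)
    finally show ?thesis by (rule loc_frac_eqI') (use c assms u(1) v(1) in simp_all)
  qed
  have "frac x s \<oplus>\<^bsub>L\<^esub> frac y t = (\<Union>(x', s')\<in>frac x s. \<Union>(y', t')\<in>frac y t.
           frac (t' \<odot>\<^bsub>M\<^esub> x' \<oplus>\<^bsub>M\<^esub> s' \<odot>\<^bsub>M\<^esub> y') (s' \<otimes> t'))"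
    by (simp add: loc_module_def)
  also have "\<dots> = frac (t \<odot>\<^bsub>M\<^esub> x \<oplus>\<^bsub>M\<^esub> s \<odot>\<^bsub>M\<^esub> y) (s \<otimes> t)"
    by (rule UN_eq_const_pair[OF loc_frac_mem[OF assms(1,2)] UN_eq_const_pair[OF loc_frac_mem[OF assms(3,4)] *]])
  finally show ?thesis .
qed

end

text \<open>\<open>loc_ring\<close> is built from the localization of \<open>self_module\<close>, so
  the computation rules for fractions in the ring are those of the locale for this module.\<close>

sublocale localization \<subseteq> self: localization R "self_module R" S
  by (intro localization.intro localization_axioms.intro R.module_self_module submonoid)

context localization
begin

lemma loc_ring_simps [simp]:
  "carrier Rl = carrier (loc_module R S (self_module R))"
  "\<zero>\<^bsub>Rl\<^esub> = \<zero>\<^bsub>loc_module R S (self_module R)\<^esub>"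
  "A \<oplus>\<^bsub>Rl\<^esub> B = A \<oplus>\<^bsub>loc_module R S (self_module R)\<^esub> B"
  "A \<otimes>\<^bsub>Rl\<^esub> B = A \<odot>\<^bsub>loc_module R S (self_module R)\<^esub> B"
  "\<one>\<^bsub>Rl\<^esub> = sfrac \<one> \<one>"
  by (simp_all add: loc_ring_def Let_def)

lemma loc_smult:
  assumes "a \<in> carrier R" "s \<in> S" "x \<in> carrier M" "t \<in> S"
  shows "sfrac a s \<odot>\<^bsub>L\<^esub> frac x t = frac (a \<odot>\<^bsub>M\<^esub> x) (s \<otimes> t)"
proof -
  have *: "frac (a' \<odot>\<^bsub>M\<^esub> x') (s' \<otimes> t') = frac (a \<odot>\<^bsub>M\<^esub> x) (s \<otimes> t)"
    if "(a', s') \<in> sfrac a s" "(x', t') \<in> frac x t" for a' s' x' t'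
  proof -
    have c: "a' \<in> carrier R" "s' \<in> S" "x' \<in> carrier M" "t' \<in> S"
      "sfrac a' s' = sfrac a s" "frac x' t' = frac x t"
      using that mem_loc_frac self.mem_loc_frac assms by auto
    obtain u where u: "u \<in> S" "u \<otimes> (s \<otimes> a') = u \<otimes> (s' \<otimes> a)"
      using c assms self.loc_frac_eq_iff by auto
    obtain v where v: "v \<in> S" "v \<odot>\<^bsub>M\<^esub> (t \<odot>\<^bsub>M\<^esub> x') = v \<odot>\<^bsub>M\<^esub> (t' \<odot>\<^bsub>M\<^esub> x)"
      using c assms loc_frac_eq_iff by metis
    have "(u \<otimes> v) \<odot>\<^bsub>M\<^esub> ((s \<otimes> t) \<odot>\<^bsub>M\<^esub> (a' \<odot>\<^bsub>M\<^esub> x')) = (u \<otimes> (s \<otimes> a')) \<odot>\<^bsub>M\<^esub> (v \<odot>\<^bsub>M\<^esub> (t \<odot>\<^bsub>M\<^esub> x'))"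
      using c u(1) v(1) assms by (simp add: smult_assoc1[symmetric] R.m_ac)
    also have "\<dots> = (u \<otimes> v) \<odot>\<^bsub>M\<^esub> ((s' \<otimes> t') \<odot>\<^bsub>M\<^esub> (a \<odot>\<^bsub>M\<^esub> x))"
      unfolding u(2) v(2) using c u(1) v(1) assms by (simp add: smult_assoc1[symmetric] R.m_ac)
    finally show ?thesis by (rule loc_frac_eqI') (use c assms u(1) v(1) in simp_all)
  qed
  have "sfrac a s \<odot>\<^bsub>L\<^esub> frac x t = (\<Union>(a', s')\<in>sfrac a s. \<Union>(x', t')\<in>frac x t.
           frac (a' \<odot>\<^bsub>M\<^esub> x') (s' \<otimes> t'))"
    by (simp add: loc_module_def)
  also have "\<dots> = frac (a \<odot>\<^bsub>M\<^esub> x) (s \<otimes> t)"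
    using UN_eq_const_pair[OF self.loc_frac_mem UN_eq_const_pair[OF loc_frac_mem[OF assms(3,4)] *]] assms(1,2)
    by simp
  finally show ?thesis .
qed

end

context localization
begin

lemma abelian_group_loc_module: "abelian_group L"
proof (rule abelian_groupI)
  fix A B assume "A \<in> carrier L" "B \<in> carrier L"
  then obtain x s y t where *: "x \<in> carrier M" "s \<in> S" "A = frac x s" "y \<in> carrier M" "t \<in> S" "B = frac y t"
    by (metis loc_carrierE)
  show "A \<oplus>\<^bsub>L\<^esub> B \<in> carrier L" using * by (simp add: loc_add)
  show "A \<oplus>\<^bsub>L\<^esub> B = B \<oplus>\<^bsub>L\<^esub> A" using * by (simp add: loc_add M.a_comm R.m_comm)
  fix C assume "C \<in> carrier L"
  then obtain z r where "z \<in> carrier M" "r \<in> S" "C = frac z r" by (metis loc_carrierE)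
  then show "A \<oplus>\<^bsub>L\<^esub> B \<oplus>\<^bsub>L\<^esub> C = A \<oplus>\<^bsub>L\<^esub> (B \<oplus>\<^bsub>L\<^esub> C)"
    using * by (simp add: loc_add smult_r_distr smult_assoc1[symmetric] M.a_ac R.m_ac)
next
  show "\<zero>\<^bsub>L\<^esub> \<in> carrier L" by (simp add: loc_zero)
next
  fix A assume "A \<in> carrier L"
  then obtain x s where *: "x \<in> carrier M" "s \<in> S" "A = frac x s" by (metis loc_carrierE)
  show "\<zero>\<^bsub>L\<^esub> \<oplus>\<^bsub>L\<^esub> A = A" using * by (simp add: loc_add loc_zero)
  have "frac (\<ominus>\<^bsub>M\<^esub> x) s \<oplus>\<^bsub>L\<^esub> A = frac \<zero>\<^bsub>M\<^esub> (s \<otimes> s)"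
    using * by (simp add: loc_add smult_r_minus M.l_neg)
  also have "\<dots> = \<zero>\<^bsub>L\<^esub>" unfolding loc_zero using * by (intro loc_frac_eqI) auto
  finally show "\<exists>B\<in>carrier L. B \<oplus>\<^bsub>L\<^esub> A = \<zero>\<^bsub>L\<^esub>" using * by (auto intro!: bexI[of _ "frac (\<ominus>\<^bsub>M\<^esub> x) s"])
qed

lemma loc_smult_closed:
  assumes "q \<in> carrier Rl" "A \<in> carrier L" shows "q \<odot>\<^bsub>L\<^esub> A \<in> carrier L"
proof -
  obtain a s where "a \<in> carrier R" "s \<in> S" "q = sfrac a s"
    using assms(1) by (auto elim: self.loc_carrierE)
  moreover obtain x t where "x \<in> carrier M" "t \<in> S" "A = frac x t"
    using assms(2) by (auto elim: loc_carrierE)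
  ultimately show ?thesis by (simp add: loc_smult)
qed

lemma loc_smult_assoc:
  assumes "q \<in> carrier Rl" "q' \<in> carrier Rl" "A \<in> carrier L"
  shows "(q \<otimes>\<^bsub>Rl\<^esub> q') \<odot>\<^bsub>L\<^esub> A = q \<odot>\<^bsub>L\<^esub> (q' \<odot>\<^bsub>L\<^esub> A)"
proof -
  obtain a s where "a \<in> carrier R" "s \<in> S" "q = sfrac a s"
    using assms(1) by (auto elim: self.loc_carrierE)
  moreover obtain a' s' where "a' \<in> carrier R" "s' \<in> S" "q' = sfrac a' s'"
    using assms(2) by (auto elim: self.loc_carrierE)
  moreover obtain x t where "x \<in> carrier M" "t \<in> S" "A = frac x t"
    using assms(3) by (auto elim: loc_carrierE)
  ultimately show ?thesis
    by (simp add: loc_smult self.loc_smult smult_assoc1 R.m_assoc)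
qed

lemma loc_smult_r_distr:
  assumes "q \<in> carrier Rl" "A \<in> carrier L" "B \<in> carrier L"
  shows "q \<odot>\<^bsub>L\<^esub> (A \<oplus>\<^bsub>L\<^esub> B) = q \<odot>\<^bsub>L\<^esub> A \<oplus>\<^bsub>L\<^esub> q \<odot>\<^bsub>L\<^esub> B"
proof -
  obtain a s where 1: "a \<in> carrier R" "s \<in> S" "q = sfrac a s"
    using assms(1) by (auto elim: self.loc_carrierE)
  obtain x t where 2: "x \<in> carrier M" "t \<in> S" "A = frac x t"
    using assms(2) by (auto elim: loc_carrierE)
  obtain y u where 3: "y \<in> carrier M" "u \<in> S" "B = frac y u"
    using assms(3) by (auto elim: loc_carrierE)
  \<comment> \<open>Adding after multiplying brings in \<open>s\<close> twice; both sides agree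
    after cancelling this common factor.\<close>
  have "frac (a \<odot>\<^bsub>M\<^esub> (u \<odot>\<^bsub>M\<^esub> x \<oplus>\<^bsub>M\<^esub> t \<odot>\<^bsub>M\<^esub> y)) (s \<otimes> (t \<otimes> u)) =
      frac ((s \<otimes> u) \<odot>\<^bsub>M\<^esub> (a \<odot>\<^bsub>M\<^esub> x) \<oplus>\<^bsub>M\<^esub> (s \<otimes> t) \<odot>\<^bsub>M\<^esub> (a \<odot>\<^bsub>M\<^esub> y)) ((s \<otimes> t) \<otimes> (s \<otimes> u))"
    using 1 2 3 by (intro loc_frac_eqI) (simp_all add: smult_r_distr smult_assoc1[symmetric] R.m_ac)
  then show ?thesis using 1 2 3 by (simp add: loc_add loc_smult)
qed

lemma loc_smult_l_distr:
  assumes "q \<in> carrier Rl" "q' \<in> carrier Rl" "A \<in> carrier L"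
  shows "(q \<oplus>\<^bsub>Rl\<^esub> q') \<odot>\<^bsub>L\<^esub> A = q \<odot>\<^bsub>L\<^esub> A \<oplus>\<^bsub>L\<^esub> q' \<odot>\<^bsub>L\<^esub> A"
proof -
  obtain a s where 1: "a \<in> carrier R" "s \<in> S" "q = sfrac a s"
    using assms(1) by (auto elim: self.loc_carrierE)
  obtain b t where 2: "b \<in> carrier R" "t \<in> S" "q' = sfrac b t"
    using assms(2) by (auto elim: self.loc_carrierE)
  obtain x u where 3: "x \<in> carrier M" "u \<in> S" "A = frac x u"
    using assms(3) by (auto elim: loc_carrierE)
  have "frac ((t \<otimes> a \<oplus> s \<otimes> b) \<odot>\<^bsub>M\<^esub> x) (s \<otimes> t \<otimes> u) =
      frac ((t \<otimes> u) \<odot>\<^bsub>M\<^esub> (a \<odot>\<^bsub>M\<^esub> x) \<oplus>\<^bsub>M\<^esub> (s \<otimes> u) \<odot>\<^bsub>M\<^esub> (b \<odot>\<^bsub>M\<^esub> x)) ((s \<otimes> u) \<otimes> (t \<otimes> u))"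
    using 1 2 3
    by (intro loc_frac_eqI) (simp_all add: smult_r_distr smult_l_distr smult_assoc1[symmetric] R.m_ac R.l_distr R.r_distr)
  then show ?thesis using 1 2 3 by (simp add: loc_add loc_smult self.loc_add)
qed

lemma loc_smult_one: "A \<in> carrier L \<Longrightarrow> \<one>\<^bsub>Rl\<^esub> \<odot>\<^bsub>L\<^esub> A = A"
  by (auto elim!: loc_carrierE simp: loc_smult)

lemma loc_mult_comm:
  assumes "q \<in> carrier Rl" "q' \<in> carrier Rl" shows "q \<otimes>\<^bsub>Rl\<^esub> q' = q' \<otimes>\<^bsub>Rl\<^esub> q"
proof -
  obtain a s where "a \<in> carrier R" "s \<in> S" "q = sfrac a s"
    using assms(1) by (auto elim: self.loc_carrierE)
  moreover obtain b t where "b \<in> carrier R" "t \<in> S" "q' = sfrac b t"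
    using assms(2) by (auto elim: self.loc_carrierE)
  ultimately show ?thesis by (simp add: self.loc_smult R.m_comm)
qed

end

context localization
begin

lemma cring_loc_ring: "cring Rl"
proof (rule cringI)
  interpret A: abelian_group "loc_module R S (self_module R)" by (rule self.abelian_group_loc_module)
  show "abelian_group Rl"
  proof (rule abelian_groupI)
    show "\<exists>y\<in>carrier Rl. y \<oplus>\<^bsub>Rl\<^esub> x = \<zero>\<^bsub>Rl\<^esub>" if "x \<in> carrier Rl" for x
      using that A.l_neg by auto
  qed (simp_all add: A.a_ac)
  show "comm_monoid Rl"
    using self.loc_smult_closed self.loc_smult_assoc self.loc_smult_one loc_mult_comm
    by (intro comm_monoidI) simp_all
  show "(x \<oplus>\<^bsub>Rl\<^esub> y) \<otimes>\<^bsub>Rl\<^esub> z = x \<otimes>\<^bsub>Rl\<^esub> z \<oplus>\<^bsub>Rl\<^esub> y \<otimes>\<^bsub>Rl\<^esub> z"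
    if "x \<in> carrier Rl" "y \<in> carrier Rl" "z \<in> carrier Rl" for x y z
    using self.loc_smult_l_distr that by simp
qed

lemma module_loc_module: "module Rl L"
  using cring_loc_ring abelian_group_loc_module loc_smult_closed loc_smult_assoc
    loc_smult_r_distr loc_smult_l_distr loc_smult_one
  by (intro moduleI) auto

end

section \<open>Spans of finite families, and generators of localized modules\<close>

context module
begin

lemma fam_span_empty: "fam_span R M a {} = {\<zero>\<^bsub>M\<^esub>}"
  by (auto simp: fam_span_def)

text \<open>Turns sums over an index set into iterated adjunction, which opens the statement to the
  lemmas on \<open>adjoin\<close> and \<open>lin_combs\<close>.\<close>

lemma fam_span_insert:
  assumes J: "finite J" "k \<notin> J" and a: "a \<in> insert k J \<rightarrow> carrier M"
  shows "fam_span R M a (insert k J) = adjoin M (carrier R) (fam_span R M a J) (a k)"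
proof (intro equalityI subsetI)
  have ac: "a k \<in> carrier M" "a \<in> J \<rightarrow> carrier M" using a by auto
  have sum: "(\<Oplus>\<^bsub>M\<^esub>j\<in>insert k J. r j \<odot>\<^bsub>M\<^esub> a j) = (\<Oplus>\<^bsub>M\<^esub>j\<in>J. r j \<odot>\<^bsub>M\<^esub> a j) \<oplus>\<^bsub>M\<^esub> r k \<odot>\<^bsub>M\<^esub> a k"
    if r: "r \<in> J \<rightarrow> carrier R" "r k \<in> carrier R" for r
  proof -
    have f: "(\<lambda>j. r j \<odot>\<^bsub>M\<^esub> a j) \<in> J \<rightarrow> carrier M" using r ac by auto
    show ?thesis using M.finsum_insert[OF J f] M.finsum_closed[OF f] r ac by (simp add: M.a_comm)
  qed
  {
    fix x assume "x \<in> fam_span R M a (insert k J)"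
    then obtain r where r: "x = (\<Oplus>\<^bsub>M\<^esub>j\<in>insert k J. r j \<odot>\<^bsub>M\<^esub> a j)" "r \<in> insert k J \<rightarrow> carrier R"
      by (auto simp: fam_span_def)
    then have r': "r \<in> J \<rightarrow> carrier R" "r k \<in> carrier R" by auto
    then show "x \<in> adjoin M (carrier R) (fam_span R M a J) (a k)"
      unfolding r(1) sum[OF r'] by (intro adjoinI) (auto simp: fam_span_def)
  }
  {
    fix x assume "x \<in> adjoin M (carrier R) (fam_span R M a J) (a k)"
    then obtain r c where r: "x = (\<Oplus>\<^bsub>M\<^esub>j\<in>J. r j \<odot>\<^bsub>M\<^esub> a j) \<oplus>\<^bsub>M\<^esub> c \<odot>\<^bsub>M\<^esub> a k" "r \<in> J \<rightarrow> carrier R"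
      "c \<in> carrier R"
      by (auto simp: fam_span_def elim!: adjoinE)
    define r' where "r' = r(k := c)"
    have r': "r' \<in> J \<rightarrow> carrier R" "r' k \<in> carrier R" "r' \<in> insert k J \<rightarrow> carrier R"
      using r J by (auto simp: r'_def)
    have "(\<Oplus>\<^bsub>M\<^esub>j\<in>J. r' j \<odot>\<^bsub>M\<^esub> a j) = (\<Oplus>\<^bsub>M\<^esub>j\<in>J. r j \<odot>\<^bsub>M\<^esub> a j)"
      using r r' ac J by (intro M.finsum_cong') (auto simp: r'_def)
    then have "x = (\<Oplus>\<^bsub>M\<^esub>j\<in>insert k J. r' j \<odot>\<^bsub>M\<^esub> a j)"
      unfolding sum[OF r'(1,2)] by (simp add: r(1)) (simp add: r'_def)
    then show "x \<in> fam_span R M a (insert k J)" using r'(3) by (auto simp: fam_span_def)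
  }
qed

lemma fam_span_submodule:
  assumes "finite J" "a \<in> J \<rightarrow> carrier M"
  shows "submodule (fam_span R M a J) R M"
  using assms
proof (induction J)
  case empty
  then show ?case unfolding fam_span_empty by (intro submoduleI) auto
next
  case (insert k J)
  then show ?case by (subst fam_span_insert) (auto intro!: adjoin_submodule)
qed

text \<open>The order is reversed because \<open>lin_combs\<close> adjoins the head of the list
  last, and the index set grows at \<open>n - 1\<close>.\<close>

lemma fam_span_lessThan:
  "a \<in> {..<n} \<rightarrow> carrier M \<Longrightarrow>
    fam_span R M a {..<n} = lin_combs M (carrier R) {\<zero>\<^bsub>M\<^esub>} (map a (rev [0..<n]))"
proof (induction n)
  case 0
  show ?case by (simp add: fam_span_empty)
next
  case (Suc n)
  have a: "a \<in> insert n {..<n} \<rightarrow> carrier M" "a \<in> {..<n} \<rightarrow> carrier M" using Suc.prems by auto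
  show ?case using fam_span_insert[OF _ _ a(1)] Suc.IH[OF a(2)] by (simp add: lessThan_Suc)
qed

lemma zero_submodule: "submodule {\<zero>\<^bsub>M\<^esub>} R M"
  by (intro submoduleI) auto

end

context localization
begin

text \<open>Any numerators \<open>ms\<close> of the generators \<open>Ys\<close> will do: the
  denominators of generators and coefficients are collected in the single denominator
  \<open>t\<close>.\<close>

lemma lin_combs_loc_numerators:
  assumes "list_all2 (\<lambda>Y m. m \<in> carrier M \<and> (\<exists>s\<in>S. Y = frac m s)) Ys ms"
    and "A \<in> lin_combs L (carrier Rl) {\<zero>\<^bsub>L\<^esub>} Ys"
  shows "\<exists>w\<in>lin_combs M (carrier R) {\<zero>\<^bsub>M\<^esub>} ms. \<exists>t\<in>S. A = frac w t"
  using assms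
proof (induction arbitrary: A rule: list_all2_induct)
  case Nil
  then show ?case by (auto simp: loc_zero intro!: bexI[of _ \<one>])
next
  case (Cons Y Ys m ms)
  then obtain B q where A: "A = B \<oplus>\<^bsub>L\<^esub> q \<odot>\<^bsub>L\<^esub> Y" "B \<in> lin_combs L (carrier Rl) {\<zero>\<^bsub>L\<^esub>} Ys" "q \<in> carrier Rl"
    by (auto elim: adjoinE)
  then obtain w t where w: "w \<in> lin_combs M (carrier R) {\<zero>\<^bsub>M\<^esub>} ms" "t \<in> S" "B = frac w t"
    using Cons.IH by blast
  obtain r p where q: "r \<in> carrier R" "p \<in> S" "q = sfrac r p"
    using A(3) by (auto elim: self.loc_carrierE)
  obtain s where Y: "s \<in> S" "Y = frac m s" "m \<in> carrier M" using Cons.hyps(1) by blast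
  have ms: "set ms \<subseteq> carrier M"
    using Cons.hyps(2) by (auto simp: list_all2_conv_all_nth in_set_conv_nth)
  have sub: "submodule (lin_combs M (carrier R) {\<zero>\<^bsub>M\<^esub>} ms) R M"
    by (rule lin_combs_submodule[OF zero_submodule ms])
  have wc: "w \<in> carrier M" using w(1) submodule_subset[OF sub] by blast
  have "A = frac ((p \<otimes> s) \<odot>\<^bsub>M\<^esub> w \<oplus>\<^bsub>M\<^esub> (t \<otimes> r) \<odot>\<^bsub>M\<^esub> m) (t \<otimes> (p \<otimes> s))"
    using A(1) w q Y wc by (simp add: loc_smult loc_add smult_assoc1)
  moreover have "(p \<otimes> s) \<odot>\<^bsub>M\<^esub> w \<oplus>\<^bsub>M\<^esub> (t \<otimes> r) \<odot>\<^bsub>M\<^esub> m \<in> lin_combs M (carrier R) {\<zero>\<^bsub>M\<^esub>} (m # ms)"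
    unfolding lin_combs.simps using w q Y submodule_smult[OF sub] by (intro adjoinI) auto
  ultimately show ?case using w q Y by (metis S_mult)
qed

lemma lin_combs_loc_fracs:
  assumes "set ms \<subseteq> carrier M" "w \<in> lin_combs M (carrier R) {\<zero>\<^bsub>M\<^esub>} ms" "t \<in> S"
  shows "frac w t \<in> lin_combs L (carrier Rl) {\<zero>\<^bsub>L\<^esub>} (map (\<lambda>m. frac m \<one>) ms)"
  using assms(1,2)
proof (induction ms arbitrary: w)
  case Nil
  have "frac \<zero>\<^bsub>M\<^esub> t = frac \<zero>\<^bsub>M\<^esub> \<one>" using assms(3) by (intro loc_frac_eqI) auto
  then show ?case using Nil by (simp add: loc_zero)
next
  case (Cons m ms)
  then obtain v c where w: "w = v \<oplus>\<^bsub>M\<^esub> c \<odot>\<^bsub>M\<^esub> m" "v \<in> lin_combs M (carrier R) {\<zero>\<^bsub>M\<^esub>} ms" "c \<in> carrier R"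
    by (auto elim: adjoinE)
  have c: "v \<in> carrier M" "m \<in> carrier M"
    using w(2) Cons.prems(1) lin_combs_closed[of "{\<zero>\<^bsub>M\<^esub>}" "carrier R" ms] by auto
  \<comment> \<open>Expanding by \<open>t\<close> makes the fraction match the formula for a sum of
    two fractions with denominator \<open>t\<close>.\<close>
  have "frac w t = frac (t \<odot>\<^bsub>M\<^esub> v \<oplus>\<^bsub>M\<^esub> t \<odot>\<^bsub>M\<^esub> (c \<odot>\<^bsub>M\<^esub> m)) (t \<otimes> t)"
    unfolding w(1) using w c assms(3)
    by (intro loc_frac_eqI) (simp_all add: smult_r_distr smult_assoc1[symmetric] R.m_ac)
  also have "\<dots> = frac v t \<oplus>\<^bsub>L\<^esub> sfrac c t \<odot>\<^bsub>L\<^esub> frac m \<one>"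
    using w c assms(3) by (simp add: loc_add loc_smult)
  finally have eq: "frac w t = frac v t \<oplus>\<^bsub>L\<^esub> sfrac c t \<odot>\<^bsub>L\<^esub> frac m \<one>" .
  show ?case
    unfolding eq list.map lin_combs.simps
    using Cons w assms(3) self.loc_frac_closed by (intro adjoinI) auto
qed

text \<open>Numerators of the generators are the required list in \<open>M\<close>. The hypothesis
  speaks of the fractions \<open>z / 1\<close>, which suits both the localized module and the images
  of generators of a base change.\<close>

lemma locally_generatedI_loc:
  assumes x: "x \<in> {..<n} \<rightarrow> carrier L"
    and gen: "\<And>z. z \<in> carrier M \<Longrightarrow> frac z \<one> \<in> fam_span Rl L x {..<n}"
  shows "locally_generated R M S (carrier M) {\<zero>\<^bsub>M\<^esub>} n"
proof -
  interpret L: module Rl L by (rule module_loc_module)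
  have "\<forall>i<n. \<exists>m s. m \<in> carrier M \<and> s \<in> S \<and> x i = frac m s"
    using x by (metis PiE lessThan_iff loc_carrierE)
  then obtain m s where ms: "\<And>i. i < n \<Longrightarrow> m i \<in> carrier M \<and> s i \<in> S \<and> x i = frac (m i) (s i)"
    by metis
  define ys where "ys = map m (rev [0..<n])"
  have la: "list_all2 (\<lambda>Y m. m \<in> carrier M \<and> (\<exists>s\<in>S. Y = frac m s)) (map x (rev [0..<n])) ys"
    using ms by (auto simp: ys_def list_all2_conv_all_nth rev_nth)
  have "\<exists>t\<in>S. t \<odot>\<^bsub>M\<^esub> z \<in> lin_combs M (carrier R) {\<zero>\<^bsub>M\<^esub>} ys" if z: "z \<in> carrier M" for z
  proof -
    have "frac z \<one> \<in> lin_combs L (carrier Rl) {\<zero>\<^bsub>L\<^esub>} (map x (rev [0..<n]))"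
      using gen[OF z] L.fam_span_lessThan[OF x] by simp
    then obtain w t where w: "w \<in> lin_combs M (carrier R) {\<zero>\<^bsub>M\<^esub>} ys" "t \<in> S" "frac z \<one> = frac w t"
      using lin_combs_loc_numerators[OF la] by blast
    have sub: "submodule (lin_combs M (carrier R) {\<zero>\<^bsub>M\<^esub>} ys) R M"
      using ms by (intro lin_combs_submodule[OF zero_submodule]) (auto simp: ys_def)
    have wc: "w \<in> carrier M" using w(1) submodule_subset[OF sub] by blast
    \<comment> \<open>The equality of \<open>z / 1\<close> and \<open>w / t\<close> holds only after
      multiplication by some \<open>u\<close>; hence the denominator of \<open>z\<close> is
      \<open>u t\<close>.\<close>
    obtain u where u: "u \<in> S" "u \<odot>\<^bsub>M\<^esub> (t \<odot>\<^bsub>M\<^esub> z) = u \<odot>\<^bsub>M\<^esub> w"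
      using loc_frac_eq_iff[OF z S_one wc w(2)] w(3) wc by auto
    have "(u \<otimes> t) \<odot>\<^bsub>M\<^esub> z \<in> lin_combs M (carrier R) {\<zero>\<^bsub>M\<^esub>} ys"
      using u w z submodule_smult[OF sub _ w(1)] by (simp add: smult_assoc1)
    then show ?thesis using u(1) w(2) S_mult by blast
  qed
  then show ?thesis
    unfolding locally_generated_def using ms by (intro exI[of _ ys]) (auto simp: ys_def)
qed

text \<open>The link between the localized modules of the theorem and the predicate of the proof:
  pass to numerators in one direction, to fractions with denominator 1 in the other.\<close>

lemma generated_by_loc_iff:
  "generated_by Rl L n \<longleftrightarrow> locally_generated R M S (carrier M) {\<zero>\<^bsub>M\<^esub>} n"
proof
  assume "generated_by Rl L n"
  then show "locally_generated R M S (carrier M) {\<zero>\<^bsub>M\<^esub>} n"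
    unfolding generated_by_def using locally_generatedI_loc by auto
next
  interpret L: module Rl L by (rule module_loc_module)
  assume "locally_generated R M S (carrier M) {\<zero>\<^bsub>M\<^esub>} n"
  then obtain ys where ys: "length ys = n" "set ys \<subseteq> carrier M"
    "\<forall>z\<in>carrier M. \<exists>t\<in>S. t \<odot>\<^bsub>M\<^esub> z \<in> lin_combs M (carrier R) {\<zero>\<^bsub>M\<^esub>} ys"
    unfolding locally_generated_def by blast
  \<comment> \<open>Reversed, since \<open>fam_span_lessThan\<close> lists the family from the
    largest index downwards.\<close>
  define x where "x i = frac (rev ys ! i) \<one>" for i
  have x: "x \<in> {..<n} \<rightarrow> carrier L"
  proof
    fix i assume "i \<in> {..<n}"
    then have "rev ys ! i \<in> set (rev ys)" using ys(1) by (intro nth_mem) simp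
    then have "rev ys ! i \<in> carrier M" using ys(2) by auto
    then show "x i \<in> carrier L" unfolding x_def by simp
  qed
  have "map x (rev [0..<n]) = rev (map (\<lambda>m. frac m \<one>) (map (nth (rev ys)) [0..<length (rev ys)]))"
    using ys(1) by (simp add: rev_map x_def comp_def)
  also have "\<dots> = map (\<lambda>m. frac m \<one>) ys" unfolding map_nth by (simp add: rev_map)
  finally have mapx: "map x (rev [0..<n]) = map (\<lambda>m. frac m \<one>) ys" .
  have "fam_span Rl L x {..<n} = carrier L"
  proof
    show "fam_span Rl L x {..<n} \<subseteq> carrier L"
      using L.submodule_subset[OF L.fam_span_submodule[OF _ x]] by simp
    show "carrier L \<subseteq> fam_span Rl L x {..<n}"
    proof
      fix A assume "A \<in> carrier L"
      then obtain z s where z: "z \<in> carrier M" "s \<in> S" "A = frac z s" by (metis loc_carrierE)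
      then obtain t where t: "t \<in> S" "t \<odot>\<^bsub>M\<^esub> z \<in> lin_combs M (carrier R) {\<zero>\<^bsub>M\<^esub>} ys" using ys(3) by blast
      have "A = frac (t \<odot>\<^bsub>M\<^esub> z) (t \<otimes> s)" using z t loc_frac_cancel by simp
      then show "A \<in> fam_span Rl L x {..<n}"
        using lin_combs_loc_fracs[OF ys(2) t(2), of "t \<otimes> s"] z t
        unfolding L.fam_span_lessThan[OF x] mapx by simp
    qed
  qed
  then show "generated_by Rl L n" unfolding generated_by_def using x by blast
qed

section \<open>Primes of a localization, and dimension against height\<close>

definition contract :: "('a \<times> 'a) set set \<Rightarrow> 'a set" where
  "contract Q = {r \<in> carrier R. sfrac r \<one> \<in> Q}"

definition extend :: "'a set \<Rightarrow> ('a \<times> 'a) set set" where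
  "extend \<qq> = {sfrac r s | r s. r \<in> \<qq> \<and> s \<in> S}"

end

context localization
begin

lemma sfrac_unit:
  assumes "r \<in> carrier R" "s \<in> S"
  shows "sfrac r \<one> = sfrac s \<one> \<otimes>\<^bsub>Rl\<^esub> sfrac r s" "sfrac r s = sfrac \<one> s \<otimes>\<^bsub>Rl\<^esub> sfrac r \<one>"
proof -
  have "sfrac (s \<otimes> r) s = sfrac r \<one>" using assms by (intro self.loc_frac_eqI) auto
  then show "sfrac r \<one> = sfrac s \<one> \<otimes>\<^bsub>Rl\<^esub> sfrac r s" using assms by (simp add: self.loc_smult)
  show "sfrac r s = sfrac \<one> s \<otimes>\<^bsub>Rl\<^esub> sfrac r \<one>" using assms by (simp add: self.loc_smult)
qed

lemma contract_prime:
  assumes "primeideal Q Rl"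
  shows "primeideal (contract Q) R" "contract Q \<inter> S = {}"
proof -
  interpret Q: primeideal Q Rl by fact
  have one: "\<one>\<^bsub>Rl\<^esub> \<notin> Q" using Q.I_notcarr Q.one_imp_carrier by metis
  have sub: "contract Q \<subseteq> carrier R" by (auto simp: contract_def)
  have add: "sfrac (a \<oplus> b) \<one> = sfrac a \<one> \<oplus>\<^bsub>Rl\<^esub> sfrac b \<one>" if "a \<in> carrier R" "b \<in> carrier R" for a b
    using that by (simp add: self.loc_add)
  have mult: "sfrac (a \<otimes> b) \<one> = sfrac a \<one> \<otimes>\<^bsub>Rl\<^esub> sfrac b \<one>" if "a \<in> carrier R" "b \<in> carrier R" for a b
    using that by (simp add: self.loc_smult)
  have cl: "sfrac a \<one> \<in> carrier Rl" if "a \<in> carrier R" for a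
    using that self.loc_frac_closed by simp
  have l: "r \<otimes> a \<in> contract Q" if "a \<in> contract Q" "r \<in> carrier R" for a r
    using that Q.I_l_closed[OF _ cl] mult by (auto simp: contract_def)
  show disj: "contract Q \<inter> S = {}"
  proof (rule ccontr)
    assume "contract Q \<inter> S \<noteq> {}"
    then obtain s where s: "s \<in> S" "sfrac s \<one> \<in> Q" by (auto simp: contract_def)
    have "sfrac \<one> s \<otimes>\<^bsub>Rl\<^esub> sfrac s \<one> \<in> Q"
      using s self.loc_frac_closed by (intro Q.I_l_closed) auto
    also have "sfrac \<one> s \<otimes>\<^bsub>Rl\<^esub> sfrac s \<one> = \<one>\<^bsub>Rl\<^esub>"
      using s by (simp add: self.loc_smult) (intro self.loc_frac_eqI; simp)
    finally show False using one by blast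
  qed
  show "primeideal (contract Q) R"
  proof (rule primeidealI)
    show "ideal (contract Q) R"
    proof (rule idealI)
      show "subgroup (contract Q) (add_monoid R)"
      proof (rule R.add.subgroupI)
        show "contract Q \<noteq> {}"
        proof -
          have "\<zero>\<^bsub>Rl\<^esub> = sfrac \<zero> \<one>" by (simp add: self.loc_zero)
          then have "sfrac \<zero> \<one> \<in> Q" using additive_subgroup.zero_closed[OF ideal.axioms(1)[OF Q.is_ideal]] by metis
          then have "\<zero> \<in> contract Q" by (simp add: contract_def)
          then show ?thesis by blast
        qed
        show "\<ominus> a \<in> contract Q" if "a \<in> contract Q" for a
        proof -
          have ac: "a \<in> carrier R" using that sub by blast
          have "(\<ominus> \<one>) \<otimes> a \<in> contract Q" using l[OF that] by simp
          then show ?thesis using ac by (simp add: R.l_minus)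
        qed
        show "a \<oplus> b \<in> contract Q" if "a \<in> contract Q" "b \<in> contract Q" for a b
          using that add additive_subgroup.a_closed[OF ideal.axioms(1)[OF Q.is_ideal]] by (auto simp: contract_def)
      qed (use sub in auto)
      show "a \<otimes> x \<in> contract Q" if "a \<in> contract Q" "x \<in> carrier R" for a x
        using l[OF that] that sub R.m_comm by (metis subsetD)
    qed (use l R.ring_axioms in auto)
    show "carrier R \<noteq> contract Q" using disj S_one R.one_closed by blast
    show "a \<in> contract Q \<or> b \<in> contract Q"
      if "a \<in> carrier R" "b \<in> carrier R" "a \<otimes> b \<in> contract Q" for a b
      using that Q.I_prime[OF cl cl] mult by (auto simp: contract_def)
  qed (rule R.is_cring)
qed

text \<open>A fraction and its numerator differ by a unit of the localization, so a fraction that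
  separates the two primes has a numerator that separates the contractions.\<close>

lemma contract_strict_mono:
  assumes P: "primeideal P Rl" and Q: "primeideal Q Rl" and "P \<subset> Q"
  shows "contract P \<subset> contract Q"
proof -
  interpret P: primeideal P Rl by fact
  interpret Q: primeideal Q Rl by fact
  obtain A where A: "A \<in> Q" "A \<notin> P" using assms(3) by blast
  then obtain r s where r: "r \<in> carrier R" "s \<in> S" "A = sfrac r s"
    using Q.Icarr self.loc_carrierE loc_ring_simps(1) self_module_simps(1) by metis
  have "sfrac r \<one> \<in> Q"
    using A r self.loc_frac_closed unfolding sfrac_unit(1)[OF r(1,2)] by (intro Q.I_l_closed) auto
  moreover have "sfrac r \<one> \<notin> P"
  proof
    assume "sfrac r \<one> \<in> P"
    then have "sfrac \<one> s \<otimes>\<^bsub>Rl\<^esub> sfrac r \<one> \<in> P"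
      using r self.loc_frac_closed by (intro P.I_l_closed) auto
    then show False using A(2) r sfrac_unit(2)[OF r(1,2)] by simp
  qed
  ultimately show ?thesis using assms(3) r(1) by (auto simp: contract_def)
qed

text \<open>As \<open>\<qq>\<close> is prime and misses \<open>S\<close>, membership of a fraction
  is decided by the numerator of any representation. This second claim yields that the extension is
  proper and prime.\<close>

lemma extend_prime:
  assumes q: "primeideal \<qq> R" and "\<qq> \<inter> S = {}"
  shows "primeideal (extend \<qq>) Rl"
    and "\<And>r s. r \<in> carrier R \<Longrightarrow> s \<in> S \<Longrightarrow> sfrac r s \<in> extend \<qq> \<longleftrightarrow> r \<in> \<qq>"
proof -
  interpret q: primeideal \<qq> R by fact
  interpret Rl: cring Rl by (rule cring_loc_ring)
  show mem: "sfrac r s \<in> extend \<qq> \<longleftrightarrow> r \<in> \<qq>" if rs: "r \<in> carrier R" "s \<in> S" for r s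
  proof
    assume "sfrac r s \<in> extend \<qq>"
    then obtain r' s' where r': "sfrac r s = sfrac r' s'" "r' \<in> \<qq>" "s' \<in> S" by (auto simp: extend_def)
    have "r' \<in> carrier R" using r'(2) q.Icarr by blast
    then obtain u where u: "u \<in> S" "u \<otimes> (s' \<otimes> r) = u \<otimes> (s \<otimes> r')"
      using self.loc_frac_eq_iff[of r s r' s'] r' rs by auto
    have "(u \<otimes> s') \<otimes> r \<in> \<qq>"
      using u r' that q.I_l_closed \<open>r' \<in> carrier R\<close> by (simp add: R.m_assoc)
    moreover have "u \<otimes> s' \<in> S" using u r' by simp
    ultimately show "r \<in> \<qq>" using q.I_prime[of "u \<otimes> s'" r] that(1) assms(2) by auto
  qed (use that in \<open>auto simp: extend_def\<close>)
  have sub: "extend \<qq> \<subseteq> carrier Rl" using q.Icarr self.loc_frac_closed by (auto simp: extend_def)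
  have l: "B \<otimes>\<^bsub>Rl\<^esub> A \<in> extend \<qq>" if A: "A \<in> extend \<qq>" and B: "B \<in> carrier Rl" for A B
  proof -
    obtain r s where r: "r \<in> \<qq>" "s \<in> S" "A = sfrac r s" using A by (auto simp: extend_def)
    obtain r' s' where r': "r' \<in> carrier R" "s' \<in> S" "B = sfrac r' s'"
      using B by (auto elim: self.loc_carrierE)
    have "B \<otimes>\<^bsub>Rl\<^esub> A = sfrac (r' \<otimes> r) (s' \<otimes> s)" using r r' q.Icarr by (simp add: self.loc_smult)
    moreover have "s' \<otimes> s \<in> S" using r r' by simp
    ultimately show ?thesis using q.I_l_closed[OF r(1) r'(1)] unfolding extend_def by blast
  qed
  show "primeideal (extend \<qq>) Rl"
  proof (rule primeidealI)
    show "ideal (extend \<qq>) Rl"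
    proof (rule idealI)
      show "subgroup (extend \<qq>) (add_monoid Rl)"
      proof (rule Rl.add.subgroupI)
        show "extend \<qq> \<noteq> {}" using additive_subgroup.zero_closed[OF ideal.axioms(1)[OF q.is_ideal]] S_one
          unfolding extend_def by blast
        show "\<ominus>\<^bsub>Rl\<^esub> A \<in> extend \<qq>" if "A \<in> extend \<qq>" for A
        proof -
          have Ac: "A \<in> carrier Rl" using that sub by blast
          have "(\<ominus>\<^bsub>Rl\<^esub> \<one>\<^bsub>Rl\<^esub>) \<otimes>\<^bsub>Rl\<^esub> A \<in> extend \<qq>"
            by (rule l[OF that Rl.a_inv_closed[OF Rl.one_closed]])
          then show ?thesis using Rl.l_minus[OF Rl.one_closed Ac] Rl.l_one[OF Ac] by simp
        qed
        show "A \<oplus>\<^bsub>Rl\<^esub> B \<in> extend \<qq>" if "A \<in> extend \<qq>" "B \<in> extend \<qq>" for A B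
        proof -
          obtain r s r' s' where r: "r \<in> \<qq>" "s \<in> S" "A = sfrac r s" "r' \<in> \<qq>" "s' \<in> S" "B = sfrac r' s'"
            using \<open>A \<in> extend \<qq>\<close> \<open>B \<in> extend \<qq>\<close> by (auto simp: extend_def)
          have "A \<oplus>\<^bsub>Rl\<^esub> B = sfrac (s' \<otimes> r \<oplus> s \<otimes> r') (s \<otimes> s')"
            using r q.Icarr by (simp add: self.loc_add)
          moreover have "s' \<otimes> r \<oplus> s \<otimes> r' \<in> \<qq>" using r q.I_l_closed additive_subgroup.a_closed[OF ideal.axioms(1)[OF q.is_ideal]] by simp
          moreover have "s \<otimes> s' \<in> S" using r by simp
          ultimately show ?thesis unfolding extend_def by auto
        qed
      qed (use sub in auto)
      show "A \<otimes>\<^bsub>Rl\<^esub> B \<in> extend \<qq>" if "A \<in> extend \<qq>" "B \<in> carrier Rl" for A B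
      proof -
        have Ac: "A \<in> carrier Rl" using sub that by blast
        show ?thesis unfolding Rl.m_comm[OF Ac that(2)] by (rule l[OF that])
      qed
    qed (fact Rl.ring_axioms, rule l)
    have "\<one>\<^bsub>Rl\<^esub> \<notin> extend \<qq>"
      using mem[of \<one> \<one>] assms(2) S_one R.one_closed by auto
    then show "carrier Rl \<noteq> extend \<qq>" using Rl.one_closed by blast
    fix A B assume AB: "A \<in> carrier Rl" "B \<in> carrier Rl" "A \<otimes>\<^bsub>Rl\<^esub> B \<in> extend \<qq>"
    obtain r s where r: "r \<in> carrier R" "s \<in> S" "A = sfrac r s"
      using AB(1) by (auto elim: self.loc_carrierE)
    obtain r' s' where r': "r' \<in> carrier R" "s' \<in> S" "B = sfrac r' s'"
      using AB(2) by (auto elim: self.loc_carrierE)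
    have "sfrac (r \<otimes> r') (s \<otimes> s') \<in> extend \<qq>" using AB(3) r r' by (simp add: self.loc_smult)
    then show "A \<in> extend \<qq> \<or> B \<in> extend \<qq>"
      using mem r r' q.I_prime by simp
  qed (rule cring_loc_ring)
qed

lemma extend_strict_mono:
  assumes "primeideal \<qq> R" "\<qq> \<inter> S = {}" "primeideal \<pp> R" "\<pp> \<inter> S = {}" "\<qq> \<subset> \<pp>"
  shows "extend \<qq> \<subset> extend \<pp>"
proof -
  obtain r where r: "r \<in> \<pp>" "r \<notin> \<qq>" using assms(5) by blast
  then have "r \<in> carrier R" using ideal.Icarr primeideal.axioms(1) assms(3) by metis
  then have "sfrac r \<one> \<in> extend \<pp>" "sfrac r \<one> \<notin> extend \<qq>"
    using extend_prime(2)[OF assms(3,4)] extend_prime(2)[OF assms(1,2)] r by auto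
  then show ?thesis using assms(5) unfolding extend_def by blast
qed

end

lemma (in cring) localization_at_prime:
  assumes "primeideal \<pp> R" shows "localization R (self_module R) (carrier R - \<pp>)"
  by (intro localization.intro localization_axioms.intro module_self_module
      primeideal_complement_submonoid assms)

context cring
begin

text \<open>The condition \<open>G_s\<close> speaks of dimensions of local rings, the proof counts
  with heights. The bounds increase with the dimension, so this inequality transfers them;
  \<open>krull_dim_ring_at_ge_1\<close> then makes \<open>G_s\<close> applicable at nonminimal
  primes.\<close>

lemma krull_dim_ring_at_le:
  assumes p: "primeideal \<pp> R"
  shows "krull_dim (ring_at R \<pp>) \<le> prime_height R \<pp>"
  unfolding krull_dim_def
proof (rule Sup_least)
  interpret localization R "self_module R" "carrier R - \<pp>" by (rule localization_at_prime[OF p])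
  fix x assume "x \<in> {enat n |n. \<exists>c. prime_chain (ring_at R \<pp>) n c}"
  then obtain n c where x: "x = enat n"
    and c: "\<And>i. i \<le> n \<Longrightarrow> primeideal (c i) (ring_at R \<pp>)" "\<And>i. i < n \<Longrightarrow> c i \<subset> c (Suc i)"
    by (auto simp: prime_chain_def)
  \<comment> \<open>The last contraction is contained in \<open>\<pp>\<close> but may differ from
    it. Replacing it by \<open>\<pp>\<close> keeps the chain strict and gives it the required
    end.\<close>
  define c' where "c' = (\<lambda>i. if i < n then contract (c i) else \<pp>)"
  have "contract (c n) \<subseteq> \<pp>"
    using contract_prime(2)[OF c(1)[of n]] by (auto simp: contract_def)
  then have "c' i \<subset> c' (Suc i)" if "i < n" for i
    using contract_strict_mono[OF c(1) c(1) c(2), of i] that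
    by (cases "Suc i = n") (auto simp: c'_def)
  moreover have "primeideal (c' i) R" for i using p contract_prime(1) c by (auto simp: c'_def)
  moreover have "c' n = \<pp>" by (simp add: c'_def)
  ultimately show "x \<le> prime_height R \<pp>"
    unfolding prime_height_def x by (intro Sup_upper) (auto simp: prime_chain_def)
qed

lemma krull_dim_ring_at_ge_1:
  assumes p: "primeideal \<pp> R" and q: "primeideal \<qq> R" "\<qq> \<subset> \<pp>"
  shows "1 \<le> krull_dim (ring_at R \<pp>)"
proof -
  interpret localization R "self_module R" "carrier R - \<pp>" by (rule localization_at_prime[OF p])
  have disj: "\<pp> \<inter> (carrier R - \<pp>) = {}" "\<qq> \<inter> (carrier R - \<pp>) = {}" using q(2) by auto
  define c where "c i = (if i = 0 then extend \<qq> else extend \<pp>)" for i :: nat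
  have "prime_chain (ring_at R \<pp>) 1 c"
    using extend_prime(1)[OF p disj(1)] extend_prime(1)[OF q(1) disj(2)]
      extend_strict_mono[OF q(1) disj(2) p disj(1) q(2)]
    by (auto simp: prime_chain_def c_def)
  then show ?thesis unfolding krull_dim_def one_enat_def by (intro Sup_upper) blast
qed

end

section \<open>The rank of a module\<close>

text \<open>The shape in which the additivity relations of the tensor product arrive in the
  localized module.\<close>

lemma (in abelian_group) add_diff_diff_cancel:
  assumes "x \<in> carrier G" "y \<in> carrier G" shows "x \<oplus> y \<ominus> x \<ominus> y = \<zero>"
proof -
  have "x \<oplus> y \<ominus> x = y" using assms by (simp add: minus_eq a_comm[of x y] a_assoc r_neg)
  then show ?thesis using assms by (simp add: minus_eq r_neg)
qed

context localization
begin

text \<open>The map sending the class of \<open>(x, q)\<close> to \<open>q\<close> times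
  \<open>x / 1\<close> is well defined on the tensor product, linear over the localized ring and
  hits every \<open>z / 1\<close>. Hence it carries generators of the base change to generators of
  the localized module.\<close>

lemma base_change_generators:
  defines "B \<equiv> base_change R Rl (\<lambda>r. sfrac r \<one>) M"
  assumes x: "x \<in> {..<n} \<rightarrow> carrier B" and gen: "fam_span Rl B x {..<n} = carrier B"
  shows "locally_generated R M S (carrier M) {\<zero>\<^bsub>M\<^esub>} n"
proof -
  interpret L: module Rl L by (rule module_loc_module)
  let ?X = "carrier M \<times> carrier Rl"
  define F where "F = free_Abelian_group ?X"
  define rels where "rels = tensor_relations R Rl (\<lambda>r. sfrac r \<one>) M"
  define H where "H = generate F rels"
  \<comment> \<open>Multiplication by \<open>q\<close> in the second factor, on the free group
    before passing to classes.\<close>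
  define \<psi> where "\<psi> q = frag_extend (\<lambda>(x, q'). frag_of (x, q \<otimes>\<^bsub>Rl\<^esub> q') :: 'c \<times> ('a \<times> 'a) set \<Rightarrow>\<^sub>0 int)" for q
  interpret F: comm_group F unfolding F_def by (rule abelian_free_Abelian_group)
  have F_carrier: "z \<in> carrier F \<longleftrightarrow> Poly_Mapping.keys z \<subseteq> ?X" for z by (simp add: F_def)
  have F_of: "frag_of p \<in> carrier F \<longleftrightarrow> p \<in> ?X" for p by (simp add: F_def)
  have F_diff: "u - v \<in> carrier F" if "u \<in> carrier F" "v \<in> carrier F" for u v
    using that keys_diff[of u v] by (auto simp: F_carrier)
  have F_minus: "u - v = u \<otimes>\<^bsub>F\<^esub> inv\<^bsub>F\<^esub> v" if "v \<in> carrier F" for u v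
    using that by (simp add: F_def)
  have sc: "sfrac r \<one> \<in> carrier Rl" if "r \<in> carrier R" for r using that self.loc_frac_closed by simp
  have rels_cases [consumes 1]: thesis
    if "u \<in> rels"
      "\<And>x y q. u = frag_of (x \<oplus>\<^bsub>M\<^esub> y, q) - frag_of (x, q) - frag_of (y, q) \<Longrightarrow>
        x \<in> carrier M \<Longrightarrow> y \<in> carrier M \<Longrightarrow> q \<in> carrier Rl \<Longrightarrow> thesis"
      "\<And>x q q'. u = frag_of (x, q \<oplus>\<^bsub>Rl\<^esub> q') - frag_of (x, q) - frag_of (x, q') \<Longrightarrow>
        x \<in> carrier M \<Longrightarrow> q \<in> carrier Rl \<Longrightarrow> q' \<in> carrier Rl \<Longrightarrow> thesis"
      "\<And>r x q. u = frag_of (r \<odot>\<^bsub>M\<^esub> x, q) - frag_of (x, sfrac r \<one> \<otimes>\<^bsub>Rl\<^esub> q) \<Longrightarrow>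
        r \<in> carrier R \<Longrightarrow> x \<in> carrier M \<Longrightarrow> q \<in> carrier Rl \<Longrightarrow> thesis"
    for u thesis
    using that unfolding rels_def tensor_relations_def by blast
  have rels_sub: "rels \<subseteq> carrier F"
  proof
    fix u assume "u \<in> rels"
    then show "u \<in> carrier F"
    proof (cases rule: rels_cases)
      case (1 x y q)
      then show ?thesis unfolding 1(1) by (intro F_diff) (simp_all add: F_of)
    next
      case (2 x q q')
      then show ?thesis unfolding 2(1) by (intro F_diff) (simp_all add: F_of del: loc_ring_simps)
    next
      case (3 r x q)
      then show ?thesis unfolding 3(1) using sc by (intro F_diff) (simp_all add: F_of del: loc_ring_simps)
    qed
  qed
  have H: "subgroup H F" unfolding H_def by (rule F.generate_is_subgroup[OF rels_sub])
  have Hn: "H \<lhd> F" using H by (simp add: F.normal_iff_subgroup)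
  have B_simps: "carrier B = carrier (F Mod H)" "ring.add B = monoid.mult (F Mod H)" "\<zero>\<^bsub>B\<^esub> = \<one>\<^bsub>F Mod H\<^esub>"
    unfolding B_def base_change_def Let_def F_def[symmetric] rels_def[symmetric] H_def[symmetric]
    by (simp_all add: FactGroup_def)
  have B_smult: "q \<odot>\<^bsub>B\<^esub> A = (\<Union>z\<in>A. H #>\<^bsub>F\<^esub> \<psi> q z)" for q A
    unfolding B_def base_change_def Let_def F_def[symmetric] rels_def[symmetric] H_def[symmetric] \<psi>_def
    by simp
  have comm_FH: "comm_group (F Mod H)" by (rule F.abelian_FactGroup[OF H])
  have abelian_B: "abelian_monoid B"
  proof -
    interpret FH: comm_group "F Mod H" by (rule comm_FH)
    show ?thesis
      by (rule abelian_monoidI) (simp_all add: B_simps FH.m_ac del: mult_FactGroup one_FactGroup)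
  qed
  have \<psi>_of: "\<psi> q (frag_of (x, q')) = frag_of (x, q \<otimes>\<^bsub>Rl\<^esub> q')" for q q' x
    by (simp add: \<psi>_def)
  have \<psi>_diff: "\<psi> q (u - v) = \<psi> q u - \<psi> q v" for q u v by (simp add: \<psi>_def frag_extend_diff)
  have \<psi>_add: "\<psi> q (u \<otimes>\<^bsub>F\<^esub> v) = \<psi> q u \<otimes>\<^bsub>F\<^esub> \<psi> q v" for q u v
    by (simp add: \<psi>_def F_def frag_extend_add)
  have \<psi>_zero: "\<psi> q 0 = 0" for q by (simp add: \<psi>_def)
  have F_one: "\<one>\<^bsub>F\<^esub> = 0" by (simp add: F_def)
  have \<psi>_closed: "\<psi> q u \<in> carrier F" if "q \<in> carrier Rl" "u \<in> carrier F" for q u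
    using that(2) unfolding F_carrier
  proof (induction u rule: free_Abelian_group_induct[consumes 1])
    case 1
    then show ?case by (simp add: \<psi>_def)
  next
    case (2 u v)
    then show ?case unfolding \<psi>_diff using F_diff unfolding F_carrier by blast
  next
    case (3 p)
    then show ?case using that(1) by (cases p) (simp add: \<psi>_of del: loc_ring_simps)
  qed
  have H_diff: "u - v \<in> H" if "u \<in> H" "v \<in> H" for u v
    using that F_minus subgroup.mem_carrier[OF H] subgroup.m_closed[OF H] subgroup.m_inv_closed[OF H] by simp
  have rels_H: "u \<in> H" if "u \<in> rels" for u unfolding H_def by (rule generate.incl[OF that])
  have \<psi>_rels: "\<psi> q u \<in> rels" if q: "q \<in> carrier Rl" and "u \<in> rels" for q u
    using that(2)
  proof (cases rule: rels_cases)
    case (1 x y q')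
    then show ?thesis
      using L.R.m_closed[OF q 1(4)] unfolding 1(1) \<psi>_diff \<psi>_of rels_def tensor_relations_def by blast
  next
    case (2 x q' q'')
    then show ?thesis
      using L.R.m_closed[OF q 2(3)] L.R.m_closed[OF q 2(4)] L.R.r_distr[OF 2(3,4) q]
      unfolding 2(1) \<psi>_diff \<psi>_of rels_def tensor_relations_def by auto
  next
    case (3 r x q')
    have "q \<otimes>\<^bsub>Rl\<^esub> (sfrac r \<one> \<otimes>\<^bsub>Rl\<^esub> q') = sfrac r \<one> \<otimes>\<^bsub>Rl\<^esub> (q \<otimes>\<^bsub>Rl\<^esub> q')"
      by (rule L.R.m_lcomm[OF q sc[OF 3(2)] 3(4)])
    then show ?thesis
      using L.R.m_closed[OF q 3(4)] 3
      unfolding 3(1) \<psi>_diff \<psi>_of rels_def tensor_relations_def by auto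
  qed
  \<comment> \<open>Each defining relation goes to a relation of the same kind, so \<open>H\<close>
    is preserved and the scalar action on cosets does not depend on the representative.\<close>
  have \<psi>_H: "\<psi> q u \<in> H" if q: "q \<in> carrier Rl" and "u \<in> H" for q u
    using that(2) unfolding H_def
  proof (induction rule: generate.induct)
    case one
    show ?case using generate.one[of F rels] by (simp add: F_one \<psi>_zero)
  next
    case (incl u)
    then show ?case using \<psi>_rels[OF q] generate.incl by metis
  next
    case (inv u)
    have "inv\<^bsub>F\<^esub> u = 0 - u" using inv rels_sub by (auto simp: F_def)
    moreover have "0 - \<psi> q u \<in> H"
      using \<psi>_rels[OF q inv] rels_H subgroup.one_closed[OF H] by (intro H_diff) (simp_all add: F_one)
    ultimately show ?case unfolding H_def[symmetric] by (simp only: \<psi>_diff \<psi>_zero)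
  next
    case (eng u v)
    then show ?case using generate.eng[OF eng(3,4)] by (simp add: \<psi>_add)
  qed
  have smult_coset: "q \<odot>\<^bsub>B\<^esub> (H #>\<^bsub>F\<^esub> z) = H #>\<^bsub>F\<^esub> \<psi> q z" if q: "q \<in> carrier Rl" and z: "z \<in> carrier F" for q z
  proof -
    have "H #>\<^bsub>F\<^esub> \<psi> q z' = H #>\<^bsub>F\<^esub> \<psi> q z" if z': "z' \<in> H #>\<^bsub>F\<^esub> z" for z'
    proof -
      obtain u where u: "u \<in> H" "z' = u \<otimes>\<^bsub>F\<^esub> z" using z' by (auto simp: r_coset_def)
      have "\<psi> q z' = \<psi> q u \<otimes>\<^bsub>F\<^esub> \<psi> q z" using u(2) by (simp only: \<psi>_add)
      then have "\<psi> q z' \<in> H #>\<^bsub>F\<^esub> \<psi> q z" using \<psi>_H[OF q u(1)] by (auto simp: r_coset_def)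
      then show ?thesis using F.repr_independence[OF _ \<psi>_closed[OF q z] H] by simp
    qed
    moreover have "z \<in> H #>\<^bsub>F\<^esub> z" using F.rcos_self[OF z H] .
    ultimately show ?thesis unfolding B_smult by blast
  qed

  \<comment> \<open>The universal property of the free abelian group gives \<open>h\<close>; it
    vanishes on \<open>H\<close> because the map on pairs is additive in both arguments and balanced
    over \<open>R\<close>.\<close>
  have "(\<lambda>(x, q). q \<odot>\<^bsub>L\<^esub> frac x \<one>) ` ?X \<subseteq> carrier (add_monoid L)"
    using loc_smult_closed by auto
  then obtain h where h: "h \<in> hom F (add_monoid L)"
    and h_of': "\<And>p. p \<in> ?X \<Longrightarrow> h (frag_of p) = (\<lambda>(x, q). q \<odot>\<^bsub>L\<^esub> frac x \<one>) p"
    using comm_group.free_Abelian_group_universal[OF L.M.a_comm_group] unfolding F_def by blast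
  have h_of: "h (frag_of (x, q)) = q \<odot>\<^bsub>L\<^esub> frac x \<one>" if "x \<in> carrier M" "q \<in> carrier Rl" for x q
    using h_of'[of "(x, q)"] that by simp
  interpret h: group_hom F "add_monoid L" h
    using h L.M.a_group by (intro group_hom.intro group_hom_axioms.intro F.is_group)
  have h_closed: "h u \<in> carrier L" if "u \<in> carrier F" for u using h.hom_closed[OF that] by simp
  have h_add: "h (u \<otimes>\<^bsub>F\<^esub> v) = h u \<oplus>\<^bsub>L\<^esub> h v" if "u \<in> carrier F" "v \<in> carrier F" for u v
    using h.hom_mult[OF that] by simp
  have h_diff: "h (u - v) = h u \<ominus>\<^bsub>L\<^esub> h v" if "u \<in> carrier F" "v \<in> carrier F" for u v
    using h_add[of u "inv\<^bsub>F\<^esub> v"] h.hom_inv[of v] that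
    by (simp add: F_minus a_inv_def L.M.minus_eq)
  have h_zero: "h 0 = \<zero>\<^bsub>L\<^esub>" using h.hom_one by (simp add: F_def)
  have h_rels: "h u = \<zero>\<^bsub>L\<^esub>" if "u \<in> rels" for u
    using that
  proof (cases rule: rels_cases)
    case (1 x y q)
    have c: "frag_of (x \<oplus>\<^bsub>M\<^esub> y, q) \<in> carrier F" "frag_of (x, q) \<in> carrier F" "frag_of (y, q) \<in> carrier F"
      using 1 by (simp_all add: F_of del: loc_ring_simps)
    have f: "frac (x \<oplus>\<^bsub>M\<^esub> y) \<one> = frac x \<one> \<oplus>\<^bsub>L\<^esub> frac y \<one>" using 1 by (simp add: loc_add)
    have "h u = (q \<odot>\<^bsub>L\<^esub> frac x \<one> \<oplus>\<^bsub>L\<^esub> q \<odot>\<^bsub>L\<^esub> frac y \<one>) \<ominus>\<^bsub>L\<^esub> q \<odot>\<^bsub>L\<^esub> frac x \<one> \<ominus>\<^bsub>L\<^esub> q \<odot>\<^bsub>L\<^esub> frac y \<one>"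
      unfolding 1(1) using c 1 F_diff
      by (simp add: h_diff h_of f L.smult_r_distr del: loc_ring_simps)
    also have "\<dots> = \<zero>\<^bsub>L\<^esub>"
      using 1 by (intro L.M.add_diff_diff_cancel L.smult_closed loc_frac_closed S_one)
    finally show ?thesis .
  next
    case (2 x q q')
    have c: "frag_of (x, q \<oplus>\<^bsub>Rl\<^esub> q') \<in> carrier F" "frag_of (x, q) \<in> carrier F" "frag_of (x, q') \<in> carrier F"
      using 2 by (simp_all add: F_of del: loc_ring_simps)
    have "h u = (q \<odot>\<^bsub>L\<^esub> frac x \<one> \<oplus>\<^bsub>L\<^esub> q' \<odot>\<^bsub>L\<^esub> frac x \<one>) \<ominus>\<^bsub>L\<^esub> q \<odot>\<^bsub>L\<^esub> frac x \<one> \<ominus>\<^bsub>L\<^esub> q' \<odot>\<^bsub>L\<^esub> frac x \<one>"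
      unfolding 2(1) using c 2 F_diff
      by (simp add: h_diff h_of L.smult_l_distr del: loc_ring_simps)
    also have "\<dots> = \<zero>\<^bsub>L\<^esub>"
      using 2 by (intro L.M.add_diff_diff_cancel L.smult_closed loc_frac_closed S_one)
    finally show ?thesis .
  next
    case (3 r x q)
    have c: "frag_of (r \<odot>\<^bsub>M\<^esub> x, q) \<in> carrier F" "frag_of (x, sfrac r \<one> \<otimes>\<^bsub>Rl\<^esub> q) \<in> carrier F"
      using 3 sc by (simp_all add: F_of del: loc_ring_simps)
    have f: "frac (r \<odot>\<^bsub>M\<^esub> x) \<one> = sfrac r \<one> \<odot>\<^bsub>L\<^esub> frac x \<one>" using 3 by (simp add: loc_smult)
    have "(sfrac r \<one> \<otimes>\<^bsub>Rl\<^esub> q) \<odot>\<^bsub>L\<^esub> frac x \<one> = (q \<otimes>\<^bsub>Rl\<^esub> sfrac r \<one>) \<odot>\<^bsub>L\<^esub> frac x \<one>"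
      using L.R.m_comm[OF sc[OF 3(2)] 3(4)] by simp
    also have "\<dots> = q \<odot>\<^bsub>L\<^esub> (sfrac r \<one> \<odot>\<^bsub>L\<^esub> frac x \<one>)"
      using 3 sc by (intro L.smult_assoc1) auto
    finally have "h u = q \<odot>\<^bsub>L\<^esub> (sfrac r \<one> \<odot>\<^bsub>L\<^esub> frac x \<one>) \<ominus>\<^bsub>L\<^esub> q \<odot>\<^bsub>L\<^esub> (sfrac r \<one> \<odot>\<^bsub>L\<^esub> frac x \<one>)"
      unfolding 3(1) using c 3 sc by (simp add: h_diff h_of f del: loc_ring_simps)
    also have "\<dots> = \<zero>\<^bsub>L\<^esub>"
      using 3 sc by (simp add: L.M.minus_eq L.M.r_neg L.smult_closed del: loc_ring_simps)
    finally show ?thesis .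
  qed
  have h_H: "h u = \<zero>\<^bsub>L\<^esub>" if "u \<in> H" for u
    using that unfolding H_def
  proof (induction rule: generate.induct)
    case one
    then show ?case using h.hom_one by simp
  next
    case (incl u)
    then show ?case by (rule h_rels)
  next
    case (inv u)
    then have u: "u \<in> carrier F" using rels_sub by blast
    then have "inv\<^bsub>F\<^esub> u = 0 - u" by (simp add: F_def)
    moreover have "0 \<in> carrier F" by (simp add: F_carrier)
    ultimately show ?case
      using h_diff[of 0 u] u h_rels[OF inv] h_zero L.M.r_neg[OF L.M.zero_closed]
      by (simp only: L.M.minus_eq)
  next
    case (eng u v)
    then show ?case using h_add[of u v] F.generate_in_carrier[OF rels_sub] by simp
  qed
  have h_coset: "h u = h v" if "u \<in> carrier F" "v \<in> carrier F" "H #>\<^bsub>F\<^esub> u = H #>\<^bsub>F\<^esub> v" for u v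
  proof -
    have "u \<in> H #>\<^bsub>F\<^esub> v" using F.rcos_self[OF that(1) H] that(3) by simp
    then obtain w where w: "w \<in> H" "u = w \<otimes>\<^bsub>F\<^esub> v" by (auto simp: r_coset_def)
    then show ?thesis
      using h_add[of w v] h_H subgroup.mem_carrier[OF H] that(2) h_closed by simp
  qed
  \<comment> \<open>\<open>h\<close> is constant on cosets and so factors through the quotient by
    \<open>H\<close>, which is the additive group of the base change.\<close>
  obtain g where g: "g \<in> hom (F Mod H) (add_monoid L)"
    and g_coset: "\<And>z. z \<in> carrier F \<Longrightarrow> g (H #>\<^bsub>F\<^esub> z) = h z"
    using FactGroup_universal[OF h Hn h_coset] by metis
  have g_closed: "g A \<in> carrier L" if "A \<in> carrier B" for A
    using hom_in_carrier[OF g] that by (simp add: B_simps)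
  have g_add: "g (A \<oplus>\<^bsub>B\<^esub> A') = g A \<oplus>\<^bsub>L\<^esub> g A'" if "A \<in> carrier B" "A' \<in> carrier B" for A A'
    using hom_mult[OF g] that by (simp add: B_simps)
  have g_zero: "g \<zero>\<^bsub>B\<^esub> = \<zero>\<^bsub>L\<^esub>"
  proof -
    have "g (H #>\<^bsub>F\<^esub> \<one>\<^bsub>F\<^esub>) = \<zero>\<^bsub>L\<^esub>" using g_coset h.hom_one by simp
    then show ?thesis using F.coset_mult_one[OF subgroup.subset[OF H]] by (simp add: B_simps)
  qed
  have B_cosetE: "\<exists>z\<in>carrier F. A = H #>\<^bsub>F\<^esub> z" if "A \<in> carrier B" for A
    using that by (auto simp: B_simps carrier_FactGroup)
  have cosetB: "H #>\<^bsub>F\<^esub> z \<in> carrier B" if "z \<in> carrier F" for z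
    using that by (auto simp: B_simps carrier_FactGroup)
  have h_\<psi>: "h (\<psi> q u) = q \<odot>\<^bsub>L\<^esub> h u" if q: "q \<in> carrier Rl" and u: "u \<in> carrier F" for q u
  proof -
    have "Poly_Mapping.keys u \<subseteq> ?X" using u by (simp add: F_carrier)
    then show ?thesis
    proof (induction u rule: free_Abelian_group_induct[consumes 1])
      case 1
      then show ?case using h_zero L.smult_r_null[OF q] by (simp add: \<psi>_def)
    next
      case (2 u v)
      then have c: "u \<in> carrier F" "v \<in> carrier F" by (simp_all add: F_carrier)
      show ?case
        using 2 c q \<psi>_closed h_closed
        by (simp add: \<psi>_diff h_diff L.M.minus_eq L.smult_r_distr L.smult_r_minus del: loc_ring_simps)
    next
      case (3 p)
      then obtain x q' where "p = (x, q')" "x \<in> carrier M" "q' \<in> carrier Rl" by auto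
      then show ?case
        using q by (simp add: \<psi>_of h_of L.smult_assoc1 del: loc_ring_simps)
    qed
  qed
  have smult_closed: "q \<odot>\<^bsub>B\<^esub> A \<in> carrier B" and g_smult: "g (q \<odot>\<^bsub>B\<^esub> A) = q \<odot>\<^bsub>L\<^esub> g A"
    if "q \<in> carrier Rl" "A \<in> carrier B" for q A
    using B_cosetE[OF that(2)] that(1) by (auto simp: smult_coset g_coset \<psi>_closed h_\<psi> cosetB)
  interpret B: abelian_monoid B by (rule abelian_B)
  have g_sum: "g (\<Oplus>\<^bsub>B\<^esub>j\<in>J. r j \<odot>\<^bsub>B\<^esub> x j) = (\<Oplus>\<^bsub>L\<^esub>j\<in>J. r j \<odot>\<^bsub>L\<^esub> g (x j))"
    if "finite J" "r \<in> J \<rightarrow> carrier Rl" "x \<in> J \<rightarrow> carrier B" for J r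
    using that
  proof (induction J)
    case empty
    then show ?case by (simp add: g_zero)
  next
    case (insert k J)
    have f: "(\<lambda>j. r j \<odot>\<^bsub>B\<^esub> x j) \<in> J \<rightarrow> carrier B" "r k \<odot>\<^bsub>B\<^esub> x k \<in> carrier B"
      using insert.prems smult_closed by (auto simp: Pi_def simp del: loc_ring_simps)
    have f': "(\<lambda>j. r j \<odot>\<^bsub>L\<^esub> g (x j)) \<in> J \<rightarrow> carrier L" "r k \<odot>\<^bsub>L\<^esub> g (x k) \<in> carrier L"
      using insert.prems g_closed loc_smult_closed by (auto simp: Pi_def simp del: loc_ring_simps)
    show ?case
      using insert B.finsum_insert[OF insert.hyps f] L.M.finsum_insert[OF insert.hyps f']
        g_add[OF f(2) B.finsum_closed[OF f(1)]] g_smult[of "r k" "x k"]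
      by (simp add: Pi_def del: loc_ring_simps)
  qed
  show ?thesis
  proof (rule locally_generatedI_loc)
    show "(\<lambda>i. g (x i)) \<in> {..<n} \<rightarrow> carrier L" using x g_closed by auto
    fix z assume z: "z \<in> carrier M"
    have zF: "frag_of (z, \<one>\<^bsub>Rl\<^esub>) \<in> carrier F" using z L.R.one_closed by (simp add: F_of del: loc_ring_simps)
    then obtain r where r: "H #>\<^bsub>F\<^esub> frag_of (z, \<one>\<^bsub>Rl\<^esub>) = (\<Oplus>\<^bsub>B\<^esub>j\<in>{..<n}. r j \<odot>\<^bsub>B\<^esub> x j)"
      "r \<in> {..<n} \<rightarrow> carrier Rl"
      using cosetB gen unfolding fam_span_def by blast
    \<comment> \<open>The class of \<open>(z, 1)\<close> is a preimage of \<open>z / 1\<close>; its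
      expression by the given generators is transported by \<open>g\<close>.\<close>
    have "frac z \<one> = \<one>\<^bsub>Rl\<^esub> \<odot>\<^bsub>L\<^esub> frac z \<one>" using z loc_smult_one by simp
    also have "\<dots> = g (H #>\<^bsub>F\<^esub> frag_of (z, \<one>\<^bsub>Rl\<^esub>))"
      using g_coset[OF zF] h_of[OF z L.R.one_closed] by simp
    also have "\<dots> = (\<Oplus>\<^bsub>L\<^esub>j\<in>{..<n}. r j \<odot>\<^bsub>L\<^esub> g (x j))"
      unfolding r(1) using g_sum[OF _ r(2) x] by simp
    finally show "frac z \<one> \<in> fam_span Rl L (\<lambda>i. g (x i)) {..<n}"
      unfolding fam_span_def using r(2) by blast
  qed
qed

end

lemma regular_elements_submonoid:
  assumes "cring R" shows "submonoid (regular_elements R) R"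
proof -
  interpret cring R by fact
  show ?thesis
  proof (rule submonoid.intro)
    show "regular_elements R \<subseteq> carrier R" by (auto simp: regular_elements_def)
    show "\<one>\<^bsub>R\<^esub> \<in> regular_elements R" by (simp add: regular_elements_def)
    fix s t assume st: "s \<in> regular_elements R" "t \<in> regular_elements R"
    have "x = \<zero>\<^bsub>R\<^esub>" if "x \<in> carrier R" "(s \<otimes>\<^bsub>R\<^esub> t) \<otimes>\<^bsub>R\<^esub> x = \<zero>\<^bsub>R\<^esub>" for x
    proof -
      have c: "s \<in> carrier R" "t \<in> carrier R" using st by (auto simp: regular_elements_def)
      then have "s \<otimes>\<^bsub>R\<^esub> (t \<otimes>\<^bsub>R\<^esub> x) = \<zero>\<^bsub>R\<^esub>" using that m_assoc by metis
      then have "t \<otimes>\<^bsub>R\<^esub> x = \<zero>\<^bsub>R\<^esub>" using st(1) c that(1) unfolding regular_elements_def by blast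
      then show ?thesis using st(2) that(1) unfolding regular_elements_def by blast
    qed
    moreover have "s \<otimes>\<^bsub>R\<^esub> t \<in> carrier R" using st by (auto simp: regular_elements_def)
    ultimately show "s \<otimes>\<^bsub>R\<^esub> t \<in> regular_elements R" unfolding regular_elements_def by blast
  qed
qed

text \<open>The total quotient ring is the localization at the regular elements, so a basis of the
  base change yields \<open>e\<close> generators of \<open>M\<close> up to regular
  denominators.\<close>

lemma (in module) has_rank_generators:
  assumes "has_rank R M e"
  shows "locally_generated R M (regular_elements R) (carrier M) {\<zero>\<^bsub>M\<^esub>} e"
proof -
  interpret localization R M "regular_elements R"
    by (intro localization.intro localization_axioms.intro module_axioms
        regular_elements_submonoid R.is_cring)
  have to: "to_total_quotient_ring R = (\<lambda>r. loc_frac (regular_elements R) (self_module R) r \<one>)"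
    by (simp add: fun_eq_iff to_total_quotient_ring_def)
  let ?B = "base_change R (total_quotient_ring R) (to_total_quotient_ring R) M"
  obtain x where x: "x \<in> {..<e} \<rightarrow> carrier ?B" "fam_span (total_quotient_ring R) ?B x {..<e} = carrier ?B"
    using assms unfolding has_rank_def free_of_rank_def by blast
  show ?thesis by (rule base_change_generators[OF x[unfolded to]])
qed

lemma (in module) mu_at_eq:
  assumes "primeideal \<pp> R"
  shows "mu_at R \<pp> M = Inf {enat n |n. locally_generated R M (carrier R - \<pp>) (carrier M) {\<zero>\<^bsub>M\<^esub>} n}"
proof -
  interpret localization R M "carrier R - \<pp>"
    by (intro localization.intro localization_axioms.intro module_axioms
        primeideal_complement_submonoid assms)
  show ?thesis unfolding mu_at_def min_gens_def generated_by_loc_iff ..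
qed

section \<open>Quotient modules\<close>

context module
begin

context
  fixes U assumes U: "submodule U R M"
begin

lemma abelian_subgroup_submodule: "abelian_subgroup U M"
  using submodule.axioms(1)[OF U]
  by (intro abelian_subgroupI3 additive_subgroupI M.abelian_group_axioms)

interpretation U: abelian_subgroup U M by (rule abelian_subgroup_submodule)

lemma quot_module_coset: "x \<in> carrier M \<Longrightarrow> U +>\<^bsub>M\<^esub> x \<in> carrier (quot_module M U)"
  using M.a_rcosetsI[OF submodule_subset[OF U]] by (simp add: quot_module_def)

lemma quot_module_cosetE:
  assumes "A \<in> carrier (quot_module M U)"
  obtains x where "x \<in> carrier M" "A = U +>\<^bsub>M\<^esub> x"
  using assms by (auto simp: quot_module_def A_RCOSETS_def' a_r_coset_def')

lemma quot_module_add: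
  assumes "x \<in> carrier M" "y \<in> carrier M"
  shows "(U +>\<^bsub>M\<^esub> x) \<oplus>\<^bsub>quot_module M U\<^esub> (U +>\<^bsub>M\<^esub> y) = U +>\<^bsub>M\<^esub> (x \<oplus>\<^bsub>M\<^esub> y)"
  using U.a_rcos_sum[OF assms] by (simp add: quot_module_def)

lemma coset_eq_iff:
  assumes "x \<in> carrier M" "y \<in> carrier M"
  shows "U +>\<^bsub>M\<^esub> x = U +>\<^bsub>M\<^esub> y \<longleftrightarrow> x \<ominus>\<^bsub>M\<^esub> y \<in> U"
proof
  assume "U +>\<^bsub>M\<^esub> x = U +>\<^bsub>M\<^esub> y"
  then have "x \<in> U +>\<^bsub>M\<^esub> y" using U.a_rcos_self[OF assms(1)] by simp
  then show "x \<ominus>\<^bsub>M\<^esub> y \<in> U" using U.a_rcos_module_imp assms by (simp add: M.minus_eq)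
next
  assume "x \<ominus>\<^bsub>M\<^esub> y \<in> U"
  then have "x \<in> U +>\<^bsub>M\<^esub> y" using U.a_rcos_module_rev assms by (simp add: M.minus_eq)
  then show "U +>\<^bsub>M\<^esub> x = U +>\<^bsub>M\<^esub> y" using U.a_repr_independence' assms by metis
qed

lemma coset_eq_self: "x \<in> U \<Longrightarrow> U +>\<^bsub>M\<^esub> x = U"
  by (rule U.a_rcos_const)

lemma quot_module_zero: "\<zero>\<^bsub>quot_module M U\<^esub> = U +>\<^bsub>M\<^esub> \<zero>\<^bsub>M\<^esub>"
  using coset_eq_self[OF submodule_zero[OF U]] by (simp add: quot_module_def)

lemma quot_module_smult:
  assumes r: "r \<in> carrier R" and x: "x \<in> carrier M"
  shows "r \<odot>\<^bsub>quot_module M U\<^esub> (U +>\<^bsub>M\<^esub> x) = U +>\<^bsub>M\<^esub> (r \<odot>\<^bsub>M\<^esub> x)"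
proof -
  have *: "U +>\<^bsub>M\<^esub> (r \<odot>\<^bsub>M\<^esub> y) = U +>\<^bsub>M\<^esub> (r \<odot>\<^bsub>M\<^esub> x)" if y: "y \<in> U +>\<^bsub>M\<^esub> x" for y
  proof -
    have yc: "y \<in> carrier M" by (rule U.a_elemrcos_carrier[OF x y])
    have "y \<ominus>\<^bsub>M\<^esub> x \<in> U" using U.a_rcos_module_imp[OF x y] by (simp add: M.minus_eq)
    then have "r \<odot>\<^bsub>M\<^esub> (y \<ominus>\<^bsub>M\<^esub> x) \<in> U" using submodule_smult[OF U r] by blast
    also have "r \<odot>\<^bsub>M\<^esub> (y \<ominus>\<^bsub>M\<^esub> x) = r \<odot>\<^bsub>M\<^esub> y \<ominus>\<^bsub>M\<^esub> r \<odot>\<^bsub>M\<^esub> x"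
      using r x yc by (simp add: M.minus_eq smult_r_distr smult_r_minus)
    finally show ?thesis using coset_eq_iff r x yc by simp
  qed
  have "r \<odot>\<^bsub>quot_module M U\<^esub> (U +>\<^bsub>M\<^esub> x) = (\<Union>y\<in>U +>\<^bsub>M\<^esub> x. U +>\<^bsub>M\<^esub> (r \<odot>\<^bsub>M\<^esub> y))"
    by (simp add: quot_module_def)
  also have "\<dots> = U +>\<^bsub>M\<^esub> (r \<odot>\<^bsub>M\<^esub> x)" using * U.a_rcos_self[OF x] by blast
  finally show ?thesis .
qed

lemma module_quot_module: "module R (quot_module M U)"
proof (rule moduleI)
  note simps = quot_module_add quot_module_smult quot_module_zero
  show "abelian_group (quot_module M U)"
  proof (rule abelian_groupI)
    show "\<exists>B\<in>carrier (quot_module M U). B \<oplus>\<^bsub>quot_module M U\<^esub> A = \<zero>\<^bsub>quot_module M U\<^esub>"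
      if A: "A \<in> carrier (quot_module M U)" for A
    proof -
      obtain x where "x \<in> carrier M" "A = U +>\<^bsub>M\<^esub> x" using A by (rule quot_module_cosetE)
      then show ?thesis
        by (intro bexI[of _ "U +>\<^bsub>M\<^esub> (\<ominus>\<^bsub>M\<^esub> x)"]) (simp_all add: simps M.l_neg quot_module_coset)
    qed
  qed (((elim quot_module_cosetE)?, simp add: simps quot_module_coset M.a_ac)+)
  fix a b A B
  assume ab: "a \<in> carrier R" "b \<in> carrier R"
    and "A \<in> carrier (quot_module M U)" "B \<in> carrier (quot_module M U)"
  then obtain x y where xy: "x \<in> carrier M" "A = U +>\<^bsub>M\<^esub> x" "y \<in> carrier M" "B = U +>\<^bsub>M\<^esub> y"
    by (metis quot_module_cosetE)
  show "a \<odot>\<^bsub>quot_module M U\<^esub> (A \<oplus>\<^bsub>quot_module M U\<^esub> B) =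
      a \<odot>\<^bsub>quot_module M U\<^esub> A \<oplus>\<^bsub>quot_module M U\<^esub> a \<odot>\<^bsub>quot_module M U\<^esub> B"
    using ab xy by (simp add: simps smult_r_distr)
  show "(a \<oplus> b) \<odot>\<^bsub>quot_module M U\<^esub> A =
      a \<odot>\<^bsub>quot_module M U\<^esub> A \<oplus>\<^bsub>quot_module M U\<^esub> b \<odot>\<^bsub>quot_module M U\<^esub> A"
    using ab xy by (simp add: simps smult_l_distr)
  show "(a \<otimes> b) \<odot>\<^bsub>quot_module M U\<^esub> A = a \<odot>\<^bsub>quot_module M U\<^esub> (b \<odot>\<^bsub>quot_module M U\<^esub> A)"
    using ab xy by (simp add: simps smult_assoc1)
  show "a \<odot>\<^bsub>quot_module M U\<^esub> A \<in> carrier (quot_module M U)"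
    using ab xy by (simp add: simps quot_module_coset)
next
  fix A assume "A \<in> carrier (quot_module M U)"
  then show "\<one> \<odot>\<^bsub>quot_module M U\<^esub> A = A"
    by (elim quot_module_cosetE) (simp add: quot_module_smult)
qed (rule R.is_cring)

lemma lin_combs_quot_module:
  assumes "set ys \<subseteq> carrier M"
  shows "lin_combs (quot_module M U) (carrier R) {\<zero>\<^bsub>quot_module M U\<^esub>} (map (a_r_coset M U) ys) =
    a_r_coset M U ` lin_combs M (carrier R) U ys"
  using assms
proof (induction ys)
  case Nil
  have "a_r_coset M U ` U = (\<lambda>_. U) ` U" by (rule image_cong[OF refl coset_eq_self])
  also have "\<dots> = {U}" using submodule_zero[OF U] by (intro image_constant)
  finally have "a_r_coset M U ` U = {U}" .
  then show ?case using coset_eq_self[OF submodule_zero[OF U]] by (simp add: quot_module_zero)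
next
  case (Cons y ys)
  let ?K = "lin_combs M (carrier R) U ys"
  have K: "?K \<subseteq> carrier M" using lin_combs_closed[OF submodule_subset[OF U]] Cons.prems by simp
  have eq: "(U +>\<^bsub>M\<^esub> v) \<oplus>\<^bsub>quot_module M U\<^esub> c \<odot>\<^bsub>quot_module M U\<^esub> (U +>\<^bsub>M\<^esub> y) = U +>\<^bsub>M\<^esub> (v \<oplus>\<^bsub>M\<^esub> c \<odot>\<^bsub>M\<^esub> y)"
    if "v \<in> ?K" "c \<in> carrier R" for v c
    using that K Cons.prems by (simp add: subsetD quot_module_smult quot_module_add)
  have "adjoin (quot_module M U) (carrier R) (a_r_coset M U ` ?K) (U +>\<^bsub>M\<^esub> y) =
      a_r_coset M U ` adjoin M (carrier R) ?K y"
  proof (intro equalityI subsetI)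
    fix A assume "A \<in> adjoin (quot_module M U) (carrier R) (a_r_coset M U ` ?K) (U +>\<^bsub>M\<^esub> y)"
    then obtain v c where A: "A = (U +>\<^bsub>M\<^esub> v) \<oplus>\<^bsub>quot_module M U\<^esub> c \<odot>\<^bsub>quot_module M U\<^esub> (U +>\<^bsub>M\<^esub> y)"
      "v \<in> ?K" "c \<in> carrier R" by (auto elim!: adjoinE)
    show "A \<in> a_r_coset M U ` adjoin M (carrier R) ?K y"
      unfolding A(1) eq[OF A(2,3)] by (intro imageI adjoinI A)
  next
    fix A assume "A \<in> a_r_coset M U ` adjoin M (carrier R) ?K y"
    then obtain v c where A: "A = U +>\<^bsub>M\<^esub> (v \<oplus>\<^bsub>M\<^esub> c \<odot>\<^bsub>M\<^esub> y)" "v \<in> ?K" "c \<in> carrier R"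
      by (auto elim!: adjoinE)
    show "A \<in> adjoin (quot_module M U) (carrier R) (a_r_coset M U ` ?K) (U +>\<^bsub>M\<^esub> y)"
      unfolding A(1) eq[OF A(2,3), symmetric] by (intro imageI adjoinI A)
  qed
  then show ?case using Cons by simp
qed

text \<open>Since \<open>U \<subseteq> K\<close>, the set \<open>K\<close> is a union of cosets of
  \<open>U\<close>; no membership is lost by passing to \<open>M / U\<close>.\<close>

lemma coset_mem_image_iff:
  assumes K: "submodule K R M" "U \<subseteq> K" and w: "w \<in> carrier M"
  shows "U +>\<^bsub>M\<^esub> w \<in> a_r_coset M U ` K \<longleftrightarrow> w \<in> K"
proof
  assume "U +>\<^bsub>M\<^esub> w \<in> a_r_coset M U ` K"
  then obtain k where k: "k \<in> K" "U +>\<^bsub>M\<^esub> w = U +>\<^bsub>M\<^esub> k" by blast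
  have kc: "k \<in> carrier M" using k submodule_subset[OF K(1)] by blast
  have "w \<ominus>\<^bsub>M\<^esub> k \<in> K" using coset_eq_iff[OF w kc] k K(2) by blast
  then have "(w \<ominus>\<^bsub>M\<^esub> k) \<oplus>\<^bsub>M\<^esub> k \<in> K" using submodule_add[OF K(1)] k by blast
  then show "w \<in> K" using w kc by (simp add: M.minus_eq M.a_assoc M.l_neg)
qed blast

text \<open>Generators of \<open>M / U\<close> are lifted to representatives, and generators of
  \<open>M\<close> modulo \<open>U\<close> are sent to their cosets; both span conditions agree by
  \<open>coset_mem_image_iff\<close>.\<close>

lemma locally_generated_quot_module:
  assumes "S \<subseteq> carrier R"
  shows "locally_generated R (quot_module M U) S (carrier (quot_module M U)) {\<zero>\<^bsub>quot_module M U\<^esub>} n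
    \<longleftrightarrow> locally_generated R M S (carrier M) U n"
proof -
  have key: "(\<forall>A\<in>carrier (quot_module M U). \<exists>t\<in>S. t \<odot>\<^bsub>quot_module M U\<^esub> A \<in>
          lin_combs (quot_module M U) (carrier R) {\<zero>\<^bsub>quot_module M U\<^esub>} (map (a_r_coset M U) ys)) \<longleftrightarrow>
      (\<forall>z\<in>carrier M. \<exists>t\<in>S. t \<odot>\<^bsub>M\<^esub> z \<in> lin_combs M (carrier R) U ys)" (is "?lhs \<longleftrightarrow> ?rhs")
    if ys: "set ys \<subseteq> carrier M" for ys
  proof -
    have *: "t \<odot>\<^bsub>quot_module M U\<^esub> (U +>\<^bsub>M\<^esub> z) \<in>
          lin_combs (quot_module M U) (carrier R) {\<zero>\<^bsub>quot_module M U\<^esub>} (map (a_r_coset M U) ys) \<longleftrightarrow>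
        t \<odot>\<^bsub>M\<^esub> z \<in> lin_combs M (carrier R) U ys" if "t \<in> S" "z \<in> carrier M" for t z
      using that assms coset_mem_image_iff[OF lin_combs_submodule[OF U ys] lin_combs_superset[OF submodule_subset[OF U] ys]]
      by (simp add: subsetD lin_combs_quot_module[OF ys] quot_module_smult)
    show ?thesis
    proof
      assume ?lhs
      then show ?rhs using * quot_module_coset by blast
    next
      assume rhs: ?rhs
      show ?lhs
      proof
        fix A assume "A \<in> carrier (quot_module M U)"
        then obtain z where z: "z \<in> carrier M" "A = U +>\<^bsub>M\<^esub> z" by (rule quot_module_cosetE)
        then obtain t where "t \<in> S" "t \<odot>\<^bsub>M\<^esub> z \<in> lin_combs M (carrier R) U ys" using rhs by blast
        then show "\<exists>t\<in>S. t \<odot>\<^bsub>quot_module M U\<^esub> A \<in>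
          lin_combs (quot_module M U) (carrier R) {\<zero>\<^bsub>quot_module M U\<^esub>} (map (a_r_coset M U) ys)"
          using * z by blast
      qed
    qed
  qed
  show ?thesis
  proof
    assume "locally_generated R (quot_module M U) S (carrier (quot_module M U)) {\<zero>\<^bsub>quot_module M U\<^esub>} n"
    then obtain Ys where Ys: "length Ys = n" "set Ys \<subseteq> carrier (quot_module M U)"
      "\<forall>A\<in>carrier (quot_module M U). \<exists>t\<in>S. t \<odot>\<^bsub>quot_module M U\<^esub> A \<in>
          lin_combs (quot_module M U) (carrier R) {\<zero>\<^bsub>quot_module M U\<^esub>} Ys"
      unfolding locally_generated_def by blast
    have "\<forall>A\<in>carrier (quot_module M U). \<exists>x. x \<in> carrier M \<and> A = U +>\<^bsub>M\<^esub> x"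
      using quot_module_cosetE by metis
    then obtain rep where rep: "\<And>A. A \<in> carrier (quot_module M U) \<Longrightarrow> rep A \<in> carrier M \<and> A = U +>\<^bsub>M\<^esub> rep A"
      by metis
    have ys: "set (map rep Ys) \<subseteq> carrier M" using rep Ys(2) by auto
    have "map (a_r_coset M U) (map rep Ys) = Ys"
      using rep Ys(2) by (auto simp: comp_def intro!: map_idI)
    then show "locally_generated R M S (carrier M) U n"
      using key[OF ys] ys Ys unfolding locally_generated_def by (intro exI[of _ "map rep Ys"]) simp
  next
    assume "locally_generated R M S (carrier M) U n"
    then obtain ys where ys: "length ys = n" "set ys \<subseteq> carrier M"
      "\<forall>z\<in>carrier M. \<exists>t\<in>S. t \<odot>\<^bsub>M\<^esub> z \<in> lin_combs M (carrier R) U ys"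
      unfolding locally_generated_def by blast
    then show "locally_generated R (quot_module M U) S (carrier (quot_module M U)) {\<zero>\<^bsub>quot_module M U\<^esub>} n"
      unfolding locally_generated_def using key[OF ys(2)] quot_module_coset
      by (intro exI[of _ "map (a_r_coset M U) ys"]) auto
  qed
qed

lemma mu_at_quot_module:
  assumes "primeideal \<pp> R"
  shows "mu_at R \<pp> (quot_module M U) = Inf {enat n |n. locally_generated R M (carrier R - \<pp>) (carrier M) U n}"
  using module.mu_at_eq[OF module_quot_module assms] locally_generated_quot_module[of "carrier R - \<pp>"]
  by simp

end

end

lemma adjoin_carrier_update [simp]: "adjoin (M\<lparr>carrier := W\<rparr>) C U y = adjoin M C U y"
  by (simp add: adjoin_def)

lemma lin_combs_carrier_update [simp]: "lin_combs (M\<lparr>carrier := W\<rparr>) C U ys = lin_combs M C U ys"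
  by (induction ys) simp_all

lemma locally_generated_carrier_update [simp]:
  "locally_generated R (M\<lparr>carrier := W\<rparr>) S V U n = locally_generated R M S V U n"
  by (simp add: locally_generated_def)

lemma (in module) mu_at_submodule:
  assumes W: "submodule W R M" and p: "primeideal \<pp> R"
  shows "mu_at R \<pp> (M\<lparr>carrier := W\<rparr>) =
    Inf {enat n |n. locally_generated R M (carrier R - \<pp>) W {\<zero>\<^bsub>M\<^esub>} n}"
  using module.mu_at_eq[OF submodule.submodule_is_module[OF W module_axioms] p] by simp

lemma (in module) mu_at_submodule_quot_module:
  assumes W: "submodule W R M" and U: "submodule U R M" "U \<subseteq> W" and p: "primeideal \<pp> R"
  shows "mu_at R \<pp> (quot_module (M\<lparr>carrier := W\<rparr>) U) =
    Inf {enat n |n. locally_generated R M (carrier R - \<pp>) W U n}"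
proof -
  interpret W: module R "M\<lparr>carrier := W\<rparr>" by (rule submodule.submodule_is_module[OF W module_axioms])
  have "module R ((M\<lparr>carrier := W\<rparr>)\<lparr>carrier := U\<rparr>)"
    using submodule.submodule_is_module[OF U(1) module_axioms] by simp
  then have "submodule U R (M\<lparr>carrier := W\<rparr>)"
    using U(2) by (intro W.module_incl_imp_submodule) simp_all
  then show ?thesis using W.mu_at_quot_module[OF _ p] by simp
qed

section \<open>General elements\<close>

text \<open>Passes from regular denominators to the complement of a minimal prime.\<close>

lemma locally_generated_mono_denominators:
  assumes "locally_generated R M S W U n" "S \<subseteq> S'"
  shows "locally_generated R M S' W U n"
  using assms unfolding locally_generated_def by blast

lemma (in module) fam_span_cong:
  assumes "finite J" "a \<in> J \<rightarrow> carrier M" "\<And>j. j \<in> J \<Longrightarrow> b j = a j"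
  shows "fam_span R M b J = fam_span R M a J"
  using assms
proof (induction J)
  case (insert k J)
  then have "b \<in> insert k J \<rightarrow> carrier M" by fastforce
  then show ?case using insert by (simp add: fam_span_insert)
qed (simp add: fam_span_empty)

context module
begin

lemma fam_span_subset:
  assumes W: "submodule W R M" and "finite J" "a \<in> J \<rightarrow> W"
  shows "fam_span R M a J \<subseteq> W"
  using assms(2,3)
proof (induction J)
  case empty
  then show ?case using submodule_zero[OF W] by (simp add: fam_span_empty)
next
  case (insert k J)
  then have "a \<in> insert k J \<rightarrow> carrier M" using submodule_subset[OF W] by blast
  then show ?case using insert by (simp add: fam_span_insert adjoin_least[OF W])
qed

lemma fin_gen_lin_combs:
  assumes "fin_gen R M"
  obtains xs where "set xs \<subseteq> carrier M" "lin_combs M (carrier R) {\<zero>\<^bsub>M\<^esub>} xs = carrier M"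
proof -
  obtain x and n :: nat where x: "x \<in> {..<n} \<rightarrow> carrier M" "fam_span R M x {..<n} = carrier M"
    using assms unfolding fin_gen_def generated_by_def by blast
  have "set (map x (rev [0..<n])) \<subseteq> carrier M" using x(1) by auto
  then show thesis using that x(2) unfolding fam_span_lessThan[OF x(1)] by blast
qed

text \<open>The product of denominators for finitely many generators of \<open>M\<close> serves for
  all elements. It turns generation at a prime into a colon ideal not contained in the
  prime.\<close>

lemma colon_meets_submonoid:
  assumes fg: "fin_gen R M" and S: "submonoid S R" and K: "submodule K R M"
    and loc: "\<forall>z\<in>carrier M. \<exists>t\<in>S. t \<odot>\<^bsub>M\<^esub> z \<in> K"
  shows "\<exists>t\<in>S. t \<in> colon R M K"
proof -
  note Sc = submonoid.subset[OF S, THEN subsetD]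
  obtain xs where xs: "set xs \<subseteq> carrier M" "lin_combs M (carrier R) {\<zero>\<^bsub>M\<^esub>} xs = carrier M"
    using fin_gen_lin_combs[OF fg] .
  have "\<exists>t\<in>S. \<forall>x\<in>set xs. t \<odot>\<^bsub>M\<^esub> x \<in> K"
    using xs(1)
  proof (induction xs)
    case Nil
    then show ?case using submonoid.one_closed[OF S] by auto
  next
    case (Cons x xs)
    then obtain t where t: "t \<in> S" "\<forall>x\<in>set xs. t \<odot>\<^bsub>M\<^esub> x \<in> K" by auto
    obtain u where u: "u \<in> S" "u \<odot>\<^bsub>M\<^esub> x \<in> K" using loc Cons.prems by auto
    have "(t \<otimes> u) \<odot>\<^bsub>M\<^esub> x \<in> K"
      using submodule_smult[OF K Sc[OF t(1)] u(2)] Cons.prems Sc t(1) u(1) by (simp add: smult_assoc1)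
    moreover have "(t \<otimes> u) \<odot>\<^bsub>M\<^esub> y \<in> K" if "y \<in> set xs" for y
    proof -
      have "(t \<otimes> u) \<odot>\<^bsub>M\<^esub> y = u \<odot>\<^bsub>M\<^esub> (t \<odot>\<^bsub>M\<^esub> y)"
        using that Cons.prems Sc t(1) u(1) by (subst R.m_comm) (auto simp: smult_assoc1)
      then show ?thesis using submodule_smult[OF K Sc[OF u(1)]] t(2) that by simp
    qed
    ultimately show ?case using submonoid.m_closed[OF S t(1) u(1)] by auto
  qed
  then obtain t where t: "t \<in> S" "\<forall>x\<in>set xs. t \<odot>\<^bsub>M\<^esub> x \<in> K" by blast
  have tc: "t \<in> carrier R" using Sc t(1) by blast
  \<comment> \<open>The elements that \<open>t\<close> carries into \<open>K\<close> form a
    submodule; it contains the generators, hence all of \<open>M\<close>.\<close>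
  define V where "V = {z \<in> carrier M. t \<odot>\<^bsub>M\<^esub> z \<in> K}"
  have V: "submodule V R M"
  proof (rule submoduleI)
    show "\<zero>\<^bsub>M\<^esub> \<in> V" using tc submodule_zero[OF K] by (simp add: V_def)
    show "\<ominus>\<^bsub>M\<^esub> x \<in> V" if "x \<in> V" for x
      using that tc submodule_neg[OF K] by (simp add: V_def smult_r_minus)
    show "x \<oplus>\<^bsub>M\<^esub> y \<in> V" if "x \<in> V" "y \<in> V" for x y
      using that tc submodule_add[OF K] by (simp add: V_def smult_r_distr)
    show "r \<odot>\<^bsub>M\<^esub> x \<in> V" if "r \<in> carrier R" "x \<in> V" for r x
    proof -
      have "t \<odot>\<^bsub>M\<^esub> (r \<odot>\<^bsub>M\<^esub> x) = r \<odot>\<^bsub>M\<^esub> (t \<odot>\<^bsub>M\<^esub> x)"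
        using that tc by (simp add: V_def smult_assoc1[symmetric] R.m_comm)
      then show ?thesis using that submodule_smult[OF K] by (simp add: V_def)
    qed
  qed (simp add: V_def)
  have "{\<zero>\<^bsub>M\<^esub>} \<subseteq> V" using submodule_zero[OF V] by simp
  moreover have "set xs \<subseteq> V" using xs(1) t(2) by (auto simp: V_def)
  ultimately have "carrier M \<subseteq> V" using lin_combs_least[OF V, of "{\<zero>\<^bsub>M\<^esub>}" xs] xs(2) by simp
  then show ?thesis using t(1) tc by (auto simp: colon_def V_def)
qed

definition generation_locus :: "'c set \<Rightarrow> nat \<Rightarrow> 'a set" where
  "generation_locus U k =
     {t \<in> carrier R. \<exists>ys. length ys = k \<and> set ys \<subseteq> carrier M \<and>
        t \<in> colon R M (lin_combs M (carrier R) U ys)}"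

text \<open>The ideal generated by \<open>generation_locus U k\<close> plays the role of the Fitting ideal of index
  \<open>k\<close> of \<open>M / U\<close>: it has the same radical.\<close>

lemma locally_generated_iff_generation_locus:
  assumes fg: "fin_gen R M" and U: "submodule U R M" and p: "primeideal \<pp> R"
  shows "locally_generated R M (carrier R - \<pp>) (carrier M) U k \<longleftrightarrow> \<not> generation_locus U k \<subseteq> \<pp>"
proof
  assume "locally_generated R M (carrier R - \<pp>) (carrier M) U k"
  then obtain ys where ys: "length ys = k" "set ys \<subseteq> carrier M"
    "\<forall>z\<in>carrier M. \<exists>t\<in>carrier R - \<pp>. t \<odot>\<^bsub>M\<^esub> z \<in> lin_combs M (carrier R) U ys"
    unfolding locally_generated_def by blast
  obtain t where "t \<in> carrier R - \<pp>" "t \<in> colon R M (lin_combs M (carrier R) U ys)"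
    using colon_meets_submonoid[OF fg primeideal_complement_submonoid[OF p]
        lin_combs_submodule[OF U ys(2)] ys(3)] by blast
  then show "\<not> generation_locus U k \<subseteq> \<pp>" using ys by (auto simp: generation_locus_def)
next
  assume "\<not> generation_locus U k \<subseteq> \<pp>"
  then obtain t ys where t: "t \<in> carrier R - \<pp>" "length ys = k" "set ys \<subseteq> carrier M"
    "t \<in> colon R M (lin_combs M (carrier R) U ys)"
    by (auto simp: generation_locus_def)
  then have "\<forall>z\<in>carrier M. \<exists>t\<in>carrier R - \<pp>. t \<odot>\<^bsub>M\<^esub> z \<in> lin_combs M (carrier R) U ys"
    by (auto simp: colon_def)
  then show "locally_generated R M (carrier R - \<pp>) (carrier M) U k"
    unfolding locally_generated_def using t(2,3) by blast
qed

text \<open>An exceptional prime of height \<open>d\<close> is minimal over \<open>generation_locus U (d + e - i - 1)\<close>,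
  because every smaller prime has smaller height.\<close>

lemma finite_exceptional_primes:
  assumes R: "noetherian_cring R" and fg: "fin_gen R M" and U: "submodule U R M"
    and gen: "\<And>\<qq> d. primeideal \<qq> R \<Longrightarrow> prime_height R \<qq> = enat d \<Longrightarrow> d < s \<Longrightarrow>
      locally_generated R M (carrier R - \<qq>) (carrier M) U (d + e - i)"
  shows "finite {\<qq>. primeideal \<qq> R \<and> (\<exists>d<s. prime_height R \<qq> = enat d \<and>
      \<not> locally_generated R M (carrier R - \<qq>) (carrier M) U (d + e - Suc i))}"
proof -
  define mins where "mins k = {\<qq>. primeideal \<qq> R \<and> generation_locus U k \<subseteq> \<qq> \<and>
      (\<forall>\<pp>. primeideal \<pp> R \<and> generation_locus U k \<subseteq> \<pp> \<longrightarrow> \<not> \<pp> \<subset> \<qq>)}" for k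
  have "finite (mins k)" for k
    unfolding mins_def
    by (rule noetherian_cring.finite_minimal_primes[OF R]) (auto simp: generation_locus_def)
  \<comment> \<open>From \<open>d < s\<close> the index \<open>d + e - Suc i\<close> is below
    \<open>s + e\<close>, whatever the truncation.\<close>
  then have fin: "finite (\<Union>k<s + e. mins k)" by simp
  have "\<qq> \<in> (\<Union>k<s + e. mins k)"
    if q: "primeideal \<qq> R" "d < s" "prime_height R \<qq> = enat d"
      and ex: "\<not> locally_generated R M (carrier R - \<qq>) (carrier M) U (d + e - Suc i)" for \<qq> d
  proof -
    define k where "k = d + e - Suc i"
    have "generation_locus U k \<subseteq> \<qq>"
      using ex locally_generated_iff_generation_locus[OF fg U q(1)] by (simp add: k_def)
    moreover have "\<not> generation_locus U k \<subseteq> \<pp>" if p: "primeideal \<pp> R" "\<pp> \<subset> \<qq>" for \<pp>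
    proof -
      obtain d' where d': "d' < d" "prime_height R \<pp> = enat d'"
        using prime_height_strict[OF p(1) q(1) p(2) q(3)] by blast
      \<comment> \<open>Since \<open>d' < d\<close>, the bound assumed at the smaller prime is
        already at most \<open>k = d + e - Suc i\<close>.\<close>
      have "locally_generated R M (carrier R - \<pp>) (carrier M) U (d' + e - i)"
        using gen[OF p(1) d'(2)] d'(1) q(2) by simp
      then have "locally_generated R M (carrier R - \<pp>) (carrier M) U k"
        by (rule locally_generated_mono)
          (use d'(1) submodule_subset[OF U] carrier_is_submodule in \<open>auto simp: k_def\<close>)
      then show ?thesis using locally_generated_iff_generation_locus[OF fg U p(1)] by blast
    qed
    ultimately have "\<qq> \<in> mins k" using q(1) by (auto simp: mins_def)
    then show ?thesis using q(2) by (intro UN_I[of k]) (auto simp: k_def)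
  qed
  then show ?thesis by (intro finite_subset[OF _ fin] subsetI) blast
qed

text \<open>The elements of the family are returned to the list of generators one at a time. For
  \<open>{1..s}\<close> this gives the lower bound for the number of generators of the quotient in
  (1).\<close>

lemma locally_generated_fam_spanD:
  assumes W: "submodule W R M" and "finite J" "a \<in> J \<rightarrow> W"
    and "locally_generated R M S W (fam_span R M a J) n"
  shows "locally_generated R M S W {\<zero>\<^bsub>M\<^esub>} (n + card J)"
  using assms(2-4)
proof (induction J arbitrary: n)
  case empty
  then show ?case by (simp add: fam_span_empty)
next
  case (insert k J)
  have a: "a \<in> insert k J \<rightarrow> carrier M" using insert.prems submodule_subset[OF W] by blast
  have "fam_span R M a J \<subseteq> carrier M"
    using fam_span_submodule[OF insert.hyps(1), THEN submodule_subset] a by simp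
  then have "locally_generated R M S W (fam_span R M a J) (Suc n)"
    using locally_generated_adjoinD[OF _ _ W, of S "fam_span R M a J" "a k" n] insert a
    by (simp add: fam_span_insert)
  then show ?case using insert.IH[of "Suc n"] insert.prems(1) insert.hyps by simp
qed

end

lemma Inf_enat_le_iff: "Inf {enat n |n. g n} \<le> enat m \<longleftrightarrow> (\<exists>n\<le>m. g n)"
proof
  assume *: "Inf {enat n |n. g n} \<le> enat m"
  show "\<exists>n\<le>m. g n"
  proof (rule ccontr)
    assume "\<not> ?thesis"
    then have "enat (Suc m) \<le> Inf {enat n |n. g n}"
      by (intro Inf_greatest) (auto simp: not_le Suc_le_eq)
    then have "enat (Suc m) \<le> enat m" using * by (rule order_trans)
    then show False by simp
  qed
next
  assume "\<exists>n\<le>m. g n"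
  then obtain n where "n \<le> m" "g n" by blast
  then show "Inf {enat n |n. g n} \<le> enat m" by (intro Inf_lower2[of "enat n"]) auto
qed

text \<open>For the least values \<open>m\<close> and \<open>m'\<close> the assumptions give
  \<open>m' \<le> m - s\<close> and \<open>m \<le> m' + s\<close>. If no finite value exists for one
  predicate, none exists for the other, and both sides are infinite.\<close>

lemma Inf_enat_shift:
  assumes "\<And>n. g n \<Longrightarrow> g' (n - s)" "\<And>n. g' n \<Longrightarrow> g (n + s)"
  shows "Inf {enat n |n. g' n} = max 0 (Inf {enat n |n. g n} - enat s)"
proof (cases "\<exists>n. g n")
  case False
  then have "\<not> g' n" for n using assms(2) by blast
  then show ?thesis using False by (simp add: top_enat_def)
next
  case True
  have least: "Inf {enat n |n. f n} = enat (LEAST n. f n)" if "\<exists>n. f n" for f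
  proof (rule antisym)
    show "Inf {enat n |n. f n} \<le> enat (LEAST n. f n)"
      using LeastI_ex[OF that] by (auto simp: Inf_enat_le_iff)
    show "enat (LEAST n. f n) \<le> Inf {enat n |n. f n}" by (auto intro!: Inf_greatest Least_le)
  qed
  have True': "\<exists>n. g' n" using True assms(1) by blast
  define m m' where "m = (LEAST n. g n)" and "m' = (LEAST n. g' n)"
  have "m' \<le> m - s" unfolding m_def m'_def using assms(1)[OF LeastI_ex[OF True]] by (rule Least_le)
  moreover have "m \<le> m' + s" unfolding m_def m'_def using assms(2)[OF LeastI_ex[OF True']] by (rule Least_le)
  ultimately have "m' = m - s" by simp
  then show ?thesis unfolding least[OF True] least[OF True'] m_def[symmetric] m'_def[symmetric] by simp
qed

lemma nonminimal_prime:
  assumes "prime_height R \<pp> = enat d" "d > 0"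
  shows "\<exists>\<qq>. primeideal \<qq> R \<and> \<qq> \<subset> \<pp>"
proof (rule ccontr)
  assume *: "\<not> ?thesis"
  have "prime_height R \<pp> \<le> enat 0"
    unfolding prime_height_def
  proof (rule Sup_least)
    fix x assume "x \<in> {enat n |n. \<exists>c. prime_chain R n c \<and> c n = \<pp>}"
    then obtain n c where x: "x = enat n" "prime_chain R n c" "c n = \<pp>" by blast
    have "n = 0"
    proof (cases n)
      case (Suc m)
      then have "primeideal (c m) R" "c m \<subset> \<pp>" using x by (auto simp: prime_chain_def)
      then show ?thesis using * by blast
    qed
    then show "x \<le> enat 0" using x by simp
  qed
  then show False using assms by simp
qed

text \<open>A prime of height 0 contains no regular element, so the generators from the rank survive
  with its denominators. At positive height there is a smaller prime, so the local dimension is at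
  least 1 and \<open>G_s\<close> applies.\<close>

lemma (in module) rank_G_generators:
  assumes R: "noetherian_cring R" and rank: "has_rank R M e" and G: "satisfies_G R M e s"
    and q: "primeideal \<qq> R" "prime_height R \<qq> = enat d" "d < s"
  shows "locally_generated R M (carrier R - \<qq>) (carrier M) {\<zero>\<^bsub>M\<^esub>} (d + e)"
proof (cases "d = 0")
  case True
  have "\<not> \<pp> \<subset> \<qq>" if "primeideal \<pp> R" for \<pp>
    using prime_height_strict[OF that q(1) _ q(2)] True by auto
  then have "regular_elements R \<subseteq> carrier R - \<qq>"
    using noetherian_cring.minimal_prime_not_regular[OF R q(1)] by blast
  then show ?thesis
    using locally_generated_mono_denominators[OF has_rank_generators[OF rank]] True by simp
next
  case False
  then obtain \<pp> where p: "primeideal \<pp> R" "\<pp> \<subset> \<qq>" using nonminimal_prime[OF q(2)] by auto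
  have ge: "1 \<le> krull_dim (ring_at R \<qq>)" by (rule R.krull_dim_ring_at_ge_1[OF q(1) p])
  have "krull_dim (ring_at R \<qq>) \<le> enat d" using R.krull_dim_ring_at_le[OF q(1)] q(2) by simp
  then obtain k where k: "krull_dim (ring_at R \<qq>) = enat k" "k \<le> d"
    by (cases "krull_dim (ring_at R \<qq>)") auto
  have "krull_dim (ring_at R \<qq>) \<le> enat s - 1" using k q(3) by (simp add: one_enat_def)
  then have "mu_at R \<qq> M \<le> krull_dim (ring_at R \<qq>) + enat e - 1"
    using G q(1) ge unfolding satisfies_G_def by blast
  \<comment> \<open>\<open>G_s\<close> yields \<open>k + e - 1\<close> with
    \<open>k \<le> d\<close>. The form \<open>d + e\<close> is taken to have one formula for all
    heights, including 0.\<close>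
  also have "\<dots> \<le> enat (d + e)" using k by (simp add: one_enat_def)
  finally obtain n where "n \<le> d + e"
    "locally_generated R M (carrier R - \<qq>) (carrier M) {\<zero>\<^bsub>M\<^esub>} n"
    unfolding mu_at_eq[OF q(1)] Inf_enat_le_iff by blast
  then show ?thesis using locally_generated_mono[OF _ _ carrier_is_submodule] by simp
qed

text \<open>All subsets of \<open>{1..k}\<close> are carried along because the next element must
  serve each of them at once. The clause for \<open>P\<close> concerns only the full set and is
  stated for every \<open>n\<close>, so no minimal number has to be named.\<close>

lemma (in module) general_elements:
  assumes R: "noetherian_cring R" and fg: "fin_gen R M" and W: "submodule W R M"
    and C: "infinite C" "C \<subseteq> carrier R" "\<And>c d. c \<in> C \<Longrightarrow> d \<in> C \<Longrightarrow> c \<noteq> d \<Longrightarrow> c \<ominus> d \<in> Units R"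
    and P: "finite P" "\<forall>\<pp>\<in>P. primeideal \<pp> R"
    and colon: "\<And>\<qq> d. primeideal \<qq> R \<Longrightarrow> prime_height R \<qq> = enat d \<Longrightarrow> d < s \<Longrightarrow>
      \<not> colon R M W \<subseteq> \<qq>"
    and gen: "\<And>\<qq> d. primeideal \<qq> R \<Longrightarrow> prime_height R \<qq> = enat d \<Longrightarrow> d < s \<Longrightarrow>
      locally_generated R M (carrier R - \<qq>) (carrier M) {\<zero>\<^bsub>M\<^esub>} (d + e)"
  shows "\<exists>a. (\<forall>j\<in>{1..k}. a j \<in> W) \<and>
    (\<forall>V \<qq> d. V \<subseteq> {1..k} \<longrightarrow> primeideal \<qq> R \<longrightarrow> prime_height R \<qq> = enat d \<longrightarrow> d < s \<longrightarrow>
      locally_generated R M (carrier R - \<qq>) (carrier M) (fam_span R M a V) (d + e - card V)) \<and>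
    (\<forall>\<pp>\<in>P. \<forall>n. locally_generated R M (carrier R - \<pp>) W {\<zero>\<^bsub>M\<^esub>} n \<longrightarrow>
      locally_generated R M (carrier R - \<pp>) W (fam_span R M a {1..k}) (n - k))"
proof (induction k)
  case 0
  then show ?case using gen by (simp add: fam_span_empty)
next
  case (Suc k)
  then obtain a where aW: "\<And>j. j \<in> {1..k} \<Longrightarrow> a j \<in> W"
    and aV: "\<And>V \<qq> d. V \<subseteq> {1..k} \<Longrightarrow> primeideal \<qq> R \<Longrightarrow> prime_height R \<qq> = enat d \<Longrightarrow> d < s \<Longrightarrow>
      locally_generated R M (carrier R - \<qq>) (carrier M) (fam_span R M a V) (d + e - card V)"
    and aP: "\<And>\<pp> n. \<pp> \<in> P \<Longrightarrow> locally_generated R M (carrier R - \<pp>) W {\<zero>\<^bsub>M\<^esub>} n \<Longrightarrow>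
      locally_generated R M (carrier R - \<pp>) W (fam_span R M a {1..k}) (n - k)"
    by metis
  have fin: "finite V" if "V \<subseteq> {1..k}" for V using that finite_subset by blast
  have aM: "a \<in> V \<rightarrow> carrier M" if "V \<subseteq> {1..k}" for V
    using that aW submodule_subset[OF W] by blast
  have sub: "submodule (fam_span R M a V) R M" if "V \<subseteq> {1..k}" for V
    using fam_span_submodule[OF fin[OF that] aM[OF that]] .
  \<comment> \<open>The primes where the bound demanded of \<open>V\<close> with one more index does
    not already hold for \<open>V\<close>; only there does the new element have to do
    something.\<close>
  define exc where "exc V = {\<qq>. primeideal \<qq> R \<and> (\<exists>d<s. prime_height R \<qq> = enat d \<and>
      \<not> locally_generated R M (carrier R - \<qq>) (carrier M) (fam_span R M a V) (d + e - Suc (card V)))}" for V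
  \<comment> \<open>All conditions on the new element: every earlier subset with its exceptional
    primes, and the full earlier set with the primes of \<open>P\<close>.\<close>
  define I where "I = Sigma (Pow {1..k}) exc \<union> {{1..k}} \<times> P"
  have "finite (exc V)" if "V \<subseteq> {1..k}" for V
    unfolding exc_def by (rule finite_exceptional_primes[OF R fg sub[OF that] aV[OF that]])
  then have finI: "finite I" using P(1) by (auto simp: I_def)
  define good where "good N V \<qq> \<longleftrightarrow> N \<subset> W \<and> smult_add_closed N \<and> (\<forall>w\<in>W - N. \<forall>n.
      locally_generated R M (carrier R - \<qq>) W (fam_span R M a V) n \<longrightarrow>
      locally_generated R M (carrier R - \<qq>) W (adjoin M (carrier R) (fam_span R M a V) w) (n - 1))"
    for N V \<qq>
  have "\<forall>x\<in>I. \<exists>N. good N (fst x) (snd x)"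
  proof
    fix x assume "x \<in> I"
    then have "primeideal (snd x) R" "fst x \<subseteq> {1..k}" using P(2) by (auto simp: I_def exc_def)
    then show "\<exists>N. good N (fst x) (snd x)"
      unfolding good_def by (intro basic_element_condition[OF _ W sub])
  qed
  from bchoice[OF this] obtain N where good: "\<forall>x\<in>I. good (N x) (fst x) (snd x)" ..
  have N: "N x \<subset> W \<and> smult_add_closed (N x)" if "x \<in> I" for x
    using good that unfolding good_def by blast
  have N_gen: "locally_generated R M (carrier R - \<qq>) W (adjoin M (carrier R) (fam_span R M a V) w) (n - 1)"
    if "(V, \<qq>) \<in> I" "w \<in> W - N (V, \<qq>)"
      "locally_generated R M (carrier R - \<qq>) W (fam_span R M a V) n" for V \<qq> w n
    using bspec[OF good that(1)] that(2,3) unfolding good_def fst_conv snd_conv by blast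
  obtain w where w: "w \<in> W" "w \<notin> \<Union>(N ` I)"
    using avoid_finite_union[OF W C, of "N ` I"] finI N by auto
  have wM: "w \<in> carrier M" using w(1) submodule_subset[OF W] by blast
  define b where "b = a(Suc k := w)"
  have b_old: "fam_span R M b V = fam_span R M a V" if "V \<subseteq> {1..k}" for V
    using that by (intro fam_span_cong fin aM) (auto simp: b_def)
  have b_new: "fam_span R M b (insert (Suc k) V) = adjoin M (carrier R) (fam_span R M a V) w"
    if "V \<subseteq> {1..k}" for V
  proof -
    have "Suc k \<notin> V" using that by auto
    moreover have "b \<in> insert (Suc k) V \<rightarrow> carrier M" using aM[OF that] wM by (auto simp: b_def)
    ultimately show ?thesis
      using fam_span_insert[OF fin[OF that]] b_old[OF that] by (simp add: b_def)
  qed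
  show ?case
  proof (intro exI[of _ b] conjI allI impI ballI)
    show "b j \<in> W" if "j \<in> {1..Suc k}" for j
      using that aW w(1) by (auto simp: b_def le_Suc_eq)
  next
    fix V \<qq> d
    assume V: "V \<subseteq> {1..Suc k}" and q: "primeideal \<qq> R" "prime_height R \<qq> = enat d" "d < s"
    show "locally_generated R M (carrier R - \<qq>) (carrier M) (fam_span R M b V) (d + e - card V)"
    proof (cases "Suc k \<in> V")
      case False
      then have "V \<subseteq> {1..k}" using V by (fastforce simp: le_Suc_eq)
      then show ?thesis using aV[OF _ q] b_old by simp
    next
      case True
      define V' where "V' = V - {Suc k}"
      have V': "V' \<subseteq> {1..k}" "V = insert (Suc k) V'" using V True by (auto simp: V'_def le_Suc_eq)
      have card: "card V = Suc (card V')" using V' fin by (subst V'(2), subst card_insert_disjoint) auto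
      show ?thesis
      proof (cases "\<qq> \<in> exc V'")
        case False
        \<comment> \<open>At an unexceptional prime the lowered bound holds before \<open>w\<close>
          is adjoined, and enlarging the submodule preserves it.\<close>
        then have "locally_generated R M (carrier R - \<qq>) (carrier M) (fam_span R M a V') (d + e - card V)"
          using q card by (auto simp: exc_def)
        then show ?thesis
          unfolding V'(2) b_new[OF V'(1)] using wM submodule_subset[OF sub[OF V'(1)]]
          by (metis V'(2) locally_generated_mono_submodule adjoin_superset)
      next
        case True
        then have I: "(V', \<qq>) \<in> I" using V' by (auto simp: I_def)
        \<comment> \<open>The choice of \<open>w\<close> lowers generator numbers of
          \<open>W\<close>, while the invariant is about \<open>M\<close>. As the height of
          \<open>\<qq>\<close> is below \<open>s\<close>, some \<open>t\<close> outside
          \<open>\<qq>\<close> carries \<open>M\<close> into \<open>W\<close>, and the two numbers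
          can be interchanged.\<close>
        obtain t where t: "t \<in> carrier R - \<qq>" "t \<in> colon R M W"
          using colon[OF q] by (auto simp: colon_def)
        have restrict: "locally_generated R M (carrier R - \<qq>) W U n \<longleftrightarrow>
            locally_generated R M (carrier R - \<qq>) (carrier M) U n" if "submodule U R M" for U n
          by (rule locally_generated_restrict[OF primeideal_complement_submonoid[OF q(1)] W that t])
        have "locally_generated R M (carrier R - \<qq>) W (fam_span R M a V') (d + e - card V')"
          unfolding restrict[OF sub[OF V'(1)]] by (rule aV[OF V'(1) q])
        then have "locally_generated R M (carrier R - \<qq>) W
            (adjoin M (carrier R) (fam_span R M a V') w) (d + e - card V' - 1)"
          using N_gen[OF I] w I by blast
        then show ?thesis
          unfolding restrict[OF adjoin_submodule[OF sub[OF V'(1)] wM]]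
          using card b_new[OF V'(1)] V'(2) by simp
      qed
    qed
  next
    fix \<pp> n
    assume p: "\<pp> \<in> P" and n: "locally_generated R M (carrier R - \<pp>) W {\<zero>\<^bsub>M\<^esub>} n"
    have "({1..k}, \<pp>) \<in> I" using p by (simp add: I_def)
    then have "locally_generated R M (carrier R - \<pp>) W
        (adjoin M (carrier R) (fam_span R M a {1..k}) w) (n - k - 1)"
      using N_gen[OF _ _ aP[OF p n]] w by blast
    then show "locally_generated R M (carrier R - \<pp>) W (fam_span R M b {1..Suc k}) (n - Suc k)"
      using b_new[of "{1..k}"] by (simp add: atLeastAtMostSuc_conv)
  qed
qed

theorem theorem2p2:
  fixes R :: "('a, 'r) ring_scheme"
    and E :: "('a, 'b, 'm) module_scheme"
    and \<mm> :: "'a set"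
    and P :: "'a set set"
    and W :: "'b set"
    and e s :: nat
  assumes "local_ring R"
    and "noetherian_ring R"
    and "maximalideal \<mm> R"
    and "infinite (carrier (R Quot \<mm>))"
    and "finite P"
    and "\<forall>\<pp>\<in>P. primeideal \<pp> R"
    and "module R E"
    and "fin_gen R E"
    and "has_rank R E e"
    and "e > 0"
    and "s \<ge> 1"
    and "submodule W R E"
    and "height R (colon R E W) \<ge> enat s"
    and "satisfies_G R E e s"
  shows "\<exists>a :: nat \<Rightarrow> 'b. (\<forall>j\<in>{1..s}. a j \<in> W) \<and>
    (\<forall>i\<le>s. \<forall>V. V \<subseteq> {1..s} \<and> card V = i \<longrightarrow>
      (\<forall>\<pp>\<in>P. mu_at R \<pp> (quot_module (E\<lparr>carrier := W\<rparr>) (fam_span R E a {1..s}))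
              = max 0 (mu_at R \<pp> (E\<lparr>carrier := W\<rparr>) - enat s)) \<and>
      height R (colon R E (fam_span R E a V)) \<ge> enat (i + 1 - e))"
proof -
  interpret E: module R E by fact
  have R: "noetherian_cring R"
    by (intro noetherian_cring.intro assms(2) E.R.is_cring)
  note W = \<open>submodule W R E\<close>
  obtain C where C: "infinite C" "C \<subseteq> carrier R"
    "\<And>c d. c \<in> C \<Longrightarrow> d \<in> C \<Longrightarrow> c \<noteq> d \<Longrightarrow> c \<ominus>\<^bsub>R\<^esub> d \<in> Units R"
    using noetherian_cring.infinite_residue_field_units[OF R assms(1,3,4)] by blast
  have colon: "\<not> colon R E W \<subseteq> \<qq>" if "primeideal \<qq> R" "prime_height R \<qq> = enat d" "d < s" for \<qq> d
    using heightD[OF assms(13) that(1)] that(2,3) by simp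
  note gen = E.rank_G_generators[OF R assms(9,14)]
  have "\<exists>a. (\<forall>j\<in>{1..s}. a j \<in> W) \<and>
    (\<forall>V \<qq> d. V \<subseteq> {1..s} \<longrightarrow> primeideal \<qq> R \<longrightarrow> prime_height R \<qq> = enat d \<longrightarrow> d < s \<longrightarrow>
      locally_generated R E (carrier R - \<qq>) (carrier E) (fam_span R E a V) (d + e - card V)) \<and>
    (\<forall>\<pp>\<in>P. \<forall>n. locally_generated R E (carrier R - \<pp>) W {\<zero>\<^bsub>E\<^esub>} n \<longrightarrow>
      locally_generated R E (carrier R - \<pp>) W (fam_span R E a {1..s}) (n - s))"
    by (rule E.general_elements[OF R assms(8) W C(1,2) _ assms(5,6)]) (fact C(3), fact colon, fact gen)
  then obtain a where a: "\<forall>j\<in>{1..s}. a j \<in> W"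
    "\<forall>V \<qq> d. V \<subseteq> {1..s} \<longrightarrow> primeideal \<qq> R \<longrightarrow> prime_height R \<qq> = enat d \<longrightarrow> d < s \<longrightarrow>
      locally_generated R E (carrier R - \<qq>) (carrier E) (fam_span R E a V) (d + e - card V)"
    "\<forall>\<pp>\<in>P. \<forall>n. locally_generated R E (carrier R - \<pp>) W {\<zero>\<^bsub>E\<^esub>} n \<longrightarrow>
      locally_generated R E (carrier R - \<pp>) W (fam_span R E a {1..s}) (n - s)"
    by (elim exE conjE)
  have aVW: "a \<in> V \<rightarrow> W" if "V \<subseteq> {1..s}" for V using a(1) that by blast
  have fin: "finite V" if "V \<subseteq> {1..s}" for V using that finite_subset by blast
  have sub: "submodule (fam_span R E a V) R E" if "V \<subseteq> {1..s}" for V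
    using E.fam_span_submodule[OF fin[OF that]] aVW[OF that] E.submodule_subset[OF W] by blast
  have mu: "mu_at R \<pp> (quot_module (E\<lparr>carrier := W\<rparr>) (fam_span R E a {1..s})) =
      max 0 (mu_at R \<pp> (E\<lparr>carrier := W\<rparr>) - enat s)" if p: "\<pp> \<in> P" for \<pp>
  proof -
    have "primeideal \<pp> R" using p assms(6) by blast
    \<comment> \<open>One inequality is the last clause on \<open>a\<close>, the other undoes the
      \<open>s\<close> adjunctions.\<close>
    then show ?thesis
      unfolding E.mu_at_submodule_quot_module[OF W sub[OF order_refl] E.fam_span_subset[OF W fin[OF order_refl] aVW[OF order_refl]] \<open>primeideal \<pp> R\<close>]
        E.mu_at_submodule[OF W \<open>primeideal \<pp> R\<close>]
      using a(3) p E.locally_generated_fam_spanD[OF W fin[OF order_refl] aVW[OF order_refl], of "carrier R - \<pp>"]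
      by (intro Inf_enat_shift) auto
  qed
  have ht: "enat (card V + 1 - e) \<le> height R (colon R E (fam_span R E a V))" if V: "V \<subseteq> {1..s}" for V
  proof (rule heightI, rule ccontr)
    fix \<qq> assume q: "primeideal \<qq> R" "colon R E (fam_span R E a V) \<subseteq> \<qq>"
    assume "\<not> enat (card V + 1 - e) \<le> prime_height R \<qq>"
    then obtain d where d: "prime_height R \<qq> = enat d" "d < card V + 1 - e"
      by (cases "prime_height R \<qq>") auto
    have "card V \<le> s" using card_mono[OF _ V] by simp
    \<comment> \<open>From \<open>d < card V + 1 - e\<close>, \<open>e > 0\<close> and
      \<open>card V \<le> s\<close>; the invariant is available only at heights below
      \<open>s\<close>.\<close>
    then have "d < s" using d(2) assms(10) by linarith
    \<comment> \<open>Here \<open>d + e \<le> card V\<close>, so the bound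
      \<open>d + e - card V\<close> is 0: at \<open>\<qq>\<close> the chosen elements generate
      \<open>E\<close>, and the colon ideal cannot lie in \<open>\<qq>\<close>.\<close>
    have "locally_generated R E (carrier R - \<qq>) (carrier E) (fam_span R E a V) 0"
      using a(2)[rule_format, OF V q(1) d(1) \<open>d < s\<close>] d(2) by simp
    then obtain t where "t \<in> carrier R - \<qq>" "t \<in> colon R E (fam_span R E a V)"
      using E.colon_meets_submonoid[OF assms(8) primeideal_complement_submonoid[OF q(1)] sub[OF V]]
      unfolding E.locally_generated_0 by blast
    then show False using q(2) by blast
  qed
  show ?thesis using a(1) mu ht by (intro exI[of _ a]) auto
qed

end
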